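(* Let $\Lambda$ be a finite or countably infinite set with at least two elements and let $A=(A_{x,y})_{x,y\in\Lambda}$ be the conservative generator of a continuous-time Markov chain $(X_t)_{t\in[0,\infty)}$ on $\Lambda$. Fix a finite subset $R$ of $\Lambda$ and sites $a,b\in R$. Then, for every $T>0$ and for every bounded measurable function $F:\mathcal{M}_T^+(R)\to\mathbb{R}$, $$\mathbb{E}_a\big[F(\ell_T)\,\mathbb{1}_{\{X_T=b\}}\,\mathbb{1}_{\{R_T=R\}}\big]=\int_{\mathcal{M}_T^+(R)}F(l)\,\rho_{ab}^{(R)}(l)\,\sigma_T(dl),$$ where, for $l\in\mathcal{M}_T^+(R)$, $$\rho_{ab}^{(R)}(l)=\det\nolimits_{ab}^{(R)}(-A+\partial_l)\int_{[0,2\pi]^R}e^{\sum_{x,y\in R}A_{x,y}\sqrt{l_x}\sqrt{l_y}\,e^{\mathrm{i}(\theta_x-\theta_y)}}\prod_{x\in R}\frac{d\theta_x}{2\pi}.$$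
   Context: $A$ is a conservative generator ($Q$-matrix): $A_{x,y}\ge 0$ for $x\neq y$, and each row sums to $0$. Under $\mathbb{P}_a$ (expectation $\mathbb{E}_a$) the chain starts at $X_0=a$. Local times: $\ell_T(x)=\int_0^T\mathbb{1}_{\{X_s=x\}}\,ds$ for $x\in\Lambda$, $T>0$. Range: $R_T=\mathrm{supp}(\ell_T)=\{X_s:s\in[0,T]\}\subseteq\Lambda$. On $\{R_T=R\}$, $F(\ell_T)$ means $F((\ell_T(x))_{x\in R})$. $\mathcal{M}_T^+(R)=\{l:R\to(0,\infty)\mid\sum_{x\in R}l(x)=T\}$; we write $l_x=l(x)$. $\sigma_T$ is the Lebesgue measure on $\mathcal{M}_T^+(R)$ normalized by the disintegration $\int_{(0,\infty)^R}d^Rl\,F(l)=\int_0^\infty dT\int_{\mathcal{M}_T^+(R)}\sigma_T(dl)\,F(l)$ for bounded continuous compactly supported $F:(0,\infty)^R\to\mathbb{R}$ (i.e. for any $x_0\in R$, it is Lebesgue measure in the coordinates $(l_x)_{x\in R\setminus\{x_0\}}$, with $l_{x_0}=T-\sum_{x\ne x_0}l_x$). For a matrix $M=(M_{x,y})_{x,y\in\Lambda}$ and $a,b\in R$, $\det_{ab}^{(R)}(M)$ denotes the $(b,a)$ cofactor of the $R\times R$ submatrix of $M$, namely the determinant of the matrix $(\mathbb{1}_{x\neq b}M_{x,y}\mathbb{1}_{y\neq a}+\mathbb{1}_{x=b,y=a})_{x,y\in R}$. $\partial_l$ denotes the diagonal matrix with $(x,x)$-entry the partial derivative $\partial_{l_x}$.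 Hence $\det_{ab}^{(R)}(-A+\partial_l)$, obtained by expanding the determinant, is a linear differential operator with constant coefficients in the variables $l_x$, $x\in R$; it is applied to the integral regarded as a function of $l\in(0,\infty)^R$, and the result is then evaluated at $l\in\mathcal{M}_T^+(R)$. *)

theory Defs
  imports "HOL-Probability.Probability" "HOL-Library.Poly_Mapping"
begin

text \<open>The countable state space \<open>\<Lambda>\<close> is the type \<open>'a::countable\<close>.\<close>

definition conservative_generator :: "('a::countable \<Rightarrow> 'a \<Rightarrow> real) \<Rightarrow> bool" where
  "conservative_generator A \<longleftrightarrow>
     (\<forall>x y. x \<noteq> y \<longrightarrow> 0 \<le> A x y) \<and> (\<forall>x. (A x has_sum 0) UNIV)"

text \<open>
  \<open>P a\<close> is the law under which the chain starts at \<open>a\<close>; only \<open>X t\<close> with \<open>t \<ge> 0\<close> matters.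
  Right-continuity refers to the discrete topology on the state space, and
  \<open>generator\<close> says that \<open>A\<close> is the derivative at time zero of the transition function
  \<open>t \<mapsto> P x (X t = y)\<close>.
\<close>

locale continuous_time_markov_chain =
  fixes A :: "'a::countable \<Rightarrow> 'a \<Rightarrow> real"
    and P :: "'a \<Rightarrow> 'w measure"
    and X :: "real \<Rightarrow> 'w \<Rightarrow> 'a"
  assumes conservative: "conservative_generator A"
    and prob_space_P: "\<And>a. prob_space (P a)"
    and sets_P: "\<And>a a'. sets (P a) = sets (P a')"
    and measurable_X: "\<And>a t. 0 \<le> t \<Longrightarrow> X t \<in> measurable (P a) (count_space UNIV)"
    and right_continuous:
      "\<And>a t \<omega>. \<omega> \<in> space (P a) \<Longrightarrow> 0 \<le> t \<Longrightarrow>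
         eventually (\<lambda>s. X s \<omega> = X t \<omega>) (at_right t)"
    and start: "\<And>a. AE \<omega> in P a. X 0 \<omega> = a"
    and markov:
      "\<And>a n t s x y. strict_mono_on {..n::nat} t \<Longrightarrow> 0 \<le> t 0 \<Longrightarrow> 0 \<le> s \<Longrightarrow>
         measure (P a) {\<omega> \<in> space (P a). (\<forall>i\<le>n. X (t i) \<omega> = x i) \<and> X (t n + s) \<omega> = y} =
         measure (P a) {\<omega> \<in> space (P a). \<forall>i\<le>n. X (t i) \<omega> = x i} *
         measure (P (x n)) {\<omega> \<in> space (P (x n)). X s \<omega> = y}"
    and generator:
      "\<And>x y. ((\<lambda>t. measure (P x) {\<omega> \<in> space (P x). X t \<omega> = y})
         has_real_derivative A x y) (at 0 within {0..})"

definition local_time :: "(real \<Rightarrow> 'w \<Rightarrow> 'a) \<Rightarrow> real \<Rightarrow> 'w \<Rightarrow> 'a \<Rightarrow> real" where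
  "local_time X T \<omega> x = (LINT s:{0..T}|lborel. indicator {x} (X s \<omega>))"

text \<open>
  The range is the support of the local times. It differs from \<open>{X s \<omega> | s. s \<in> {0..T}}\<close>
  at most by the point \<open>X T \<omega>\<close> (see \<open>image_eq_insert_chain_range\<close> below), and not at all if
  \<open>X T \<omega> \<in> chain_range X T \<omega>\<close>. The choice of the support makes the local
  times strictly positive on the whole range, without exceptional null set.
\<close>

definition chain_range :: "(real \<Rightarrow> 'w \<Rightarrow> 'a) \<Rightarrow> real \<Rightarrow> 'w \<Rightarrow> 'a set" where
  "chain_range X T \<omega> = {x. local_time X T \<omega> x \<noteq> 0}"

definition pos_simplex :: "'a set \<Rightarrow> real \<Rightarrow> ('a \<Rightarrow> real) set" where
  "pos_simplex R T = {l \<in> R \<rightarrow>\<^sub>E {0<..}. (\<Sum>x\<in>R. l x) = T}"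

text \<open>
  Lebesgue measure on the simplex in the coordinates \<open>(l x)\<close>, \<open>x \<in> R - {x0}\<close>. For \<open>R = {x0}\<close>
  it is the unit mass at \<open>l x0 = T\<close>.
\<close>

definition simplex_measure_coord ::
    "'a \<Rightarrow> 'a set \<Rightarrow> real \<Rightarrow> ('a \<Rightarrow> real) measure" where
  "simplex_measure_coord x0 R T =
     restrict_space
       (distr (\<Pi>\<^sub>M x\<in>R - {x0}. lborel) (\<Pi>\<^sub>M x\<in>R. borel)
          (\<lambda>l. l(x0 := T - (\<Sum>x\<in>R - {x0}. l x))))
       (pos_simplex R T)"

text \<open>
  The choice of \<open>x0\<close> is immaterial (\<open>simplex_measure_eq_coord\<close> below), and these measures
  disintegrate Lebesgue measure on the positive orthant (\<open>simplex_measure_disintegration\<close>).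
\<close>

definition simplex_measure :: "'a set \<Rightarrow> real \<Rightarrow> ('a \<Rightarrow> real) measure" where
  "simplex_measure R T = simplex_measure_coord (SOME x0. x0 \<in> R) R T"

definition det_on :: "'a set \<Rightarrow> ('a \<Rightarrow> 'a \<Rightarrow> 'r::comm_ring_1) \<Rightarrow> 'r" where
  "det_on R M = (\<Sum>\<pi> | \<pi> permutes R. of_int (sign \<pi>) * (\<Prod>x\<in>R. M x (\<pi> x)))"

definition cofactor_on :: "'a set \<Rightarrow> 'a \<Rightarrow> 'a \<Rightarrow> ('a \<Rightarrow> 'a \<Rightarrow> 'r::comm_ring_1) \<Rightarrow> 'r" where
  "cofactor_on R a b M =
     det_on R (\<lambda>x y. of_bool (x \<noteq> b) * M x y * of_bool (y \<noteq> a) + of_bool (x = b \<and> y = a))"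

text \<open>
  A constant-coefficient differential operator in the variables \<open>l x\<close> is represented by its
  symbol, a real polynomial whose indeterminate with index \<open>x\<close> stands for
  \<open>\<partial>/\<partial>l x\<close>. Polynomials are finitely supported functions on monomials, and monomials
  are finitely supported exponent functions.
\<close>

type_synonym 'a symbol = "('a \<Rightarrow>\<^sub>0 nat) \<Rightarrow>\<^sub>0 real"

definition symbol_const :: "real \<Rightarrow> 'a symbol" where
  "symbol_const c = Poly_Mapping.single 0 c"

definition symbol_partial :: "'a \<Rightarrow> 'a symbol" where
  "symbol_partial x = Poly_Mapping.single (Poly_Mapping.single x 1) 1"

definition partial_deriv ::
    "'a \<Rightarrow> (('a \<Rightarrow> real) \<Rightarrow> complex) \<Rightarrow> ('a \<Rightarrow> real) \<Rightarrow> complex" where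
  "partial_deriv x f l = vector_derivative (\<lambda>t. f (l(x := t))) (at (l x))"

text \<open>
  Iterated partial derivatives need some order of differentiation; the one induced by
  \<open>to_nat\<close> is used, which is immaterial for smooth functions.
\<close>

definition monomial_deriv ::
    "('a::countable \<Rightarrow>\<^sub>0 nat) \<Rightarrow> (('a \<Rightarrow> real) \<Rightarrow> complex) \<Rightarrow> ('a \<Rightarrow> real) \<Rightarrow> complex" where
  "monomial_deriv m f =
     foldr (\<lambda>x. partial_deriv x ^^ Poly_Mapping.lookup m x)
       (sorted_key_list_of_set to_nat (Poly_Mapping.keys m)) f"

definition apply_symbol ::
    "'a::countable symbol \<Rightarrow> (('a \<Rightarrow> real) \<Rightarrow> complex) \<Rightarrow> ('a \<Rightarrow> real) \<Rightarrow> complex" where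
  "apply_symbol p f l =
     (\<Sum>m\<in>Poly_Mapping.keys p. complex_of_real (Poly_Mapping.lookup p m) * monomial_deriv m f l)"

definition angular_integral :: "('a \<Rightarrow> 'a \<Rightarrow> real) \<Rightarrow> 'a set \<Rightarrow> ('a \<Rightarrow> real) \<Rightarrow> complex" where
  "angular_integral A R l =
     (LINT \<theta>:(R \<rightarrow>\<^sub>E {0..2 * pi})|(\<Pi>\<^sub>M x\<in>R. lborel).
        exp (\<Sum>x\<in>R. \<Sum>y\<in>R. complex_of_real (A x y * sqrt (l x) * sqrt (l y)) *
               exp (\<i> * complex_of_real (\<theta> x - \<theta> y))) /
        complex_of_real ((2 * pi) ^ card R))"

definition local_time_density ::
    "('a::countable \<Rightarrow> 'a \<Rightarrow> real) \<Rightarrow> 'a set \<Rightarrow> 'a \<Rightarrow> 'a \<Rightarrow> ('a \<Rightarrow> real) \<Rightarrow> complex" where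
  "local_time_density A R a b =
     apply_symbol
       (cofactor_on R a b
          (\<lambda>x y. - symbol_const (A x y) + (if x = y then symbol_partial x else 0)))
       (angular_integral A R)"

lemma image_eq_insert_chain_range:
  assumes rc: "\<And>t. 0 \<le> t \<Longrightarrow> eventually (\<lambda>s. X s \<omega> = X t \<omega>) (at_right t)" and "0 < T"
  shows "(\<lambda>s. X s \<omega>) ` {0..T} = insert (X T \<omega>) (chain_range X T \<omega>)"
proof -
  have integrable: "integrable lborel (\<lambda>s. indicator {0..T} s * indicator {x} (X s \<omega>) :: real)" for x
  proof -
    define q :: "nat \<Rightarrow> real \<Rightarrow> real" where
      "q n s = (of_int \<lfloor>s * real (Suc n)\<rfloor> + 1) / real (Suc n)" for n s
    have q_bounds: "s < q n s" "q n s \<le> s + inverse (real (Suc n))" for n s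
    proof -
      define k where "k = real (Suc n)"
      have "0 < k" by (simp add: k_def)
      then show "s < q n s" "q n s \<le> s + inverse (real (Suc n))"
        using floor_correct[of "s * k"] unfolding q_def k_def[symmetric]
        by (simp_all add: field_simps)
    qed
    have lim: "(\<lambda>n. q n s) \<longlonglongrightarrow> s" for s
    proof (rule tendsto_sandwich[OF _ _ tendsto_const])
      show "(\<lambda>n. s + inverse (real (Suc n))) \<longlonglongrightarrow> s"
        using tendsto_add[OF tendsto_const[of s] LIMSEQ_inverse_real_of_nat] by simp
    qed (use q_bounds in \<open>auto intro!: always_eventually less_imp_le\<close>)
    have at_right: "filterlim (\<lambda>n. q n s) (at_right s) sequentially" for s
      unfolding filterlim_at
      using lim[of s] q_bounds(1)[of s] by (auto intro!: always_eventually) (metis less_irrefl)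
    have "(\<lambda>s. indicator {0..T} s * indicator {x} (X s \<omega>) :: real) \<in> borel_measurable lborel"
    proof (rule borel_measurable_LIMSEQ_real)
      show "(\<lambda>n. indicator {0..T} s * indicator {x} (X (q n s) \<omega>) :: real)
          \<longlonglongrightarrow> indicator {0..T} s * indicator {x} (X s \<omega>)" for s
      proof (cases "0 \<le> s")
        case True
        have "eventually (\<lambda>n. X (q n s) \<omega> = X s \<omega>) sequentially"
          using filterlim_iff[THEN iffD1, OF at_right] rc[OF True] by blast
        then have "eventually (\<lambda>n. indicator {0..T} s * indicator {x} (X (q n s) \<omega>) =
            (indicator {0..T} s * indicator {x} (X s \<omega>) :: real)) sequentially"
          by (rule eventually_mono) simp
        then show ?thesis by (rule tendsto_eventually)
      qed simp
      show "(\<lambda>s. indicator {0..T} s * indicator {x} (X (q n s) \<omega>) :: real) \<in> borel_measurable lborel" for n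
      proof -
        have "(\<lambda>s. indicator {x} (X (q n s) \<omega>) :: real) =
            (\<lambda>k. indicator {x} (X ((of_int k + 1) / real (Suc n)) \<omega>)) \<circ> (\<lambda>s. \<lfloor>s * real (Suc n)\<rfloor>)"
          by (simp add: q_def fun_eq_iff)
        also have "\<dots> \<in> borel_measurable borel"
          by (rule measurable_comp[of _ _ "count_space UNIV"]) measurable
        finally show ?thesis by measurable
      qed
    qed
    then show ?thesis
      by (rule integrableI_bounded_set[where A = "{0..T}" and B = 1, rotated 1])
        (use assms(2) in \<open>auto simp: indicator_def emeasure_lborel_Icc\<close>)
  qed
  have pos: "X t \<omega> \<in> chain_range X T \<omega>" if t: "0 \<le> t" "t < T" for t
  proof -
    obtain u where u: "t < u" "\<And>s. t < s \<Longrightarrow> s < u \<Longrightarrow> X s \<omega> = X t \<omega>"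
      using rc[OF t(1)] unfolding eventually_at_right_field by blast
    define v where "v = min u T"
    have "0 < v - t" using u t by (simp add: v_def)
    also have "v - t = (LINT s|lborel. indicator {t<..<v} s)"
      using u t by (simp add: v_def)
    also have "\<dots> \<le> (LINT s|lborel. indicator {0..T} s * indicator {X t \<omega>} (X s \<omega>))"
    proof (rule integral_mono[OF _ integrable])
      show "integrable lborel (indicator {t<..<v} :: real \<Rightarrow> real)"
        by (rule integrable_real_indicator) (use \<open>0 < v - t\<close> in \<open>auto simp: emeasure_lborel_Ioo\<close>)
    qed (use u t in \<open>auto simp: v_def indicator_def\<close>)
    finally show ?thesis
      by (simp add: chain_range_def local_time_def set_lebesgue_integral_def)
  qed
  have "chain_range X T \<omega> \<subseteq> (\<lambda>s. X s \<omega>) ` {0..T}"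
  proof
    fix x assume "x \<in> chain_range X T \<omega>"
    then have "(LINT s|lborel. indicator {0..T} s *\<^sub>R indicator {x} (X s \<omega>)) \<noteq> (0 :: real)"
      by (simp add: chain_range_def local_time_def set_lebesgue_integral_def)
    then have "\<not> (\<forall>s. indicator {0..T} s *\<^sub>R indicator {x} (X s \<omega>) = (0 :: real))"
      by (rule contrapos_nn) (simp only: Bochner_Integration.integral_zero)
    then obtain s where "indicator {0..T} s *\<^sub>R indicator {x} (X s \<omega>) \<noteq> (0 :: real)"
      by blast
    then have "s \<in> {0..T}" "X s \<omega> = x"
      by (auto simp only: indicator_def of_bool_def singleton_iff scaleR_zero_left scaleR_zero_right split: if_splits)
    then show "x \<in> (\<lambda>s. X s \<omega>) ` {0..T}" by blast
  qed
  moreover have "X T \<omega> \<in> (\<lambda>s. X s \<omega>) ` {0..T}" using assms(2) by simp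
  moreover have "X t \<omega> \<in> insert (X T \<omega>) (chain_range X T \<omega>)" if "t \<in> {0..T}" for t
    using pos[of t] that by (cases "t = T") auto
  ultimately show ?thesis by blast
qed

lemma pos_simplex_measurable:
  assumes "finite R"
  shows "pos_simplex R T \<in> sets (\<Pi>\<^sub>M x\<in>R. borel)"
proof -
  have "pos_simplex R T =
      {l \<in> space (\<Pi>\<^sub>M x\<in>R. borel). (\<forall>x\<in>R. 0 < l x) \<and> (\<Sum>x\<in>R. l x) = T}"
    by (auto simp: pos_simplex_def space_PiM PiE_def Pi_def)
  also have "\<dots> \<in> sets (\<Pi>\<^sub>M x\<in>R. borel)"
    using assms by measurable
  finally show ?thesis .
qed

lemma coord_map_measurable:
  fixes R :: "'a set"
  assumes "x0 \<in> R"
  shows "(\<lambda>(l, t :: real). l(x0 := t - (\<Sum>x\<in>R - {x0}. l x)))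
    \<in> measurable ((\<Pi>\<^sub>M x\<in>R - {x0}. lborel) \<Otimes>\<^sub>M borel) (\<Pi>\<^sub>M x\<in>R. borel)"
proof -
  have R: "insert x0 (R - {x0}) = R" using assms by auto
  have "(\<lambda>z. (fst z, snd z - (\<Sum>x\<in>R - {x0}. fst z x)))
     \<in> measurable ((\<Pi>\<^sub>M x\<in>R - {x0}. lborel) \<Otimes>\<^sub>M borel) ((\<Pi>\<^sub>M x\<in>R - {x0}. (borel :: real measure)) \<Otimes>\<^sub>M borel)"
    by (intro measurable_Pair) (simp_all cong: sets_PiM_cong)
  from measurable_compose[OF this measurable_add_dim[of x0 "R - {x0}" "\<lambda>_. borel"]]
  show ?thesis by (simp only: R case_prod_beta' fst_conv snd_conv)
qed

lemma coord_map_measurable':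
  fixes R :: "'a set"
  assumes "x0 \<in> R"
  shows "(\<lambda>l. l(x0 := (t :: real) - (\<Sum>x\<in>R - {x0}. l x)))
    \<in> measurable (\<Pi>\<^sub>M x\<in>R - {x0}. lborel) (\<Pi>\<^sub>M x\<in>R. borel)"
  using measurable_compose[OF measurable_Pair2'[of t borel] coord_map_measurable[OF assms]]
  by simp

lemma nn_integral_coord:
  assumes "finite R" "x0 \<in> R" and [measurable]: "f \<in> borel_measurable (\<Pi>\<^sub>M x\<in>R. borel)"
  shows "(\<integral>\<^sup>+l. f l \<partial>simplex_measure_coord x0 R T) =
    (\<integral>\<^sup>+l. (\<lambda>l. f l * indicator (pos_simplex R T) l) (l(x0 := T - (\<Sum>x\<in>R - {x0}. l x)))
       \<partial>(\<Pi>\<^sub>M x\<in>R - {x0}. lborel))"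
proof -
  note [measurable] = pos_simplex_measurable[OF assms(1)] coord_map_measurable'[OF assms(2)]
  show ?thesis
    unfolding simplex_measure_coord_def
    by (subst nn_integral_restrict_space) (auto simp: nn_integral_distr)
qed

lemma nn_integral_reflect:
  fixes c :: real
  assumes "f \<in> borel_measurable borel"
  shows "(\<integral>\<^sup>+y. f y \<partial>lborel) = (\<integral>\<^sup>+y. f (c - y) \<partial>lborel)"
  using nn_integral_real_affine[OF assms, of "-1" c] by simp

lemma coord_indep:
  fixes R :: "'a set" and f :: "('a \<Rightarrow> real) \<Rightarrow> ennreal"
  assumes "finite R" "x0 \<in> R" "x1 \<in> R"
    and [measurable]: "f \<in> borel_measurable (\<Pi>\<^sub>M x\<in>R. borel)"
  shows "(\<integral>\<^sup>+l. f (l(x0 := T - (\<Sum>x\<in>R - {x0}. l x))) \<partial>(\<Pi>\<^sub>M x\<in>R - {x0}. lborel)) =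
    (\<integral>\<^sup>+l. f (l(x1 := T - (\<Sum>x\<in>R - {x1}. l x))) \<partial>(\<Pi>\<^sub>M x\<in>R - {x1}. lborel))"
proof (cases "x0 = x1")
  case False
  interpret product_sigma_finite "\<lambda>_ :: 'a. lborel :: real measure" by standard
  define S where "S = R - {x0, x1}"
  have S: "finite S" "x0 \<notin> S" "x1 \<notin> S" "R - {x0} = insert x1 S" "R - {x1} = insert x0 S"
      "insert x0 (insert x1 S) = R"
    using assms False by (auto simp: S_def)
  have m: "(\<lambda>l. f (l(z := T - (\<Sum>x\<in>R - {z}. l x)))) \<in> borel_measurable (\<Pi>\<^sub>M x\<in>R - {z}. lborel)"
    if "z \<in> R" for z
    using measurable_compose[OF coord_map_measurable'[OF that] assms(4)] .
  have sum: "(\<Sum>x\<in>S. if x = z then y else l x) = (\<Sum>x\<in>S. l x)" if "z \<notin> S" for l :: "_ \<Rightarrow> real" and z y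
    using that by (intro sum.cong) auto
  have "(\<integral>\<^sup>+l. f (l(x0 := T - (\<Sum>x\<in>R - {x0}. l x))) \<partial>(\<Pi>\<^sub>M x\<in>R - {x0}. lborel)) =
    (\<integral>\<^sup>+l. \<integral>\<^sup>+y. f (l(x1 := y, x0 := T - (y + (\<Sum>x\<in>S. l x)))) \<partial>lborel \<partial>(\<Pi>\<^sub>M x\<in>S. lborel))"
    using m[OF assms(2)] S(1-3) unfolding S(4)
    by (subst product_nn_integral_insert) (simp_all add: sum)
  also have "\<dots> = (\<integral>\<^sup>+l. \<integral>\<^sup>+y. f (l(x0 := y, x1 := T - (y + (\<Sum>x\<in>S. l x)))) \<partial>lborel \<partial>(\<Pi>\<^sub>M x\<in>S. lborel))"
  proof (rule nn_integral_cong)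
    fix l :: "'a \<Rightarrow> real" assume l: "l \<in> space (\<Pi>\<^sub>M x\<in>S. lborel)"
    let ?g = "\<lambda>l. f (l(x0 := T - (\<Sum>x\<in>insert x1 S. l x)))"
    have "(\<lambda>y. l(x1 := y)) \<in> measurable lborel (\<Pi>\<^sub>M x\<in>insert x1 S. lborel)"
      using measurable_component_update[OF l S(3)] .
    from measurable_compose[OF this m[OF assms(2), unfolded S(4)]]
    have "(\<lambda>y. f (l(x1 := y, x0 := T - (y + (\<Sum>x\<in>S. l x))))) \<in> borel_measurable borel"
      using S(1-3) by (simp add: sum)
    from nn_integral_reflect[OF this, of "T - (\<Sum>x\<in>S. l x)"]
    show "(\<integral>\<^sup>+y. f (l(x1 := y, x0 := T - (y + (\<Sum>x\<in>S. l x)))) \<partial>lborel) =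
      (\<integral>\<^sup>+y. f (l(x0 := y, x1 := T - (y + (\<Sum>x\<in>S. l x)))) \<partial>lborel)"
      using False by (simp add: fun_upd_twist algebra_simps)
  qed
  also have "\<dots> = (\<integral>\<^sup>+l. f (l(x1 := T - (\<Sum>x\<in>R - {x1}. l x))) \<partial>(\<Pi>\<^sub>M x\<in>R - {x1}. lborel))"
    using m[OF assms(3)] S(1-3) unfolding S(5)
    by (subst product_nn_integral_insert) (simp_all add: sum)
  finally show ?thesis .
qed simp

lemma sets_coord: "sets (simplex_measure_coord x0 R T) = sets (restrict_space (\<Pi>\<^sub>M x\<in>R. borel) (pos_simplex R T))"
  by (simp add: simplex_measure_coord_def sets_restrict_space)

lemma simplex_measure_eq_coord:
  assumes "finite R" "x0 \<in> R"
  shows "simplex_measure R T = simplex_measure_coord x0 R T"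
proof (rule measure_eqI)
  let ?z = "SOME x. x \<in> R"
  have z: "?z \<in> R" using assms by (metis someI)
  show "sets (simplex_measure R T) = sets (simplex_measure_coord x0 R T)"
    by (simp add: simplex_measure_def sets_coord)
  fix B assume "B \<in> sets (simplex_measure R T)"
  then have B: "B \<in> sets (restrict_space (\<Pi>\<^sub>M x\<in>R. borel) (pos_simplex R T))"
    by (simp add: simplex_measure_def sets_coord)
  have B'[measurable]: "B \<in> sets (\<Pi>\<^sub>M x\<in>R. borel)"
    using B pos_simplex_measurable[OF assms(1)] by (subst (asm) sets_restrict_space_iff) auto
  note [measurable] = pos_simplex_measurable[OF assms(1)]
  have e: "emeasure (simplex_measure_coord w R T) B = (\<integral>\<^sup>+l. indicator B l \<partial>simplex_measure_coord w R T)" for w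
    using B by (intro nn_integral_indicator[symmetric]) (simp add: sets_coord)
  show "emeasure (simplex_measure R T) B = emeasure (simplex_measure_coord x0 R T) B"
    unfolding e simplex_measure_def
    apply (subst nn_integral_coord[OF assms(1) z], measurable)
    apply (subst nn_integral_coord[OF assms], measurable)
    apply (rule coord_indep[OF assms(1) z assms(2)])
    apply measurable
    done
qed

lemma simplex_measure_disintegration:
  fixes R :: "'a set"
  assumes "finite R" "R \<noteq> {}" and f[measurable]: "f \<in> borel_measurable (\<Pi>\<^sub>M x\<in>R. borel)"
  shows "(\<integral>\<^sup>+l\<in>(R \<rightarrow>\<^sub>E {0<..}). f l \<partial>(\<Pi>\<^sub>M x\<in>R. lborel)) =
         (\<integral>\<^sup>+T\<in>{0<..}. (\<integral>\<^sup>+l. f l \<partial>simplex_measure R T) \<partial>lborel)"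
proof -
  interpret product_sigma_finite "\<lambda>_ :: 'a. lborel :: real measure" by standard
  obtain x0 where x0: "x0 \<in> R" using assms by auto
  let ?S = "R - {x0}"
  interpret S: finite_product_sigma_finite "\<lambda>_ :: 'a. lborel :: real measure" ?S
    by standard (use assms in auto)
  interpret pair_sigma_finite "\<Pi>\<^sub>M x\<in>?S. (lborel :: real measure)" "lborel :: real measure"
    by standard
  define g where "g l = f l * indicator (R \<rightarrow>\<^sub>E {0<..}) l" for l
  have O: "(R \<rightarrow>\<^sub>E {0<..}) \<in> sets (\<Pi>\<^sub>M x\<in>R. (borel :: real measure))"
    using assms(1) by (intro sets_PiM_I_finite) auto
  then have g[measurable]: "g \<in> borel_measurable (\<Pi>\<^sub>M x\<in>R. borel)"
    unfolding g_def by measurable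
  have sR: "sets (\<Pi>\<^sub>M x\<in>R. lborel) = sets (\<Pi>\<^sub>M x\<in>R. (borel :: real measure))"
    by (simp cong: sets_PiM_cong)
  have gl: "g \<in> borel_measurable (\<Pi>\<^sub>M x\<in>R. lborel)"
    using g by (simp cong: measurable_cong_sets add: measurable_cong_sets[OF sR refl])
  have R: "insert x0 ?S = R" using x0 by auto
  let ?h = "\<lambda>l t. g (l(x0 := t - (\<Sum>x\<in>?S. l x)))"
  have h: "(\<lambda>(l, t). ?h l t) \<in> borel_measurable ((\<Pi>\<^sub>M x\<in>?S. lborel) \<Otimes>\<^sub>M lborel)"
    using measurable_compose[OF coord_map_measurable[OF x0] g]
    by (simp add: case_prod_beta' cong: measurable_cong_sets sets_pair_measure_cong)
  have "(\<integral>\<^sup>+l\<in>(R \<rightarrow>\<^sub>E {0<..}). f l \<partial>(\<Pi>\<^sub>M x\<in>R. lborel)) = (\<integral>\<^sup>+l. g l \<partial>(\<Pi>\<^sub>M x\<in>R. lborel))"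
    by (simp add: g_def)
  also have "\<dots> = (\<integral>\<^sup>+l. \<integral>\<^sup>+y. g (l(x0 := y)) \<partial>lborel \<partial>(\<Pi>\<^sub>M x\<in>?S. lborel))"
    using product_nn_integral_insert[of ?S x0 g] assms(1) gl by (simp only: R) simp
  also have "\<dots> = (\<integral>\<^sup>+l. \<integral>\<^sup>+t. ?h l t \<partial>lborel \<partial>(\<Pi>\<^sub>M x\<in>?S. lborel))"
  proof (rule nn_integral_cong)
    fix l :: "'a \<Rightarrow> real" assume l: "l \<in> space (\<Pi>\<^sub>M x\<in>?S. lborel)"
    have "(\<lambda>y. l(x0 := y)) \<in> measurable lborel (\<Pi>\<^sub>M x\<in>R. lborel)"
      using measurable_component_update[OF l, of x0] by (simp only: R) simp
    from measurable_compose[OF this gl]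
    have "(\<lambda>y. g (l(x0 := y))) \<in> borel_measurable borel" by simp
    from nn_integral_real_affine[OF this, of 1 "- (\<Sum>x\<in>?S. l x)"]
    show "(\<integral>\<^sup>+y. g (l(x0 := y)) \<partial>lborel) = (\<integral>\<^sup>+t. ?h l t \<partial>lborel)" by simp
  qed
  also have "\<dots> = (\<integral>\<^sup>+t. \<integral>\<^sup>+l. ?h l t \<partial>(\<Pi>\<^sub>M x\<in>?S. lborel) \<partial>lborel)"
    using Fubini'[OF h] by simp
  also have "\<dots> = (\<integral>\<^sup>+T\<in>{0<..}. (\<integral>\<^sup>+l. f l \<partial>simplex_measure R T) \<partial>lborel)"
  proof (rule nn_integral_cong)
    fix T :: real
    have sum: "(\<Sum>x\<in>R. (l(x0 := T - (\<Sum>x\<in>?S. l x))) x) = T" for l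
    proof -
      have "(\<Sum>x\<in>?S. (l(x0 := T - (\<Sum>x\<in>?S. l x))) x) = (\<Sum>x\<in>?S. l x)"
        by (rule sum.cong) auto
      then show ?thesis using sum.remove[OF assms(1) x0, of "l(x0 := T - (\<Sum>x\<in>?S. l x))"] by simp
    qed
    have *: "indicator (R \<rightarrow>\<^sub>E {0<..}) (l(x0 := T - (\<Sum>x\<in>?S. l x))) =
        (indicator (pos_simplex R T) (l(x0 := T - (\<Sum>x\<in>?S. l x))) :: ennreal)" for l
      using sum[of l] by (simp add: pos_simplex_def indicator_def)
    have "pos_simplex R T = {}" if "T \<le> 0"
    proof -
      have "0 < (\<Sum>x\<in>R. l x)" if "l \<in> R \<rightarrow>\<^sub>E {0<..}" for l :: "'a \<Rightarrow> real"
        using that assms(1,2) by (intro sum_pos) auto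
      with that show ?thesis by (force simp: pos_simplex_def)
    qed
    then have **: "indicator (pos_simplex R T) l * indicator {0<..} T = (indicator (pos_simplex R T) l :: ennreal)" for l
      by (cases "T \<le> 0") auto
    note [measurable] = pos_simplex_measurable[OF assms(1)] coord_map_measurable'[OF x0]
    show "(\<integral>\<^sup>+l. ?h l T \<partial>(\<Pi>\<^sub>M x\<in>?S. lborel)) = (\<integral>\<^sup>+l. f l \<partial>simplex_measure R T) * indicator {0<..} T"
      unfolding simplex_measure_eq_coord[OF assms(1) x0] nn_integral_coord[OF assms(1) x0 f]
      by (subst nn_integral_multc[symmetric]) (simp_all add: g_def * ** mult.assoc)
  qed
  finally show ?thesis .
qed

end

theory Submission
  imports Defs "HOL-Complex_Analysis.Cauchy_Integral_Formula"
begin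

text \<open>
The angular integral is an average over independent uniform phases. Moving each phase
\<open>\<theta>\<^sub>x\<close> to \<open>\<theta>\<^sub>x - (\<i>/2) ln l\<^sub>x\<close>, which does not change the average of a periodic analytic
function, turns the exponent into \<open>\<Sum>\<^sub>x l\<^sub>x u\<^sub>x\<close> with
\<open>u\<^sub>x = e\<^bsup>\<i>\<theta>x\<^esup> (\<Sum>\<^sub>y A\<^sub>x\<^sub>y e\<^bsup>-\<i>\<theta>y\<^esup>)\<close>. This is linear in \<open>l\<close>, so \<open>\<partial>\<^sub>x\<close> acts under the
average as multiplication by \<open>u\<^sub>x\<close>, and the density is the phase average of
\<open>det\<^sub>a\<^sub>b(diag u - A) exp(\<Sum>\<^sub>x l\<^sub>x u\<^sub>x)\<close> (\<open>local_time_density_eq_phase_density\<close>).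

Two facts about the matrix \<open>N = diag u - A\<close> carry the argument.
It annihilates the vector \<open>(e\<^bsup>-\<i>\<theta>x\<^esup>)\<close>, hence \<open>det N = 0\<close>, and the adjugate
identity becomes \<open>u\<^sub>b det\<^sub>a\<^sub>b N = \<Sum>\<^sub>c det\<^sub>a\<^sub>c N A\<^sub>c\<^sub>b\<close>: in the interior of the simplex the
densities satisfy the forward equation of the chain. At \<open>l\<^sub>b = 0\<close> the integrand is, apart
from the deleted row \<open>b\<close>, an entire function of \<open>e\<^bsup>-\<i>\<theta>b\<^esup>\<close>, so that its average is its value at
zero; expanding the cofactor along column \<open>b\<close> gives
\<open>\<Sum>\<^sub>c \<rho>\<^sub>a\<^sub>c A\<^sub>c\<^sub>b\<close> for the range without \<open>b\<close>: the flux through the face \<open>l\<^sub>b = 0\<close> is the rate at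
which the chain discovers \<open>b\<close> (\<open>integral_boundary_phase\<close>). Therefore the masses of the
densities, summed over all ranges inside \<open>R\<close>, solve \<open>Q' = Q A\<close> with \<open>Q(0) = 1\<close>
(\<open>total_mass_has_vector_derivative\<close>, \<open>total_mass_0\<close>).

A weight \<open>exp(-\<Sum>\<^sub>x v\<^sub>x l\<^sub>x)\<close> only replaces \<open>A\<close> by \<open>A - diag v\<close>, so the same equation governs
the Laplace transforms. On the probabilistic side, the expectation of
\<open>exp(-\<Sum>\<^sub>x v\<^sub>x \<ell>\<^sub>T(x))\<close> over paths that stay in \<open>R\<close> and end at \<open>b\<close> is a limit over time grids. On a
grid the Markov property yields products of one-step matrices, that is, an Euler scheme for
that very equation (\<open>laplace_transform_stays\<close>). Removing the smaller ranges by induction leaves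
the event that the range is exactly \<open>R\<close> (\<open>laplace_transform_range\<close>), and Laplace
transforms determine the law (\<open>laplace_transform_unique\<close>).
\<close>

section \<open>Determinants and cofactors on finite index sets\<close>

definition set_col :: "'a \<Rightarrow> ('a \<Rightarrow> 'r) \<Rightarrow> ('a \<Rightarrow> 'a \<Rightarrow> 'r) \<Rightarrow> 'a \<Rightarrow> 'a \<Rightarrow> 'r" where
  "set_col a v M x y = (if y = a then v x else M x y)"

lemma prod_set_col:
  fixes M :: "'a \<Rightarrow> 'a \<Rightarrow> 'r::comm_ring_1"
  assumes "finite R" "a \<in> R" "\<pi> permutes R"
  shows "(\<Prod>x\<in>R. set_col a v M x (\<pi> x)) =
    v (inv \<pi> a) * (\<Prod>x\<in>R - {inv \<pi> a}. M x (\<pi> x))"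
proof -
  have c: "inv \<pi> a \<in> R" "\<pi> (inv \<pi> a) = a"
    using assms permutes_inv permutes_in_image permutes_inverses(1) by metis+
  have "(\<Prod>x\<in>R - {inv \<pi> a}. set_col a v M x (\<pi> x)) = (\<Prod>x\<in>R - {inv \<pi> a}. M x (\<pi> x))"
    using assms(3) by (intro prod.cong) (auto simp: set_col_def permutes_inverses)
  then show ?thesis
    using prod.remove[OF assms(1) c(1), of "\<lambda>x. set_col a v M x (\<pi> x)"] c(2)
    by (simp add: set_col_def)
qed

text \<open>
A permutation that does not send \<open>c\<close> to \<open>a\<close> contributes zero to either side, so clearing row
\<open>c\<close> besides column \<open>a\<close> makes no difference. In this form the cofactor is linear in
column \<open>a\<close>.
\<close>

lemma cofactor_on_eq_det_on:
  fixes M :: "'a \<Rightarrow> 'a \<Rightarrow> 'r::comm_ring_1"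
  assumes "finite R" "a \<in> R" "c \<in> R"
  shows "cofactor_on R a c M = det_on R (set_col a (\<lambda>x. of_bool (x = c)) M)"
  unfolding cofactor_on_def det_on_def
proof (intro sum.cong refl arg_cong2[where f = "(*)"])
  fix \<pi> assume "\<pi> \<in> {\<pi>. \<pi> permutes R}"
  then have \<pi>: "\<pi> permutes R" by simp
  let ?L = "\<lambda>x. of_bool (x \<noteq> c) * M x (\<pi> x) * of_bool (\<pi> x \<noteq> a) + of_bool (x = c \<and> \<pi> x = a) :: 'r"
  show "(\<Prod>x\<in>R. ?L x) = (\<Prod>x\<in>R. set_col a (\<lambda>x. of_bool (x = c)) M x (\<pi> x))"
  proof (cases "\<pi> c = a")
    case True
    then have "\<pi> x \<noteq> a" if "x \<noteq> c" for x using that permutes_inj[OF \<pi>] by (metis injD)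
    with True show ?thesis by (intro prod.cong) (auto simp: set_col_def)
  next
    case False
    then have "inv \<pi> a \<noteq> c" using permutes_inverses(1)[OF \<pi>] by metis
    then have "(\<Prod>x\<in>R. set_col a (\<lambda>x. of_bool (x = c)) M x (\<pi> x)) = 0"
      by (simp add: prod_set_col[OF assms(1,2) \<pi>])
    moreover have "?L c = 0" using False by simp
    then have "(\<Prod>x\<in>R. ?L x) = 0" using prod.remove[OF assms(1,3), of ?L] by simp
    ultimately show ?thesis by simp
  qed
qed

lemma det_on_set_col:
  fixes M :: "'a \<Rightarrow> 'a \<Rightarrow> 'r::comm_ring_1"
  assumes "finite R" "a \<in> R"
  shows "det_on R (set_col a v M) = (\<Sum>c\<in>R. v c * cofactor_on R a c M)"
proof -
  have "(\<Sum>c\<in>R. v c * cofactor_on R a c M) = (\<Sum>c\<in>R. \<Sum>\<pi> | \<pi> permutes R.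
      v c * (of_int (sign \<pi>) * (\<Prod>x\<in>R. set_col a (\<lambda>x. of_bool (x = c)) M x (\<pi> x))))"
    using assms by (intro sum.cong refl) (simp add: cofactor_on_eq_det_on det_on_def sum_distrib_left)
  also have "\<dots> = (\<Sum>\<pi> | \<pi> permutes R. \<Sum>c\<in>R.
      v c * (of_int (sign \<pi>) * (\<Prod>x\<in>R. set_col a (\<lambda>x. of_bool (x = c)) M x (\<pi> x))))"
    by (rule sum.swap)
  also have "\<dots> = (\<Sum>\<pi> | \<pi> permutes R. of_int (sign \<pi>) * (\<Prod>x\<in>R. set_col a v M x (\<pi> x)))"
  proof (intro sum.cong refl)
    fix \<pi> assume "\<pi> \<in> {\<pi>. \<pi> permutes R}"
    then have \<pi>: "\<pi> permutes R" by simp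
    have c: "inv \<pi> a \<in> R" using assms(2) \<pi> permutes_inv permutes_in_image by metis
    have "(\<Sum>c\<in>R. v c * (of_int (sign \<pi>) * (\<Prod>x\<in>R. set_col a (\<lambda>x. of_bool (x = c)) M x (\<pi> x)))) =
      (\<Sum>c\<in>R. if inv \<pi> a = c then v c * (of_int (sign \<pi>) * (\<Prod>x\<in>R - {inv \<pi> a}. M x (\<pi> x))) else 0)"
      by (intro sum.cong refl) (simp add: prod_set_col[OF assms \<pi>])
    also have "\<dots> = of_int (sign \<pi>) * (\<Prod>x\<in>R. set_col a v M x (\<pi> x))"
      using assms(1) c by (simp add: prod_set_col[OF assms \<pi>] sum.delta')
    finally show "(\<Sum>c\<in>R. v c * (of_int (sign \<pi>) * (\<Prod>x\<in>R. set_col a (\<lambda>x. of_bool (x = c)) M x (\<pi> x)))) =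
       of_int (sign \<pi>) * (\<Prod>x\<in>R. set_col a v M x (\<pi> x))" .
  qed
  finally show ?thesis by (simp add: det_on_def)
qed

lemma det_on_equal_columns:
  fixes M :: "'a \<Rightarrow> 'a \<Rightarrow> 'r::field_char_0"
  assumes "finite R" "a \<in> R" "b \<in> R" "a \<noteq> b" and eq: "\<And>x. M x a = M x b"
  shows "det_on R M = 0"
proof -
  let ?t = "Transposition.transpose a b"
  have t: "?t permutes R" using assms(2,3) by (rule permutes_swap_id)
  have M: "M x (?t y) = M x y" for x y by (auto simp: Transposition.transpose_def eq)
  have "det_on R M = (\<Sum>\<pi> | \<pi> permutes R. of_int (sign (?t \<circ> \<pi>)) * (\<Prod>x\<in>R. M x ((?t \<circ> \<pi>) x)))"
    unfolding det_on_def by (rule setum_permutations_compose_left[OF t])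
  also have "\<dots> = (\<Sum>\<pi> | \<pi> permutes R. - (of_int (sign \<pi>) * (\<Prod>x\<in>R. M x (\<pi> x))))"
  proof (intro sum.cong refl)
    fix \<pi> assume "\<pi> \<in> {\<pi>. \<pi> permutes R}"
    then have \<pi>: "permutation \<pi>" using assms(1) permutation_permutes by blast
    have "sign (?t \<circ> \<pi>) = - sign \<pi>"
      using assms(4) by (simp add: sign_compose[OF permutation_swap_id \<pi>] sign_swap_id)
    then show "of_int (sign (?t \<circ> \<pi>)) * (\<Prod>x\<in>R. M x ((?t \<circ> \<pi>) x)) =
      - (of_int (sign \<pi>) * (\<Prod>x\<in>R. M x (\<pi> x)))" by (simp add: M)
  qed
  also have "\<dots> = - det_on R M" by (simp add: det_on_def sum_negf)
  finally show ?thesis by (simp add: eq_neg_iff_add_eq_0 flip: mult_2)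
qed

text \<open>
The sum is the determinant with column \<open>a\<close> replaced by column \<open>b\<close>; for \<open>a \<noteq> b\<close> two columns agree.
\<close>

lemma cofactor_on_adjugate:
  fixes M :: "'a \<Rightarrow> 'a \<Rightarrow> 'r::field_char_0"
  assumes "finite R" "a \<in> R" "b \<in> R"
  shows "(\<Sum>c\<in>R. M c b * cofactor_on R a c M) = of_bool (a = b) * det_on R M"
proof (cases "a = b")
  case True
  then have "set_col a (\<lambda>c. M c b) M = M" by (auto simp: set_col_def fun_eq_iff)
  with True show ?thesis using det_on_set_col[OF assms(1,2), of "\<lambda>c. M c b" M] by simp
next
  case False
  then have "det_on R (set_col a (\<lambda>c. M c b) M) = 0"
    using assms by (intro det_on_equal_columns[of R a b]) (auto simp: set_col_def)
  with False show ?thesis using det_on_set_col[OF assms(1,2), of "\<lambda>c. M c b" M] by simp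
qed

text \<open>
The kernel is used at one index \<open>a\<close> with \<open>w a \<noteq> 0\<close>: replacing column \<open>a\<close> by the
combination \<open>\<Sum>\<^sub>b w b M\<^sub>\<cdot>\<^sub>b = 0\<close> multiplies the determinant by \<open>w a\<close>.
\<close>

lemma det_on_eq_0_if_kernel:
  fixes M :: "'a \<Rightarrow> 'a \<Rightarrow> 'r::field_char_0"
  assumes "finite R" "a \<in> R" "w a \<noteq> 0" and kernel: "\<And>x. x \<in> R \<Longrightarrow> (\<Sum>y\<in>R. M x y * w y) = 0"
  shows "det_on R M = 0"
proof -
  have "w a * det_on R M = (\<Sum>b\<in>R. if a = b then w b * det_on R M else 0)"
    using assms(1,2) by simp
  also have "\<dots> = (\<Sum>b\<in>R. w b * (\<Sum>c\<in>R. M c b * cofactor_on R a c M))"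
    by (intro sum.cong refl) (simp add: cofactor_on_adjugate[OF assms(1,2)])
  also have "\<dots> = (\<Sum>b\<in>R. \<Sum>c\<in>R. M c b * w b * cofactor_on R a c M)"
    by (simp add: sum_distrib_left mult_ac)
  also have "\<dots> = (\<Sum>c\<in>R. (\<Sum>b\<in>R. M c b * w b) * cofactor_on R a c M)"
    by (subst sum.swap) (simp add: sum_distrib_right)
  also have "\<dots> = 0" by (intro sum.neutral ballI) (simp add: kernel)
  finally show ?thesis using assms(3) by simp
qed

lemma permutes_remove_fixpoint:
  "{\<pi>. \<pi> permutes R \<and> \<pi> a = a} = {\<pi>. \<pi> permutes (R - {a})}"
  by (auto simp: permutes_def)

lemma cofactor_on_same:
  fixes M :: "'a \<Rightarrow> 'a \<Rightarrow> 'r::comm_ring_1"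
  assumes "finite R" "a \<in> R"
  shows "cofactor_on R a a M = det_on (R - {a}) M"
proof -
  have "cofactor_on R a a M =
    (\<Sum>\<pi> | \<pi> permutes R. of_int (sign \<pi>) * (\<Prod>x\<in>R. set_col a (\<lambda>x. of_bool (x = a)) M x (\<pi> x)))"
    using assms by (simp add: cofactor_on_eq_det_on det_on_def)
  also have "\<dots> = (\<Sum>\<pi> | \<pi> permutes R \<and> \<pi> a = a. of_int (sign \<pi>) *
       (\<Prod>x\<in>R. set_col a (\<lambda>x. of_bool (x = a)) M x (\<pi> x)))"
  proof (rule sum.mono_neutral_right)
    show "\<forall>\<pi>\<in>{\<pi>. \<pi> permutes R} - {\<pi>. \<pi> permutes R \<and> \<pi> a = a}.
       of_int (sign \<pi>) * (\<Prod>x\<in>R. set_col a (\<lambda>x. of_bool (x = a)) M x (\<pi> x)) = 0"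
      using assms by (auto simp: prod_set_col permutes_inverses permutes_inv_eq)
  qed (use assms in \<open>auto simp: finite_permutations\<close>)
  also have "\<dots> = (\<Sum>\<pi> | \<pi> permutes (R - {a}). of_int (sign \<pi>) * (\<Prod>x\<in>R - {a}. M x (\<pi> x)))"
    unfolding permutes_remove_fixpoint[symmetric]
    using assms by (intro sum.cong refl) (auto simp: prod_set_col permutes_inv_eq)
  finally show ?thesis by (simp add: det_on_def)
qed

text \<open>
Composing with the transposition of \<open>a\<close> and \<open>b\<close> maps the permutations that send \<open>b\<close> to \<open>a\<close> to
those fixing \<open>b\<close>, at the price of a sign; what remains is the determinant on \<open>R - {b}\<close> with
column \<open>a\<close> replaced by column \<open>b\<close>, expanded along that column. This identity matches the
densities of a range and of the same range without the newly discovered site \<open>b\<close>.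
\<close>

lemma cofactor_on_neq:
  fixes M :: "'a \<Rightarrow> 'a \<Rightarrow> 'r::comm_ring_1"
  assumes "finite R" "a \<in> R" "b \<in> R" "a \<noteq> b"
  shows "cofactor_on R a b M = - (\<Sum>c\<in>R - {b}. M c b * cofactor_on (R - {b}) a c M)"
proof -
  let ?t = "Transposition.transpose a b"
  let ?B = "set_col a (\<lambda>x. of_bool (x = b)) M"
  have t: "?t permutes R" using assms(2,3) by (rule permutes_swap_id)
  have aR: "a \<in> R - {b}" using assms by simp
  have "cofactor_on R a b M = (\<Sum>\<pi> | \<pi> permutes R. of_int (sign \<pi>) * (\<Prod>x\<in>R. ?B x (\<pi> x)))"
    using assms by (simp add: cofactor_on_eq_det_on det_on_def)
  also have "\<dots> = (\<Sum>\<pi> | \<pi> permutes R. of_int (sign (?t \<circ> \<pi>)) * (\<Prod>x\<in>R. ?B x ((?t \<circ> \<pi>) x)))"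
    by (rule setum_permutations_compose_left[OF t])
  also have "\<dots> = (\<Sum>\<pi> | \<pi> permutes R \<and> \<pi> b = b. of_int (sign (?t \<circ> \<pi>)) * (\<Prod>x\<in>R. ?B x ((?t \<circ> \<pi>) x)))"
  proof (rule sum.mono_neutral_right)
    show "\<forall>\<pi>\<in>{\<pi>. \<pi> permutes R} - {\<pi>. \<pi> permutes R \<and> \<pi> b = b}.
       of_int (sign (?t \<circ> \<pi>)) * (\<Prod>x\<in>R. ?B x ((?t \<circ> \<pi>) x)) = 0"
    proof (intro ballI)
      fix \<pi> assume "\<pi> \<in> {\<pi>. \<pi> permutes R} - {\<pi>. \<pi> permutes R \<and> \<pi> b = b}"
      then have \<pi>: "\<pi> permutes R" "\<pi> b \<noteq> b" by auto
      have p: "(?t \<circ> \<pi>) permutes R" using permutes_compose[OF \<pi>(1) t] .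
      have "inv (?t \<circ> \<pi>) a \<noteq> b"
        using \<pi>(2) by (auto simp: permutes_inv_eq[OF p] Transposition.transpose_def split: if_splits)
      then show "of_int (sign (?t \<circ> \<pi>)) * (\<Prod>x\<in>R. ?B x ((?t \<circ> \<pi>) x)) = 0"
        by (simp only: prod_set_col[OF assms(1,2) p]) simp
    qed
  qed (use assms in \<open>auto simp: finite_permutations\<close>)
  also have "\<dots> = (\<Sum>\<pi> | \<pi> permutes (R - {b}). - (of_int (sign \<pi>) *
      (\<Prod>x\<in>R - {b}. set_col a (\<lambda>x. M x b) M x (\<pi> x))))"
    unfolding permutes_remove_fixpoint[symmetric]
  proof (intro sum.cong refl)
    fix \<pi> assume "\<pi> \<in> {\<pi>. \<pi> permutes R \<and> \<pi> b = b}"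
    then have \<pi>: "\<pi> permutes R" "\<pi> b = b" by auto
    have p: "(?t \<circ> \<pi>) permutes R" using permutes_compose[OF \<pi>(1) t] .
    have "permutation \<pi>" using \<pi> assms(1) permutation_permutes by blast
    then have s: "sign (?t \<circ> \<pi>) = - sign \<pi>"
      using assms(4) by (simp add: sign_compose[OF permutation_swap_id] sign_swap_id)
    have i: "inv (?t \<circ> \<pi>) a = b" using \<pi>(2) by (auto simp: permutes_inv_eq[OF p])
    have "(\<Prod>x\<in>R. ?B x ((?t \<circ> \<pi>) x)) = (\<Prod>x\<in>R - {b}. M x ((?t \<circ> \<pi>) x))"
      by (simp only: prod_set_col[OF assms(1,2) p] i) simp
    also have "\<dots> = (\<Prod>x\<in>R - {b}. set_col a (\<lambda>x. M x b) M x (\<pi> x))"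
    proof (intro prod.cong refl)
      fix x assume "x \<in> R - {b}"
      then have "\<pi> x \<noteq> b" using \<pi> permutes_inj[OF \<pi>(1)] by (metis DiffD2 injD singletonI)
      then show "M x ((?t \<circ> \<pi>) x) = set_col a (\<lambda>x. M x b) M x (\<pi> x)"
        by (auto simp: set_col_def Transposition.transpose_def)
    qed
    finally show "of_int (sign (?t \<circ> \<pi>)) * (\<Prod>x\<in>R. ?B x ((?t \<circ> \<pi>) x)) =
       - (of_int (sign \<pi>) * (\<Prod>x\<in>R - {b}. set_col a (\<lambda>x. M x b) M x (\<pi> x)))"
      by (simp add: s)
  qed
  also have "\<dots> = - det_on (R - {b}) (set_col a (\<lambda>x. M x b) M)"
    by (simp add: det_on_def sum_negf)
  also have "\<dots> = - (\<Sum>c\<in>R - {b}. M c b * cofactor_on (R - {b}) a c M)"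
    using assms(1) aR by (simp add: det_on_set_col)
  finally show ?thesis .
qed

lemma det_on_cong:
  assumes "\<And>x y. x \<in> R \<Longrightarrow> y \<in> R \<Longrightarrow> M x y = N x y"
  shows "det_on R M = det_on R N"
  unfolding det_on_def
  by (intro sum.cong refl arg_cong2[where f = "(*)"] prod.cong) (auto simp: assms permutes_in_image)

lemma cofactor_on_cong:
  assumes "\<And>x y. x \<in> R \<Longrightarrow> y \<in> R \<Longrightarrow> M x y = N x y"
  shows "cofactor_on R a b M = cofactor_on R a b N"
  unfolding cofactor_on_def by (rule det_on_cong) (simp add: assms)

section \<open>Averages over independent uniform angles\<close>

lemma compact_imp_norm_bounded:
  fixes f :: "'b::topological_space \<Rightarrow> 'c::real_normed_vector"
  assumes "compact S" "continuous_on S f"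
  obtains C where "\<And>x. x \<in> S \<Longrightarrow> norm (f x) \<le> C"
  using compact_imp_bounded[OF compact_continuous_image[OF assms(2,1)]] unfolding bounded_iff by blast

text \<open>
A uniform bound on the derivative makes the difference quotients uniformly bounded, so the limit
passes under the integral by dominated convergence. The derivative is taken within \<open>S\<close>
so that it is also available at the end point of a half-line.
\<close>

lemma has_vector_derivative_integral:
  fixes f :: "'b \<Rightarrow> real \<Rightarrow> complex"
  assumes "finite_measure M" "convex S" "t0 \<in> S"
    and meas: "\<And>t. t \<in> S \<Longrightarrow> (\<lambda>x. f x t) \<in> borel_measurable M"
    and meas': "(\<lambda>x. f' x t0) \<in> borel_measurable M"
    and bound0: "\<And>x. x \<in> space M \<Longrightarrow> norm (f x t0) \<le> B"
    and deriv: "\<And>x t. x \<in> space M \<Longrightarrow> t \<in> S \<Longrightarrow> (f x has_vector_derivative f' x t) (at t within S)"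
    and bound: "\<And>x t. x \<in> space M \<Longrightarrow> t \<in> S \<Longrightarrow> norm (f' x t) \<le> C"
  shows "((\<lambda>t. LINT x|M. f x t) has_vector_derivative (LINT x|M. f' x t0)) (at t0 within S)"
proof -
  interpret finite_measure M by fact
  have lip: "norm (f x t - f x t0) \<le> C * norm (t - t0)" if "x \<in> space M" "t \<in> S" for x t
  proof (rule differentiable_bound[OF assms(2)])
    show "(f x has_derivative (\<lambda>h. h *\<^sub>R f' x s)) (at s within S)" if "s \<in> S" for s
      using deriv[OF \<open>x \<in> space M\<close> that] by (simp add: has_vector_derivative_def)
    show "onorm (\<lambda>h. h *\<^sub>R f' x s) \<le> C" if "s \<in> S" for s
      using bound[OF \<open>x \<in> space M\<close> that]
      by (auto intro!: onorm_le simp: mult.commute[of C] mult_left_mono)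
  qed (use that assms(3) in auto)
  have int: "integrable M (\<lambda>x. f x t)" if "t \<in> S" for t
  proof (rule integrable_const_bound[where B = "C * norm (t - t0) + B"])
    show "AE x in M. norm (f x t) \<le> C * norm (t - t0) + B"
    proof (rule AE_I2)
      fix x assume x: "x \<in> space M"
      have "norm (f x t) \<le> norm (f x t - f x t0) + norm (f x t0)"
        using norm_triangle_ineq[of "f x t - f x t0" "f x t0"] by simp
      then show "norm (f x t) \<le> C * norm (t - t0) + B"
        using lip[OF x that] bound0[OF x] by linarith
    qed
  qed (rule meas[OF that])
  have int': "integrable M (\<lambda>x. f' x t0)"
    by (rule integrable_const_bound[where B = C]) (use meas' bound assms(3) in auto)
  show ?thesis
    unfolding has_vector_derivative_def has_derivative_within
  proof
    show "bounded_linear (\<lambda>h. h *\<^sub>R (LINT x|M. f' x t0))"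
      by (rule bounded_linear_scaleR_left)
    show "((\<lambda>t. (1 / norm (t - t0)) *\<^sub>R ((LINT x|M. f x t) -
         ((LINT x|M. f x t0) + (t - t0) *\<^sub>R (LINT x|M. f' x t0)))) \<longlongrightarrow> 0) (at t0 within S)"
      unfolding tendsto_at_iff_sequentially
    proof (intro allI impI)
      fix X :: "nat \<Rightarrow> real" assume X: "\<forall>i. X i \<in> S - {t0}" "X \<longlonglongrightarrow> t0"
      let ?g = "\<lambda>t x. (1 / norm (t - t0)) *\<^sub>R (f x t - (f x t0 + (t - t0) *\<^sub>R f' x t0))"
      have "(\<lambda>i. LINT x|M. ?g (X i) x) \<longlonglongrightarrow> (LINT x|M. 0)"
      proof (rule integral_dominated_convergence[where w = "\<lambda>x. 2 * C"])
        show "?g (X i) \<in> borel_measurable M" for i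
          using X(1) meas[of "X i"] meas[OF assms(3)] meas' by (intro borel_measurable_scaleR borel_measurable_diff borel_measurable_add) auto
        show "AE x in M. (\<lambda>i. ?g (X i) x) \<longlonglongrightarrow> 0"
        proof (rule AE_I2)
          fix x assume "x \<in> space M"
          from deriv[OF this assms(3)] have "((\<lambda>t. ?g t x) \<longlongrightarrow> 0) (at t0 within S)"
            by (simp add: has_vector_derivative_def has_derivative_within)
          with X show "(\<lambda>i. ?g (X i) x) \<longlonglongrightarrow> 0"
            unfolding tendsto_at_iff_sequentially by (simp add: o_def)
        qed
        show "AE x in M. norm (?g (X i) x) \<le> 2 * C" for i
        proof (rule AE_I2)
          fix x assume x: "x \<in> space M"
          have Xi: "X i \<in> S" "0 < norm (X i - t0)" using X(1) by auto
          have "norm (f x (X i) - (f x t0 + (X i - t0) *\<^sub>R f' x t0)) \<le>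
            norm (f x (X i) - f x t0) + norm ((X i - t0) *\<^sub>R f' x t0)"
            using norm_triangle_ineq4[of "f x (X i) - f x t0" "(X i - t0) *\<^sub>R f' x t0"]
            by (simp add: algebra_simps)
          also have "\<dots> \<le> C * norm (X i - t0) + norm (X i - t0) * C"
            using lip[OF x Xi(1)] bound[OF x assms(3)] by (intro add_mono) (auto intro: mult_left_mono)
          finally have "norm (?g (X i) x) \<le> (1 / norm (X i - t0)) * (C * norm (X i - t0) + norm (X i - t0) * C)"
            unfolding norm_scaleR using Xi(2) by (intro mult_mono) auto
          also have "\<dots> = 2 * C" using Xi(2) by (simp add: divide_simps)
          finally show "norm (?g (X i) x) \<le> 2 * C" .
        qed
      qed auto
      moreover have "(LINT x|M. ?g (X i) x) = (1 / norm (X i - t0)) *\<^sub>R ((LINT x|M. f x (X i)) -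
         ((LINT x|M. f x t0) + (X i - t0) *\<^sub>R (LINT x|M. f' x t0)))" for i
        using X(1) int[of "X i"] int[OF assms(3)] int' by simp
      ultimately show "((\<lambda>t. (1 / norm (t - t0)) *\<^sub>R ((LINT x|M. f x t) -
         ((LINT x|M. f x t0) + (t - t0) *\<^sub>R (LINT x|M. f' x t0)))) \<circ> X) \<longlonglongrightarrow> 0"
        by (simp only: o_def Bochner_Integration.integral_zero)
    qed
  qed
qed

definition circ :: "real measure" where
  "circ = uniform_measure lborel {0..2 * pi}"

lemma prob_space_circ: "prob_space circ"
  unfolding circ_def by (rule prob_space_uniform_measure) (auto simp: emeasure_lborel_Icc)

lemma sets_circ [simp, measurable_cong]: "sets circ = sets borel"
  by (simp add: circ_def)

lemma space_circ [simp]: "space circ = UNIV"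
  by (simp add: circ_def)

lemma integral_uniform_measure:
  fixes f :: "'b \<Rightarrow> 'c::{banach, second_countable_topology}"
  assumes [measurable]: "f \<in> borel_measurable M" "S \<in> sets M" and "emeasure M S \<noteq> \<infinity>" "measure M S \<noteq> 0"
  shows "(LINT x|uniform_measure M S. f x) = (1 / measure M S) *\<^sub>R (LINT x:S|M. f x)"
proof -
  have e: "emeasure M S = ennreal (measure M S)"
    using assms(3) by (simp add: emeasure_eq_ennreal_measure)
  have "0 < measure M S" using assms(4) by (simp add: order_less_le)
  then have "uniform_measure M S = density M (\<lambda>x. ennreal (indicator S x / measure M S))"
    unfolding uniform_measure_def e
    by (intro arg_cong2[where f = density] refl) (auto simp: fun_eq_iff indicator_def divide_ennreal simp flip: ennreal_1)
  then have "(LINT x|uniform_measure M S. f x) = (LINT x|M. (indicator S x / measure M S) *\<^sub>R f x)"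
    by (simp add: integral_density)
  also have "\<dots> = (LINT x|M. (1 / measure M S) *\<^sub>R (indicator S x *\<^sub>R f x))"
    by simp
  finally show ?thesis by (simp only: integral_scaleR_right set_lebesgue_integral_def)
qed

lemma integral_circ:
  fixes f :: "real \<Rightarrow> complex"
  assumes [measurable]: "f \<in> borel_measurable borel"
  shows "(LINT t|circ. f t) = (LINT t:{0..2*pi}|lborel. f t) / complex_of_real (2 * pi)"
  unfolding circ_def
  by (subst integral_uniform_measure) (auto simp: scaleR_conv_of_real)

abbreviation angles :: "'a set \<Rightarrow> ('a \<Rightarrow> real) measure" where
  "angles R \<equiv> \<Pi>\<^sub>M x\<in>R. circ"

lemma prob_space_angles: "prob_space (angles R)"
  by (rule prob_space_PiM) (rule prob_space_circ)

lemma product_sigma_finite_circ: "product_sigma_finite (\<lambda>_. circ)"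
proof -
  interpret prob_space circ by (rule prob_space_circ)
  show ?thesis by standard
qed

lemma angles_eq_uniform_measure:
  assumes "finite R"
  shows "angles R = uniform_measure (\<Pi>\<^sub>M x\<in>R. lborel) (R \<rightarrow>\<^sub>E {0..2 * pi})"
proof -
  interpret L: product_sigma_finite "\<lambda>_ :: 'a. lborel :: real measure" by standard
  interpret product_sigma_finite "\<lambda>_ :: 'a. circ" by (rule product_sigma_finite_circ)
  have box: "emeasure (\<Pi>\<^sub>M x\<in>R. lborel) (R \<rightarrow>\<^sub>E {0..2 * pi}) = ennreal ((2 * pi) ^ card R)"
    using assms by (subst L.emeasure_PiM) (auto simp: emeasure_lborel_Icc ennreal_power)
  have "uniform_measure (\<Pi>\<^sub>M x\<in>R. lborel) (R \<rightarrow>\<^sub>E {0..2 * pi}) = angles R"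
  proof (rule PiM_eqI[OF assms])
    show "sets (uniform_measure (\<Pi>\<^sub>M x\<in>R. lborel) (R \<rightarrow>\<^sub>E {0..2 * pi})) = sets (angles R)"
      by (simp cong: sets_PiM_cong)
    fix A :: "'a \<Rightarrow> real set" assume "\<And>i. i \<in> R \<Longrightarrow> A i \<in> sets circ"
    then have A: "\<And>i. i \<in> R \<Longrightarrow> A i \<in> sets lborel" by simp
    have AE: "Pi\<^sub>E R A \<in> sets (\<Pi>\<^sub>M x\<in>R. lborel)" "(R \<rightarrow>\<^sub>E {0..2 * pi}) \<in> sets (\<Pi>\<^sub>M x\<in>R. lborel)"
      using A assms by (auto intro!: sets_PiM_I_finite)
    have c: "emeasure circ (A i) = emeasure lborel ({0..2 * pi} \<inter> A i) * ennreal (1 / (2 * pi))" if "i \<in> R" for i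
      using A[OF that] unfolding circ_def
      by (subst emeasure_uniform_measure) (auto simp: divide_ennreal_def inverse_ennreal inverse_eq_divide)
    have "emeasure (uniform_measure (\<Pi>\<^sub>M x\<in>R. lborel) (R \<rightarrow>\<^sub>E {0..2 * pi})) (Pi\<^sub>E R A) =
       emeasure (\<Pi>\<^sub>M x\<in>R. lborel) (\<Pi>\<^sub>E x\<in>R. {0..2 * pi} \<inter> A x) * ennreal ((1 / (2 * pi)) ^ card R)"
      using AE by (subst emeasure_uniform_measure)
        (auto simp: box PiE_Int divide_ennreal_def inverse_ennreal inverse_eq_divide power_one_over)
    also have "emeasure (\<Pi>\<^sub>M x\<in>R. lborel) (\<Pi>\<^sub>E x\<in>R. {0..2 * pi} \<inter> A x) =
        (\<Prod>x\<in>R. emeasure lborel ({0..2 * pi} \<inter> A x))"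
      using assms A by (subst L.emeasure_PiM) auto
    also have "\<dots> * ennreal ((1 / (2 * pi)) ^ card R) = (\<Prod>x\<in>R. emeasure circ (A x))"
      by (simp add: c prod.distrib flip: ennreal_power)
    finally show "emeasure (uniform_measure (\<Pi>\<^sub>M x\<in>R. lborel) (R \<rightarrow>\<^sub>E {0..2 * pi})) (Pi\<^sub>E R A) =
      (\<Prod>x\<in>R. emeasure circ (A x))" .
  qed
  then show ?thesis by simp
qed

lemma cis_measurable [measurable]: "cis \<in> borel_measurable borel"
  by (intro borel_measurable_continuous_onI continuous_intros)

lemma angular_integral_eq:
  fixes R :: "'a set"
  assumes "finite R"
  shows "angular_integral A R l = (LINT \<theta>|angles R.
     exp (\<Sum>x\<in>R. \<Sum>y\<in>R. complex_of_real (A x y * sqrt (l x) * sqrt (l y)) * cis (\<theta> x - \<theta> y)))"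
proof -
  interpret L: product_sigma_finite "\<lambda>_ :: 'a. lborel :: real measure" by standard
  have box: "emeasure (\<Pi>\<^sub>M x\<in>R. lborel) (R \<rightarrow>\<^sub>E {0..2 * pi}) = ennreal ((2 * pi) ^ card R)"
    using assms by (subst L.emeasure_PiM) (auto simp: emeasure_lborel_Icc ennreal_power)
  then have m: "measure (\<Pi>\<^sub>M x\<in>R. lborel) (R \<rightarrow>\<^sub>E {0..2 * pi}) = (2 * pi) ^ card R"
    by (simp add: measure_def)
  have S[measurable]: "(R \<rightarrow>\<^sub>E {0..2 * pi}) \<in> sets (\<Pi>\<^sub>M x\<in>R. lborel)"
    using assms by (auto intro!: sets_PiM_I_finite)
  let ?E = "\<lambda>\<theta>. exp (\<Sum>x\<in>R. \<Sum>y\<in>R. complex_of_real (A x y * sqrt (l x) * sqrt (l y)) * cis (\<theta> x - \<theta> y))"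
  have E[measurable]: "?E \<in> borel_measurable (\<Pi>\<^sub>M x\<in>R. lborel)" by measurable
  have "angular_integral A R l = (LINT \<theta>|(\<Pi>\<^sub>M x\<in>R. lborel).
      (indicator (R \<rightarrow>\<^sub>E {0..2 * pi}) \<theta> *\<^sub>R ?E \<theta>) / complex_of_real ((2 * pi) ^ card R))"
    unfolding angular_integral_def set_lebesgue_integral_def cis_conv_exp
    by (intro Bochner_Integration.integral_cong refl) (simp add: scaleR_conv_of_real)
  also have "\<dots> = (LINT \<theta>:(R \<rightarrow>\<^sub>E {0..2 * pi})|(\<Pi>\<^sub>M x\<in>R. lborel). ?E \<theta>) / complex_of_real ((2 * pi) ^ card R)"
    unfolding set_lebesgue_integral_def by (rule integral_divide_zero)
  also have "\<dots> = (LINT \<theta>|angles R. ?E \<theta>)"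
    unfolding angles_eq_uniform_measure[OF assms]
    by (subst integral_uniform_measure) (auto simp: box m scaleR_conv_of_real)
  finally show ?thesis .
qed

lemma integral_circ_cong:
  fixes f g :: "real \<Rightarrow> complex"
  assumes "f \<in> borel_measurable borel" "g \<in> borel_measurable borel"
    "\<And>t. t \<in> {0..2*pi} \<Longrightarrow> f t = g t"
  shows "(LINT t|circ. f t) = (LINT t|circ. g t)"
  using assms by (simp add: integral_circ) (auto intro!: set_lebesgue_integral_cong)

text \<open>
The derivative with respect to the real part is, up to the factor \<open>\<i>\<close>, the integral of a derivative
along a full period, hence zero.
\<close>

lemma integral_circ_vertical_shift:
  assumes h: "h holomorphic_on UNIV" and per: "\<And>w. h (w + 2 * of_real pi * \<i>) = h w"
  shows "(LINT t|circ. h (of_real s + \<i> * of_real t)) = (LINT t|circ. h (of_real s' + \<i> * of_real t))"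
proof -
  interpret prob_space circ by (rule prob_space_circ)
  have h': "deriv h holomorphic_on UNIV" using h by (rule holomorphic_deriv) simp
  have cont[continuous_intros]: "continuous_on S (\<lambda>x. h (f x))" "continuous_on S (\<lambda>x. deriv h (f x))"
    if "continuous_on S f" for S and f :: "'z::topological_space \<Rightarrow> complex"
    using continuous_on_compose2[OF holomorphic_on_imp_continuous_on[OF h] that]
      continuous_on_compose2[OF holomorphic_on_imp_continuous_on[OF h'] that] by auto
  have D: "(h has_field_derivative deriv h z) (at z)" for z
    using h by (simp add: holomorphic_derivI)
  have [measurable]: "(\<lambda>t. h (of_real s + \<i> * of_real t)) \<in> borel_measurable borel"
    "(\<lambda>t. deriv h (of_real s + \<i> * of_real t)) \<in> borel_measurable borel" for s
    by (intro borel_measurable_continuous_onI continuous_intros)+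
  \<comment> \<open>Clamping the angle to one period gives bounds that are uniform over the whole line.\<close>
  define c :: "real \<Rightarrow> real" where "c t = min (2 * pi) (max 0 t)" for t
  have c: "c t \<in> {0..2*pi}" "t \<in> {0..2*pi} \<Longrightarrow> c t = t" for t by (auto simp: c_def)
  have [measurable]: "c \<in> borel_measurable borel" unfolding c_def by measurable
  have [measurable]: "(\<lambda>t. h (of_real s + \<i> * of_real (c t))) \<in> borel_measurable borel"
    "(\<lambda>t. deriv h (of_real s + \<i> * of_real (c t))) \<in> borel_measurable borel" for s
    by (auto intro: measurable_compose[where N = borel and f = c])
  define J where "J s = (LINT t|circ. h (of_real s + \<i> * of_real (c t)))" for s
  have J: "J s = (LINT t|circ. h (of_real s + \<i> * of_real t))" for s
    unfolding J_def by (rule integral_circ_cong) (auto simp: c)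
  have zero: "(LINT t|circ. deriv h (of_real s + \<i> * of_real (c t))) = 0" for s
  proof -
    have "(LINT t|circ. deriv h (of_real s + \<i> * of_real (c t))) =
        (LINT t|circ. deriv h (of_real s + \<i> * of_real t))"
      by (rule integral_circ_cong) (auto simp: c)
    also have "\<dots> = (LINT t:{0..2*pi}|lborel. deriv h (of_real s + \<i> * of_real t)) / of_real (2 * pi)"
      by (rule integral_circ) simp
    also have "(LINT t:{0..2*pi}|lborel. deriv h (of_real s + \<i> * of_real t)) =
       - \<i> * h (of_real s + \<i> * of_real (2 * pi)) - (- \<i> * h (of_real s + \<i> * of_real 0))"
      unfolding set_lebesgue_integral_def
    proof (rule integral_FTC_Icc)
      show "((\<lambda>t. - \<i> * h (of_real s + \<i> * of_real t)) has_vector_derivative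
          deriv h (of_real s + \<i> * of_real t)) (at t within {0..2*pi})" for t
      proof -
        have "((\<lambda>t. of_real s + \<i> * of_real t) has_vector_derivative \<i>) (at t)"
          by (auto intro!: derivative_eq_intros)
        from field_vector_diff_chain_at[OF this D]
        have "((\<lambda>t. - \<i> * h (of_real s + \<i> * of_real t)) has_vector_derivative
          - \<i> * (\<i> * deriv h (of_real s + \<i> * of_real t))) (at t)"
          unfolding o_def by (rule has_vector_derivative_mult_right)
        then show ?thesis by (simp add: has_vector_derivative_at_within flip: mult.assoc)
      qed
      show "continuous_on {0..2*pi} (\<lambda>t. deriv h (of_real s + \<i> * of_real t))"
        by (intro continuous_intros)
    qed simp
    finally show ?thesis using per[of "of_real s"] by (simp add: mult_ac)
  qed
  have D0: "(J has_vector_derivative 0) (at s within {a..b})" if "s \<in> {a..b}" for s a b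
  proof -
    obtain C where C': "\<And>p. p \<in> {a..b} \<times> {0..2*pi} \<Longrightarrow> norm (deriv h (of_real (fst p) + \<i> * of_real (snd p))) \<le> C"
      by (rule compact_imp_norm_bounded[of "{a..b} \<times> {0..2*pi}" "\<lambda>p. deriv h (of_real (fst p) + \<i> * of_real (snd p))"])
        (auto intro!: compact_Times continuous_intros)
    have C: "norm (deriv h (of_real s + \<i> * of_real t)) \<le> C" if "s \<in> {a..b}" "t \<in> {0..2*pi}" for s t
      using C'[of "(s, t)"] that by auto
    obtain B where B: "\<And>t. t \<in> {0..2*pi} \<Longrightarrow> norm (h (of_real s + \<i> * of_real t)) \<le> B"
      by (rule compact_imp_norm_bounded[of "{0..2*pi}" "\<lambda>t. h (of_real s + \<i> * of_real t)"])
        (auto intro!: continuous_intros)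
    have "((\<lambda>s. LINT t|circ. h (of_real s + \<i> * of_real (c t))) has_vector_derivative
        (LINT t|circ. deriv h (of_real s + \<i> * of_real (c t)))) (at s within {a..b})"
    proof (rule has_vector_derivative_integral[where B = B and C = C])
      show "((\<lambda>s. h (of_real s + \<i> * of_real (c t))) has_vector_derivative
          deriv h (of_real s + \<i> * of_real (c t))) (at s within {a..b})" for s t
      proof -
        have "((\<lambda>s. of_real s + \<i> * of_real (c t)) has_vector_derivative 1) (at s)"
          by (auto intro!: derivative_eq_intros)
        from field_vector_diff_chain_at[OF this D] show ?thesis
          by (simp add: o_def has_vector_derivative_at_within)
      qed
    qed (use B C c that in \<open>auto intro: finite_measure_axioms\<close>)
    then show ?thesis by (simp add: J_def[abs_def] zero)
  qed
  have "J s = J s'"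
  proof -
    define a b where "a = min s s'" and "b = max s s'"
    obtain k where "\<And>x. x \<in> {a..b} \<Longrightarrow> J x = k"
      by (rule has_vector_derivative_zero_constant[of "{a..b}" J]) (use D0 in auto)
    moreover have "s \<in> {a..b}" "s' \<in> {a..b}" by (auto simp: a_def b_def)
    ultimately show ?thesis by metis
  qed
  then show ?thesis by (simp add: J)
qed

text \<open>
Apply the shift to \<open>w \<mapsto> g (exp (- w))\<close> and let the real part tend to infinity.
\<close>

lemma integral_circ_entire_mean_value:
  assumes g: "g holomorphic_on UNIV"
  shows "(LINT t|circ. g (cis (- t))) = g 0"
proof -
  interpret prob_space circ by (rule prob_space_circ)
  have cont: "continuous_on UNIV g" using g holomorphic_on_imp_continuous_on by blast
  let ?h = "\<lambda>w. g (exp (- w))"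
  have h: "?h holomorphic_on UNIV"
  proof -
    have "(\<lambda>w. exp (- w)) holomorphic_on UNIV" by (intro holomorphic_intros)
    from holomorphic_on_compose_gen[OF this g] show ?thesis by (simp add: o_def)
  qed
  have per: "?h (w + 2 * of_real pi * \<i>) = ?h w" for w
    by (simp add: exp_diff exp_minus field_simps exp_add)
  have e: "exp (- (of_real s + \<i> * of_real t)) = of_real (exp (- s)) * cis (- t)" for s t :: real
    by (simp add: exp_diff exp_minus cis_conv_exp exp_of_real field_simps exp_add)
  define J where "J s = (LINT t|circ. g (of_real (exp (- s)) * cis (- t)))" for s :: real
  have const: "J s = J 0" for s
    using integral_circ_vertical_shift[OF h per, of s 0] by (simp only: J_def e)
  obtain B where B: "\<And>z. z \<in> cball 0 1 \<Longrightarrow> norm (g z) \<le> B"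
    by (rule compact_imp_norm_bounded[of "cball 0 1" g]) (auto intro: continuous_on_subset[OF cont])
  have "(\<lambda>n. J (real n)) \<longlonglongrightarrow> (LINT t|circ. g 0)"
    unfolding J_def
  proof (rule integral_dominated_convergence[where w = "\<lambda>_. B"])
    have m: "(\<lambda>t. g (of_real (exp (- s)) * cis (- t))) \<in> borel_measurable borel" for s
      by (intro borel_measurable_continuous_onI continuous_on_compose2[OF cont] continuous_intros) auto
    show "(\<lambda>t. g (of_real (exp (- real n)) * cis (- t))) \<in> borel_measurable circ" for n
      using m[of "real n"] by simp
    show "AE t in circ. (\<lambda>n. g (of_real (exp (- real n)) * cis (- t))) \<longlonglongrightarrow> g 0"
    proof (rule AE_I2)
      fix t :: real
      have "(\<lambda>n. exp (- real n)) \<longlonglongrightarrow> 0" by real_asymp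
      then have "(\<lambda>n. complex_of_real (exp (- real n)) * cis (- t)) \<longlonglongrightarrow> of_real 0 * cis (- t)"
        by (intro tendsto_intros)
      then show "(\<lambda>n. g (of_real (exp (- real n)) * cis (- t))) \<longlonglongrightarrow> g 0"
        by (intro continuous_on_tendsto_compose[OF cont]) simp_all
    qed
    show "AE t in circ. norm (g (of_real (exp (- real n)) * cis (- t))) \<le> B" for n
      by (intro AE_I2 B) (simp add: norm_mult)
  qed auto
  moreover have "(\<lambda>n. J (real n)) = (\<lambda>n. J 0)" by (intro ext const)
  ultimately have "(\<lambda>n. J 0) \<longlonglongrightarrow> g 0" using prob_space by simp
  then have "J 0 = g 0" by (simp add: LIMSEQ_const_iff)
  then show ?thesis by (simp add: J_def)
qed

section \<open>The density as an average over phases\<close>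

text \<open>
The value zero outside \<open>R\<close> makes \<open>rate R M \<theta> x\<close> the logarithmic derivative of \<open>phase_exp\<close> in
direction \<open>x\<close> for every site \<open>x\<close>, also for those on which nothing depends.
\<close>

definition rate :: "'a set \<Rightarrow> ('a \<Rightarrow> 'a \<Rightarrow> complex) \<Rightarrow> ('a \<Rightarrow> real) \<Rightarrow> 'a \<Rightarrow> complex" where
  "rate R M \<theta> x = (if x \<in> R then cis (\<theta> x) * (\<Sum>y\<in>R. M x y * cis (- \<theta> y)) else 0)"

definition phase_matrix :: "'a set \<Rightarrow> ('a \<Rightarrow> 'a \<Rightarrow> complex) \<Rightarrow> ('a \<Rightarrow> real) \<Rightarrow> 'a \<Rightarrow> 'a \<Rightarrow> complex" where
  "phase_matrix R M \<theta> x y = (if x = y then rate R M \<theta> x else 0) - M x y"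

definition phase_exp :: "'a set \<Rightarrow> ('a \<Rightarrow> 'a \<Rightarrow> complex) \<Rightarrow> ('a \<Rightarrow> real) \<Rightarrow> ('a \<Rightarrow> real) \<Rightarrow> complex" where
  "phase_exp R M l \<theta> = exp (\<Sum>x\<in>R. of_real (l x) * rate R M \<theta> x)"

definition phase_density :: "'a set \<Rightarrow> ('a \<Rightarrow> 'a \<Rightarrow> complex) \<Rightarrow> 'a \<Rightarrow> 'a \<Rightarrow> ('a \<Rightarrow> real) \<Rightarrow> complex" where
  "phase_density R M a b l =
     (LINT \<theta>|angles R. cofactor_on R a b (phase_matrix R M \<theta>) * phase_exp R M l \<theta>)"

definition rate_bound :: "'a set \<Rightarrow> ('a \<Rightarrow> 'a \<Rightarrow> complex) \<Rightarrow> real" where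
  "rate_bound R M = (\<Sum>x\<in>R. \<Sum>y\<in>R. norm (M x y))"

lemma rate_bound_nonneg: "0 \<le> rate_bound R M"
  by (simp add: rate_bound_def sum_nonneg)

lemma norm_le_rate_bound:
  assumes "finite R" "x \<in> R" "y \<in> R"
  shows "norm (M x y) \<le> rate_bound R M"
proof -
  have "norm (M x y) \<le> (\<Sum>y\<in>R. norm (M x y))"
    using assms by (intro member_le_sum) auto
  also have "\<dots> \<le> rate_bound R M"
    unfolding rate_bound_def
    using assms by (intro member_le_sum[of x R "\<lambda>x. \<Sum>y\<in>R. norm (M x y)"]) (auto intro: sum_nonneg)
  finally show ?thesis .
qed

lemma norm_rate_le:
  assumes "finite R"
  shows "norm (rate R M \<theta> x) \<le> rate_bound R M"
proof (cases "x \<in> R")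
  case True
  have "norm (rate R M \<theta> x) \<le> (\<Sum>y\<in>R. norm (M x y * cis (- \<theta> y)))"
    using True by (simp add: rate_def norm_mult sum_norm_le)
  also have "\<dots> = (\<Sum>y\<in>R. norm (M x y))" by (simp add: norm_mult)
  also have "\<dots> \<le> rate_bound R M"
    unfolding rate_bound_def
    using assms True by (intro member_le_sum[of x R "\<lambda>x. \<Sum>y\<in>R. norm (M x y)"]) (auto intro: sum_nonneg)
  finally show ?thesis .
qed (simp add: rate_def rate_bound_nonneg)

lemma rate_measurable [measurable]: "(\<lambda>\<theta>. rate R M \<theta> x) \<in> borel_measurable (angles R)"
  unfolding rate_def by (cases "x \<in> R") simp_all

lemma phase_matrix_measurable [measurable]:
  "(\<lambda>\<theta>. phase_matrix R M \<theta> x y) \<in> borel_measurable (angles R)"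
  unfolding phase_matrix_def by measurable

lemma cofactor_measurable [measurable]:
  "(\<lambda>\<theta>. cofactor_on R' a b (phase_matrix R M \<theta>)) \<in> borel_measurable (angles R)"
  unfolding cofactor_on_def det_on_def by measurable

lemma norm_phase_exp_le:
  assumes "finite R"
  shows "norm (phase_exp R M l \<theta>) \<le> exp (rate_bound R M * (\<Sum>x\<in>R. \<bar>l x\<bar>))"
proof -
  have "norm (\<Sum>x\<in>R. of_real (l x) * rate R M \<theta> x) \<le> (\<Sum>x\<in>R. \<bar>l x\<bar> * rate_bound R M)"
    using norm_rate_le[OF assms] by (intro sum_norm_le) (auto simp: norm_mult intro: mult_left_mono)
  then have "norm (\<Sum>x\<in>R. of_real (l x) * rate R M \<theta> x) \<le> rate_bound R M * (\<Sum>x\<in>R. \<bar>l x\<bar>)"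
    by (simp add: sum_distrib_left mult.commute)
  then show ?thesis
    unfolding phase_exp_def by (intro order_trans[OF norm_exp]) simp
qed

lemma phase_exp_measurable [measurable]: "phase_exp R M l \<in> borel_measurable (angles R)"
  unfolding phase_exp_def by measurable

lemma cofactor_bounded:
  assumes "finite R" "R' \<subseteq> R"
  obtains C where "0 \<le> C" "\<And>\<theta>. norm (cofactor_on R' a b (phase_matrix R M \<theta>)) \<le> C"
proof
  let ?K = "2 * rate_bound R M + 1"
  let ?C = "\<Sum>\<pi> | \<pi> permutes R'. \<Prod>x\<in>R'. ?K"
  show "0 \<le> ?C" using rate_bound_nonneg[of R M] by (intro sum_nonneg prod_nonneg) auto
  fix \<theta>
  let ?N = "\<lambda>x y. of_bool (x \<noteq> b) * phase_matrix R M \<theta> x y * of_bool (y \<noteq> a) + of_bool (x = b \<and> y = a)"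
  have N: "norm (?N x y) \<le> ?K" if "x \<in> R'" "y \<in> R'" for x y
  proof -
    have "norm (phase_matrix R M \<theta> x y) \<le> norm (if x = y then rate R M \<theta> x else 0) + norm (M x y)"
      unfolding phase_matrix_def by (rule norm_triangle_ineq4)
    also have "\<dots> \<le> 2 * rate_bound R M"
    proof -
      have "norm (M x y) \<le> rate_bound R M"
        using norm_le_rate_bound[OF assms(1), of x y M] that assms(2) by blast
      then show ?thesis using norm_rate_le[OF assms(1), of M \<theta> x] rate_bound_nonneg[of R M] by auto
    qed
    finally have "norm (phase_matrix R M \<theta> x y) \<le> 2 * rate_bound R M" .
    then show ?thesis using rate_bound_nonneg[of R M] by (cases "x = b"; cases "y = a") auto
  qed
  show "norm (cofactor_on R' a b (phase_matrix R M \<theta>)) \<le> ?C"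
    unfolding cofactor_on_def det_on_def
  proof (rule sum_norm_le)
    fix \<pi> assume "\<pi> \<in> {\<pi>. \<pi> permutes R'}"
    then have "\<pi> permutes R'" by simp
    then have "(\<Prod>x\<in>R'. norm (?N x (\<pi> x))) \<le> (\<Prod>x\<in>R'. ?K)"
      using N by (intro prod_mono) (auto simp: permutes_in_image)
    then show "norm (of_int (sign \<pi>) * (\<Prod>x\<in>R'. ?N x (\<pi> x))) \<le> (\<Prod>x\<in>R'. ?K)"
      by (simp add: norm_mult prod_norm sign_def)
  qed
qed

text \<open>
The vector with entries \<open>cis (- \<theta> y)\<close> lies in the kernel: that is how the diagonal is chosen.
\<close>

lemma det_phase_matrix:
  assumes "finite R" "R \<noteq> {}"
  shows "det_on R (phase_matrix R M \<theta>) = 0"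
proof -
  obtain a where "a \<in> R" using assms by auto
  show ?thesis
  proof (rule det_on_eq_0_if_kernel[OF assms(1) \<open>a \<in> R\<close>, of "\<lambda>y. cis (- \<theta> y)"])
    fix x assume x: "x \<in> R"
    have "(\<Sum>y\<in>R. phase_matrix R M \<theta> x y * cis (- \<theta> y)) =
        (\<Sum>y\<in>R. if x = y then rate R M \<theta> x * cis (- \<theta> y) else 0) - (\<Sum>y\<in>R. M x y * cis (- \<theta> y))"
      unfolding sum_subtractf[symmetric]
      by (intro sum.cong refl) (auto simp: phase_matrix_def algebra_simps)
    also have "(\<Sum>y\<in>R. if x = y then rate R M \<theta> x * cis (- \<theta> y) else 0) = rate R M \<theta> x * cis (- \<theta> x)"
      using assms(1) x by simp
    also have "\<dots> = cis (\<theta> x) * cis (- \<theta> x) * (\<Sum>y\<in>R. M x y * cis (- \<theta> y))"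
      using x by (simp add: rate_def)
    also have "cis (\<theta> x) * cis (- \<theta> x) = 1" by (simp add: cis_mult)
    finally show "(\<Sum>y\<in>R. phase_matrix R M \<theta> x y * cis (- \<theta> y)) = 0" by simp
  qed simp
qed

text \<open>
The average after the imaginary shift of the phases by \<open>- \<i> ln (r x)\<close>.
\<close>

definition gauged_integral :: "'a set \<Rightarrow> ('a \<Rightarrow> 'a \<Rightarrow> complex) \<Rightarrow> ('a \<Rightarrow> real) \<Rightarrow> complex" where
  "gauged_integral R c r =
     (LINT \<theta>|angles R. exp (\<Sum>x\<in>R. \<Sum>y\<in>R. c x y * of_real (r x / r y) * cis (\<theta> x - \<theta> y)))"

lemma integrable_exp_angles:
  assumes "finite R"
  shows "integrable (angles R) (\<lambda>\<theta>. exp (\<Sum>x\<in>R. \<Sum>y\<in>R. c x y * cis (\<theta> x - \<theta> y)))"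
proof -
  interpret prob_space "angles R" by (rule prob_space_angles)
  have "norm (\<Sum>x\<in>R. \<Sum>y\<in>R. c x y * cis (\<theta> x - \<theta> y)) \<le> (\<Sum>x\<in>R. \<Sum>y\<in>R. norm (c x y))" for \<theta>
    by (intro sum_norm_le) (simp add: norm_mult)
  then show ?thesis
    by (intro integrable_const_bound[where B = "exp (\<Sum>x\<in>R. \<Sum>y\<in>R. norm (c x y))"] AE_I2
        order_trans[OF norm_exp]) auto
qed

text \<open>
As a function of the phase at \<open>b\<close> alone the integrand has the form
\<open>exp (\<alpha> z + \<beta> / z + \<gamma>)\<close> with \<open>z = s e\<^bsup>\<i>t\<^esup>\<close>, and its average over a circle does not depend
on the radius \<open>s\<close>.
\<close>

lemma gauged_integral_update:
  assumes "finite R" "b \<in> R" "0 < s" "0 < s'"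
  shows "gauged_integral R c (r(b := s)) = gauged_integral R c (r(b := s'))"
proof -
  interpret product_sigma_finite "\<lambda>_ :: 'a. circ" by (rule product_sigma_finite_circ)
  define S where "S = R - {b}"
  have S: "finite S" "b \<notin> S" "R = insert b S" using assms by (auto simp: S_def)
  define \<alpha> where "\<alpha> \<theta> = (\<Sum>y\<in>S. c b y * of_real (1 / r y) * cis (- \<theta> y))" for \<theta>
  define \<beta> where "\<beta> \<theta> = (\<Sum>x\<in>S. c x b * of_real (r x) * cis (\<theta> x))" for \<theta>
  define \<gamma> where "\<gamma> \<theta> = c b b + (\<Sum>x\<in>S. \<Sum>y\<in>S. c x y * of_real (r x / r y) * cis (\<theta> x - \<theta> y))" for \<theta>
  define h where "h \<theta> w = exp (\<alpha> \<theta> * exp w + \<beta> \<theta> * exp (- w) + \<gamma> \<theta>)" for \<theta> w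
  have *: "gauged_integral R c (r(b := s)) =
      (LINT \<theta>|angles S. LINT t|circ. h \<theta> (of_real (ln s) + \<i> * of_real t))" if "0 < s" for s
  proof -
    let ?r = "r(b := s)"
    have e: "(\<Sum>x\<in>R. \<Sum>y\<in>R. c x y * of_real (?r x / ?r y) * cis ((\<theta>(b := t)) x - (\<theta>(b := t)) y)) =
       \<alpha> \<theta> * exp (of_real (ln s) + \<i> * of_real t) + \<beta> \<theta> * exp (- (of_real (ln s) + \<i> * of_real t)) + \<gamma> \<theta>" for \<theta> t
    proof -
      have d: "cis (t - u) = cis t * cis (- u)" for t u by (simp add: cis_mult)
      let ?f = "\<lambda>x y. c x y * of_real (?r x / ?r y) * cis ((\<theta>(b := t)) x - (\<theta>(b := t)) y)"
      have E: "exp (of_real (ln s) + \<i> * of_real t) = of_real s * cis t"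
        "exp (- (of_real (ln s) + \<i> * of_real t)) = of_real (1 / s) * cis (- t)"
        using that
        by (simp_all add: exp_add exp_diff cis_conv_exp exp_of_real exp_minus field_simps)
      have "(\<Sum>x\<in>R. \<Sum>y\<in>R. ?f x y) = ?f b b + (\<Sum>y\<in>S. ?f b y) + (\<Sum>x\<in>S. ?f x b) + (\<Sum>x\<in>S. \<Sum>y\<in>S. ?f x y)"
        using S by (simp only: S(3)) (simp add: sum.distrib)
      also have "?f b b = c b b" using that by simp
      also have "(\<Sum>y\<in>S. ?f b y) = \<alpha> \<theta> * (of_real s * cis t)"
        unfolding \<alpha>_def sum_distrib_right using S(2)
        by (intro sum.cong refl) (auto simp: d)
      also have "(\<Sum>x\<in>S. ?f x b) = \<beta> \<theta> * (of_real (1 / s) * cis (- t))"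
        unfolding \<beta>_def sum_distrib_right using S(2)
        by (intro sum.cong refl) (auto simp: d)
      also have "(\<Sum>x\<in>S. \<Sum>y\<in>S. ?f x y) = (\<Sum>x\<in>S. \<Sum>y\<in>S. c x y * of_real (r x / r y) * cis (\<theta> x - \<theta> y))"
        using S(2) by (intro sum.cong refl) auto
      finally show ?thesis unfolding E by (simp add: \<gamma>_def)
    qed
    have "gauged_integral R c ?r = (LINT \<theta>|angles S. LINT t|circ.
        exp (\<Sum>x\<in>R. \<Sum>y\<in>R. c x y * of_real (?r x / ?r y) * cis ((\<theta>(b := t)) x - (\<theta>(b := t)) y)))"
      unfolding gauged_integral_def S(3)
      by (rule product_integral_insert[OF S(1,2) integrable_exp_angles]) (use S in simp)
    also have "\<dots> = (LINT \<theta>|angles S. LINT t|circ. h \<theta> (of_real (ln s) + \<i> * of_real t))"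
      by (simp only: e h_def)
    finally show ?thesis .
  qed
  have "(LINT t|circ. h \<theta> (of_real (ln s) + \<i> * of_real t)) = (LINT t|circ. h \<theta> (of_real (ln s') + \<i> * of_real t))" for \<theta>
  proof (rule integral_circ_vertical_shift)
    show "h \<theta> holomorphic_on UNIV" unfolding h_def by (intro holomorphic_intros)
    show "h \<theta> (w + 2 * of_real pi * \<i>) = h \<theta> w" for w
      by (simp add: h_def exp_add exp_diff exp_minus mult_ac)
  qed
  then show ?thesis by (simp only: *[OF assms(3)] *[OF assms(4)])
qed

lemma gauged_integral_eq:
  assumes "finite R" "\<And>x. x \<in> R \<Longrightarrow> 0 < r x"
  shows "gauged_integral R c r = gauged_integral R c (\<lambda>_. 1)"
proof -
  have "gauged_integral R c (\<lambda>x. if x \<in> D then r x else 1) = gauged_integral R c (\<lambda>_. 1)"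
    if "finite D" "D \<subseteq> R" for D
    using that
  proof (induction D rule: finite_induct)
    case (insert b D)
    let ?r = "\<lambda>x. if x \<in> D then r x else 1"
    have "(\<lambda>x. if x \<in> insert b D then r x else 1) = ?r(b := r b)" "?r(b := 1) = ?r"
      using insert.hyps by auto
    then have "gauged_integral R c (\<lambda>x. if x \<in> insert b D then r x else 1) = gauged_integral R c ?r"
      using gauged_integral_update[of R b "r b" 1 c ?r] assms insert.prems by simp
    then show ?case using insert by simp
  qed simp
  from this[OF assms(1) subset_refl] show ?thesis
    by (simp add: gauged_integral_def cong: sum.cong)
qed

text \<open>
With \<open>r x = sqrt (l x)\<close> the weight \<open>sqrt (l x) * sqrt (l y)\<close> becomes \<open>l x\<close>; the exponent, now linear
in \<open>l\<close>, is smooth up to the boundary of the orthant.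
\<close>

lemma angular_integral_eq_phase_exp:
  assumes "finite R" "\<And>x. x \<in> R \<Longrightarrow> 0 < l x"
  shows "angular_integral A R l = (LINT \<theta>|angles R. phase_exp R (\<lambda>x y. of_real (A x y)) l \<theta>)"
proof -
  let ?c = "\<lambda>x y. complex_of_real (A x y * sqrt (l x) * sqrt (l y))"
  have "angular_integral A R l = gauged_integral R ?c (\<lambda>_. 1)"
    using assms(1) by (simp add: angular_integral_eq gauged_integral_def)
  also have "\<dots> = gauged_integral R ?c (\<lambda>x. sqrt (l x))"
    by (rule gauged_integral_eq[symmetric]) (use assms in auto)
  also have "\<dots> = (LINT \<theta>|angles R. phase_exp R (\<lambda>x y. of_real (A x y)) l \<theta>)"
    unfolding gauged_integral_def phase_exp_def
  proof (intro Bochner_Integration.integral_cong refl arg_cong[where f = exp] sum.cong)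
    fix \<theta> x assume x: "x \<in> R"
    have "(\<Sum>y\<in>R. ?c x y * of_real (sqrt (l x) / sqrt (l y)) * cis (\<theta> x - \<theta> y)) =
       (\<Sum>y\<in>R. of_real (l x) * (cis (\<theta> x) * (of_real (A x y) * cis (- \<theta> y))))"
    proof (intro sum.cong refl)
      fix y assume y: "y \<in> R"
      have "A x y * sqrt (l x) * sqrt (l y) * (sqrt (l x) / sqrt (l y)) = A x y * l x"
        using assms(2)[OF x] assms(2)[OF y] by (simp add: field_simps)
      then have "?c x y * of_real (sqrt (l x) / sqrt (l y)) = of_real (A x y * l x)"
        by (simp only: flip: of_real_mult)
      moreover have "cis (\<theta> x - \<theta> y) = cis (\<theta> x) * cis (- \<theta> y)" by (simp add: cis_mult)
      ultimately show "?c x y * of_real (sqrt (l x) / sqrt (l y)) * cis (\<theta> x - \<theta> y) =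
         of_real (l x) * (cis (\<theta> x) * (of_real (A x y) * cis (- \<theta> y)))"
        by (simp only:) (simp add: mult_ac)
    qed
    also have "\<dots> = of_real (l x) * rate R (\<lambda>x y. of_real (A x y)) \<theta> x"
      using x by (simp add: rate_def sum_distrib_left)
    finally show "(\<Sum>y\<in>R. ?c x y * of_real (sqrt (l x) / sqrt (l y)) * cis (\<theta> x - \<theta> y)) =
       of_real (l x) * rate R (\<lambda>x y. of_real (A x y)) \<theta> x" .
  qed
  finally show ?thesis .
qed

section \<open>The differential operator acts on phase averages by multiplication\<close>

definition eval_monomial :: "('a \<Rightarrow> complex) \<Rightarrow> ('a \<Rightarrow>\<^sub>0 nat) \<Rightarrow> complex" where
  "eval_monomial u m = (\<Prod>x\<in>Poly_Mapping.keys m. u x ^ Poly_Mapping.lookup m x)"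

text \<open>
Substitution of numbers for the indeterminates. It is a ring homomorphism, so it commutes with
taking cofactors.
\<close>

definition eval_symbol :: "('a \<Rightarrow> complex) \<Rightarrow> 'a symbol \<Rightarrow> complex" where
  "eval_symbol u p = (\<Sum>m\<in>Poly_Mapping.keys p. of_real (Poly_Mapping.lookup p m) * eval_monomial u m)"

lemma eval_monomial_superset:
  assumes "finite S" "Poly_Mapping.keys m \<subseteq> S"
  shows "eval_monomial u m = (\<Prod>x\<in>S. u x ^ Poly_Mapping.lookup m x)"
  unfolding eval_monomial_def
  by (rule prod.mono_neutral_left) (use assms in \<open>auto simp: in_keys_iff\<close>)

lemma eval_monomial_add: "eval_monomial u (m + n) = eval_monomial u m * eval_monomial u n"
proof -
  let ?S = "Poly_Mapping.keys m \<union> Poly_Mapping.keys n"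
  have "Poly_Mapping.keys (m + n) \<subseteq> ?S" by (rule Poly_Mapping.keys_add)
  then show ?thesis
    by (simp add: eval_monomial_superset[of ?S] lookup_add power_add prod.distrib)
qed

lemma eval_symbol_superset:
  assumes "finite S" "Poly_Mapping.keys p \<subseteq> S"
  shows "eval_symbol u p = (\<Sum>m\<in>S. of_real (Poly_Mapping.lookup p m) * eval_monomial u m)"
  unfolding eval_symbol_def
  by (rule sum.mono_neutral_left) (use assms in \<open>auto simp: in_keys_iff\<close>)

lemma eval_symbol_add: "eval_symbol u (p + q) = eval_symbol u p + eval_symbol u q"
proof -
  let ?S = "Poly_Mapping.keys p \<union> Poly_Mapping.keys q"
  have "Poly_Mapping.keys (p + q) \<subseteq> ?S" by (rule Poly_Mapping.keys_add)
  then show ?thesis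
    by (simp add: eval_symbol_superset[of ?S] lookup_add ring_distribs sum.distrib)
qed

lemma eval_symbol_0: "eval_symbol u 0 = 0"
  by (simp add: eval_symbol_def)

lemma eval_symbol_uminus: "eval_symbol u (- p) = - eval_symbol u p"
  using eval_symbol_add[of u p "- p"] by (simp add: eval_symbol_0 eq_neg_iff_add_eq_0 add.commute)

lemma eval_symbol_diff: "eval_symbol u (p - q) = eval_symbol u p - eval_symbol u q"
  using eval_symbol_add[of u p "- q"] by (simp add: eval_symbol_uminus)

lemma eval_symbol_sum: "eval_symbol u (\<Sum>i\<in>I. f i) = (\<Sum>i\<in>I. eval_symbol u (f i))"
  by (induction I rule: infinite_finite_induct) (simp_all add: eval_symbol_0 eval_symbol_add)

lemma eval_symbol_single: "eval_symbol u (Poly_Mapping.single m c) = of_real c * eval_monomial u m"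
  by (cases "c = 0") (simp_all add: eval_symbol_def)

lemma symbol_eq_sum_single:
  fixes p :: "'a symbol"
  shows "p = (\<Sum>m\<in>Poly_Mapping.keys p. Poly_Mapping.single m (Poly_Mapping.lookup p m))"
proof (rule poly_mapping_eqI)
  fix n
  show "Poly_Mapping.lookup p n =
    Poly_Mapping.lookup (\<Sum>m\<in>Poly_Mapping.keys p. Poly_Mapping.single m (Poly_Mapping.lookup p m)) n"
    by (auto simp: lookup_sum lookup_single when_def in_keys_iff sum.delta')
qed

lemma eval_symbol_mult: "eval_symbol u (p * q) = eval_symbol u p * eval_symbol u q"
proof -
  let ?s = "\<lambda>p :: 'a symbol. \<lambda>m. Poly_Mapping.single m (Poly_Mapping.lookup p m)"
  have "p * q = (\<Sum>m\<in>Poly_Mapping.keys p. ?s p m) * (\<Sum>n\<in>Poly_Mapping.keys q. ?s q n)"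
    using symbol_eq_sum_single[of p] symbol_eq_sum_single[of q] by (rule arg_cong2)
  also have "\<dots> = (\<Sum>m\<in>Poly_Mapping.keys p. \<Sum>n\<in>Poly_Mapping.keys q. ?s p m * ?s q n)"
    by (rule sum_product)
  finally have "eval_symbol u (p * q) =
      (\<Sum>m\<in>Poly_Mapping.keys p. \<Sum>n\<in>Poly_Mapping.keys q. eval_symbol u (?s p m * ?s q n))"
    by (simp only: eval_symbol_sum)
  also have "\<dots> = (\<Sum>m\<in>Poly_Mapping.keys p. \<Sum>n\<in>Poly_Mapping.keys q.
      (of_real (Poly_Mapping.lookup p m) * eval_monomial u m) * (of_real (Poly_Mapping.lookup q n) * eval_monomial u n))"
    by (simp add: mult_single eval_symbol_single eval_monomial_add mult_ac)
  also have "\<dots> = eval_symbol u p * eval_symbol u q"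
    by (simp add: eval_symbol_def sum_product)
  finally show ?thesis .
qed

lemma eval_symbol_const: "eval_symbol u (symbol_const c) = of_real c"
  by (simp add: symbol_const_def eval_symbol_single eval_monomial_def)

lemma eval_symbol_partial: "eval_symbol u (symbol_partial x) = u x"
  by (simp add: symbol_partial_def eval_symbol_single eval_monomial_def)

lemma eval_symbol_1: "eval_symbol u 1 = 1"
  by (simp add: eval_symbol_single eval_monomial_def flip: single_one)

lemma eval_symbol_prod: "eval_symbol u (\<Prod>i\<in>I. f i) = (\<Prod>i\<in>I. eval_symbol u (f i))"
  by (induction I rule: infinite_finite_induct) (simp_all add: eval_symbol_1 eval_symbol_mult)

lemma eval_symbol_of_nat: "eval_symbol u (of_nat n) = of_nat n"
  by (induction n) (simp_all add: eval_symbol_0 eval_symbol_1 eval_symbol_add)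

lemma eval_symbol_of_int: "eval_symbol u (of_int n) = of_int n"
  by (cases n) (simp_all add: eval_symbol_of_nat eval_symbol_uminus eval_symbol_add eval_symbol_1 del: of_nat_Suc)

lemma eval_symbol_of_bool: "eval_symbol u (of_bool b) = of_bool b"
  by (cases b) (simp_all add: eval_symbol_0 eval_symbol_1)

lemma eval_symbol_cofactor_on:
  "eval_symbol u (cofactor_on R a b N) = cofactor_on R a b (\<lambda>x y. eval_symbol u (N x y))"
  by (simp add: cofactor_on_def det_on_def eval_symbol_sum eval_symbol_prod eval_symbol_mult
      eval_symbol_add eval_symbol_of_int eval_symbol_of_bool)

text \<open>
\<open>g\<close> is the average of \<open>H * phase_exp\<close> on the open orthant; this class is closed under partial
derivatives, each of which multiplies \<open>H\<close> by one more rate.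
\<close>

definition phase_average ::
    "'a set \<Rightarrow> ('a \<Rightarrow> 'a \<Rightarrow> complex) \<Rightarrow> (('a \<Rightarrow> real) \<Rightarrow> complex) \<Rightarrow> (('a \<Rightarrow> real) \<Rightarrow> complex) \<Rightarrow> bool" where
  "phase_average R M H g \<longleftrightarrow> H \<in> borel_measurable (angles R) \<and> (\<exists>C. \<forall>\<theta>. norm (H \<theta>) \<le> C) \<and>
     (\<forall>l. (\<forall>x\<in>R. 0 < l x) \<longrightarrow> g l = (LINT \<theta>|angles R. H \<theta> * phase_exp R M l \<theta>))"

lemma phase_exp_update:
  assumes "finite R"
  shows "phase_exp R M (l(x := t)) \<theta> =
    exp (of_real t * rate R M \<theta> x + (\<Sum>y\<in>R - {x}. of_real (l y) * rate R M \<theta> y))"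
proof (cases "x \<in> R")
  case True
  have "(\<Sum>y\<in>R. of_real ((l(x := t)) y) * rate R M \<theta> y) =
      of_real t * rate R M \<theta> x + (\<Sum>y\<in>R - {x}. of_real (l y) * rate R M \<theta> y)"
    using sum.remove[OF assms True, of "\<lambda>y. of_real ((l(x := t)) y) * rate R M \<theta> y"]
    by simp
  moreover have "(\<Sum>y\<in>R - {x}. of_real ((l(x := t)) y) * rate R M \<theta> y) =
      (\<Sum>y\<in>R - {x}. of_real (l y) * rate R M \<theta> y)"
    by (intro sum.cong) auto
  ultimately show ?thesis by (simp only: phase_exp_def)
next
  case False
  then have "(\<Sum>y\<in>R. of_real ((l(x := t)) y) * rate R M \<theta> y) = (\<Sum>y\<in>R. of_real (l y) * rate R M \<theta> y)"
    by (intro sum.cong) auto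
  with False show ?thesis by (simp add: phase_exp_def rate_def)
qed

text \<open>
The open orthant contains a whole interval of each coordinate line around each of its points, so
the values of \<open>g\<close> elsewhere do not influence the derivative.
\<close>

lemma phase_average_partial_deriv:
  assumes "finite R" "phase_average R M H g"
  shows "phase_average R M (\<lambda>\<theta>. H \<theta> * rate R M \<theta> x) (partial_deriv x g)"
proof -
  have H[measurable]: "H \<in> borel_measurable (angles R)" using assms(2) by (simp add: phase_average_def)
  obtain C where C: "\<And>\<theta>. norm (H \<theta>) \<le> C" using assms(2) by (auto simp: phase_average_def)
  then have "0 \<le> C" using norm_ge_zero order_trans by blast
  have g: "g l = (LINT \<theta>|angles R. H \<theta> * phase_exp R M l \<theta>)" if "\<And>x. x \<in> R \<Longrightarrow> 0 < l x" for l
    using assms(2) that by (simp add: phase_average_def)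
  interpret prob_space "angles R" by (rule prob_space_angles)
  show ?thesis
    unfolding phase_average_def
  proof (intro conjI allI impI)
    show "(\<lambda>\<theta>. H \<theta> * rate R M \<theta> x) \<in> borel_measurable (angles R)" by measurable
    show "\<exists>C. \<forall>\<theta>. norm (H \<theta> * rate R M \<theta> x) \<le> C"
      using C norm_rate_le[OF assms(1)] \<open>0 \<le> C\<close>
      by (auto simp: norm_mult intro!: exI[of _ "C * rate_bound R M"] mult_mono)
    fix l :: "'a \<Rightarrow> real" assume l: "\<forall>x\<in>R. 0 < l x"
    \<comment> \<open>A radius that keeps the coordinate positive.\<close>
    define e where "e = (if x \<in> R then l x / 2 else 1)"
    have e: "0 < e" using l by (simp add: e_def)
    define S where "S = {l x - e<..<l x + e}"
    let ?K = "rate_bound R M * (\<Sum>y\<in>R. \<bar>l y\<bar> + e)"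
    have K: "norm (phase_exp R M (l(x := t)) \<theta>) \<le> exp ?K" if "t \<in> S" for t \<theta>
    proof -
      have "\<bar>(l(x := t)) y\<bar> \<le> \<bar>l y\<bar> + e" for y
        using that e by (auto simp: S_def)
      then have "rate_bound R M * (\<Sum>y\<in>R. \<bar>(l(x := t)) y\<bar>) \<le> ?K"
        by (intro mult_left_mono sum_mono rate_bound_nonneg)
      then show ?thesis using norm_phase_exp_le[OF assms(1), of M "l(x := t)" \<theta>] by (meson exp_le_cancel_iff order_trans)
    qed
    have lx: "l x \<in> S" using e by (simp add: S_def)
    have "((\<lambda>t. LINT \<theta>|angles R. H \<theta> * phase_exp R M (l(x := t)) \<theta>) has_vector_derivative
       (LINT \<theta>|angles R. H \<theta> * rate R M \<theta> x * phase_exp R M (l(x := l x)) \<theta>)) (at (l x) within S)"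
    proof (rule has_vector_derivative_integral[where B = "C * exp ?K" and C = "C * rate_bound R M * exp ?K"])
      show "finite_measure (angles R)" by (rule finite_measure_axioms)
      show "convex S" "l x \<in> S" using lx by (simp_all add: S_def)
      show "norm (H \<theta> * phase_exp R M (l(x := l x)) \<theta>) \<le> C * exp ?K" for \<theta>
        unfolding norm_mult by (intro mult_mono C K lx norm_ge_zero \<open>0 \<le> C\<close>)
      show "norm (H \<theta> * rate R M \<theta> x * phase_exp R M (l(x := t)) \<theta>) \<le> C * rate_bound R M * exp ?K"
        if "t \<in> S" for \<theta> t
        unfolding norm_mult
        by (intro mult_mono C K that norm_ge_zero \<open>0 \<le> C\<close> norm_rate_le assms(1) mult_nonneg_nonneg rate_bound_nonneg)
      show "((\<lambda>t. H \<theta> * phase_exp R M (l(x := t)) \<theta>) has_vector_derivative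
        H \<theta> * rate R M \<theta> x * phase_exp R M (l(x := t)) \<theta>) (at t within S)" for \<theta> t
      proof -
        let ?c = "\<Sum>y\<in>R - {x}. of_real (l y) * rate R M \<theta> y"
        have "((\<lambda>z. H \<theta> * exp (z * rate R M \<theta> x + ?c)) has_field_derivative
            H \<theta> * rate R M \<theta> x * exp (of_real t * rate R M \<theta> x + ?c)) (at (of_real t))"
          by (auto intro!: derivative_eq_intros)
        then show ?thesis
          unfolding phase_exp_update[OF assms(1)]
          by (rule has_vector_derivative_real_field)
      qed
    qed measurable
    then have "((\<lambda>t. LINT \<theta>|angles R. H \<theta> * phase_exp R M (l(x := t)) \<theta>) has_vector_derivative
       (LINT \<theta>|angles R. H \<theta> * rate R M \<theta> x * phase_exp R M l \<theta>)) (at (l x))"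
      using lx by (subst (asm) has_vector_derivative_within_open) (auto simp: S_def)
    then have "((\<lambda>t. g (l(x := t))) has_vector_derivative
       (LINT \<theta>|angles R. H \<theta> * rate R M \<theta> x * phase_exp R M l \<theta>)) (at (l x))"
    proof (rule has_vector_derivative_transform_within_open)
      show "open S" "l x \<in> S" using lx by (simp_all add: S_def)
      fix t assume "t \<in> S"
      then have "0 < (l(x := t)) y" if "y \<in> R" for y
        using that l by (auto simp: S_def e_def split: if_splits)
      then show "(LINT \<theta>|angles R. H \<theta> * phase_exp R M (l(x := t)) \<theta>) = g (l(x := t))"
        by (intro g[symmetric])
    qed
    then show "partial_deriv x g l = (LINT \<theta>|angles R. H \<theta> * rate R M \<theta> x * phase_exp R M l \<theta>)"
      unfolding partial_deriv_def by (rule vector_derivative_at)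
  qed
qed

lemma phase_average_monomial_deriv:
  assumes "finite R" "phase_average R M (\<lambda>_. 1) f"
  shows "phase_average R M (\<lambda>\<theta>. eval_monomial (rate R M \<theta>) m) (monomial_deriv m f)"
proof -
  let ?n = "Poly_Mapping.lookup m"
  have iter: "phase_average R M (\<lambda>\<theta>. H \<theta> * rate R M \<theta> x ^ n) ((partial_deriv x ^^ n) g)"
    if "phase_average R M H g" for H g x n
  proof (induction n)
    case (Suc n)
    from phase_average_partial_deriv[OF assms(1) this, of x] show ?case
      by (simp add: mult_ac)
  qed (use that in simp)
  have list: "phase_average R M (\<lambda>\<theta>. \<Prod>x\<leftarrow>xs. rate R M \<theta> x ^ ?n x) (foldr (\<lambda>x. partial_deriv x ^^ ?n x) xs f)" for xs
  proof (induction xs)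
    case (Cons x xs)
    from iter[OF this, of x "?n x"] show ?case by (simp add: mult_ac)
  qed (use assms(2) in simp)
  interpret folding_insort_key "(\<le>)" "(<)" UNIV "to_nat :: 'a \<Rightarrow> nat" by standard simp
  let ?xs = "sorted_key_list_of_set to_nat (Poly_Mapping.keys m)"
  have "distinct ?xs" "set ?xs = Poly_Mapping.keys m"
    using distinct_sorted_key_list_of_set[of "Poly_Mapping.keys m"] set_sorted_key_list_of_set[of "Poly_Mapping.keys m"]
    by (auto simp: distinct_map linorder_class.sorted_key_list_of_set_dict)
  then have "(\<Prod>x\<leftarrow>?xs. rate R M \<theta> x ^ ?n x) = eval_monomial (rate R M \<theta>) m" for \<theta>
    using prod.distinct_set_conv_list[of ?xs "\<lambda>x. rate R M \<theta> x ^ ?n x"] by (simp add: eval_monomial_def)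
  with list[of ?xs] show ?thesis by (simp add: monomial_deriv_def)
qed

lemma local_time_density_eq_phase_density:
  assumes "finite R" "\<And>x. x \<in> R \<Longrightarrow> 0 < l x"
  shows "local_time_density A R a b l = phase_density R (\<lambda>x y. of_real (A x y)) a b l"
proof -
  interpret prob_space "angles R" by (rule prob_space_angles)
  let ?M = "\<lambda>x y. complex_of_real (A x y)"
  let ?N = "\<lambda>x y. - symbol_const (A x y) + (if x = y then symbol_partial x else 0)"
  let ?p = "cofactor_on R a b ?N"
  have f: "phase_average R ?M (\<lambda>_. 1) (angular_integral A R)"
    using angular_integral_eq_phase_exp[OF assms(1)] by (auto simp: phase_average_def)
  have ev: "eval_symbol (rate R ?M \<theta>) ?p = cofactor_on R a b (phase_matrix R ?M \<theta>)" for \<theta>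
  proof -
    have "(\<lambda>x y. eval_symbol (rate R ?M \<theta>) (?N x y)) = phase_matrix R ?M \<theta>"
      by (auto simp: fun_eq_iff phase_matrix_def eval_symbol_add eval_symbol_diff eval_symbol_uminus
        eval_symbol_const eval_symbol_partial eval_symbol_0)
    then show ?thesis by (simp add: eval_symbol_cofactor_on)
  qed
  have mono: "phase_average R ?M (\<lambda>\<theta>. eval_monomial (rate R ?M \<theta>) m) (monomial_deriv m (angular_integral A R))" for m
    by (rule phase_average_monomial_deriv[OF assms(1) f])
  have int: "integrable (angles R) (\<lambda>\<theta>. eval_monomial (rate R ?M \<theta>) m * phase_exp R ?M l \<theta>)" for m
  proof -
    have [measurable]: "(\<lambda>\<theta>. eval_monomial (rate R ?M \<theta>) m) \<in> borel_measurable (angles R)"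
      using mono[of m] by (simp add: phase_average_def)
    obtain C where C: "\<And>\<theta>. norm (eval_monomial (rate R ?M \<theta>) m) \<le> C"
      using mono[of m] by (auto simp: phase_average_def)
    then have "0 \<le> C" using norm_ge_zero order_trans by blast
    show ?thesis
      by (rule integrable_const_bound[where B = "C * exp (rate_bound R ?M * (\<Sum>x\<in>R. \<bar>l x\<bar>))"])
        (use C \<open>0 \<le> C\<close> norm_phase_exp_le[OF assms(1)] in \<open>auto simp: norm_mult intro!: mult_mono\<close>)
  qed
  have "local_time_density A R a b l = (\<Sum>m\<in>Poly_Mapping.keys ?p. of_real (Poly_Mapping.lookup ?p m) *
      (LINT \<theta>|angles R. eval_monomial (rate R ?M \<theta>) m * phase_exp R ?M l \<theta>))"
    unfolding local_time_density_def apply_symbol_def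
    using mono assms(2) by (intro sum.cong refl) (auto simp: phase_average_def)
  also have "\<dots> = (LINT \<theta>|angles R. (\<Sum>m\<in>Poly_Mapping.keys ?p. of_real (Poly_Mapping.lookup ?p m) *
      (eval_monomial (rate R ?M \<theta>) m * phase_exp R ?M l \<theta>)))"
    using int by (subst Bochner_Integration.integral_sum) (auto intro!: integrable_mult_right)
  also have "\<dots> = phase_density R ?M a b l"
    unfolding phase_density_def ev[symmetric] eval_symbol_def
    by (simp add: sum_distrib_right mult.assoc)
  finally show ?thesis .
qed

section \<open>Exponential integrals over the simplex\<close>

lemma space_simplex_measure: "space (simplex_measure R T) = pos_simplex R T"
  by (auto simp: simplex_measure_def simplex_measure_coord_def space_restrict_space space_PiM pos_simplex_def PiE_def)

lemma sets_simplex_measure: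
  "sets (simplex_measure R T) = sets (restrict_space (\<Pi>\<^sub>M x\<in>R. borel) (pos_simplex R T))"
  by (simp add: simplex_measure_def sets_coord)

lemma measurable_simplex_measure_component:
  assumes "x \<in> R"
  shows "(\<lambda>l. l x) \<in> borel_measurable (simplex_measure R T)"
  using measurable_restrict_space1[OF measurable_component_singleton[OF assms]]
  by (simp add: measurable_cong_sets[OF sets_simplex_measure refl])

lemma pos_simplex_iff:
  "l \<in> pos_simplex R T \<longleftrightarrow> l \<in> extensional R \<and> (\<forall>x\<in>R. 0 < l x) \<and> (\<Sum>x\<in>R. l x) = T"
  by (auto simp: pos_simplex_def PiE_def Pi_def)

lemma pos_simplex_bounds:
  assumes "finite R" "l \<in> pos_simplex R T" "x \<in> R"
  shows "0 < l x" "l x \<le> T"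
proof -
  show p: "0 < l x" using assms by (auto simp: pos_simplex_def)
  have "l x \<le> (\<Sum>x\<in>R. l x)"
    using assms by (intro member_le_sum) (auto simp: pos_simplex_def intro: less_imp_le)
  then show "l x \<le> T" using assms(2) by (simp add: pos_simplex_def)
qed

lemma pos_simplex_empty:
  assumes "finite R" "R \<noteq> {}" "T \<le> 0"
  shows "pos_simplex R T = {}"
  using pos_simplex_bounds[OF assms(1)] assms(2,3) by fastforce

lemma emeasure_simplex_measure_le:
  fixes R :: "'a set"
  assumes "finite R" "R \<noteq> {}" "0 \<le> T"
  shows "emeasure (simplex_measure R T) (space (simplex_measure R T)) \<le> ennreal (T ^ (card R - 1))"
proof -
  obtain x0 where x0: "x0 \<in> R" using assms(2) by auto
  interpret product_sigma_finite "\<lambda>_ :: 'a. lborel :: real measure" by standard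
  let ?S = "R - {x0}"
  have "emeasure (simplex_measure R T) (space (simplex_measure R T)) = (\<integral>\<^sup>+l. 1 \<partial>simplex_measure_coord x0 R T)"
    by (simp add: simplex_measure_eq_coord[OF assms(1) x0])
  also have "\<dots> = (\<integral>\<^sup>+l. indicator (pos_simplex R T) (l(x0 := T - (\<Sum>x\<in>?S. l x))) \<partial>(\<Pi>\<^sub>M x\<in>?S. lborel))"
    by (subst nn_integral_coord[OF assms(1) x0]) simp_all
  also have "\<dots> \<le> (\<integral>\<^sup>+l. indicator (?S \<rightarrow>\<^sub>E {0..T}) l \<partial>(\<Pi>\<^sub>M x\<in>?S. lborel))"
  proof (rule nn_integral_mono)
    fix l :: "'a \<Rightarrow> real" assume l: "l \<in> space (\<Pi>\<^sub>M x\<in>?S. lborel)"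
    show "indicator (pos_simplex R T) (l(x0 := T - (\<Sum>x\<in>?S. l x))) \<le> (indicator (?S \<rightarrow>\<^sub>E {0..T}) l :: ennreal)"
    proof (cases "l(x0 := T - (\<Sum>x\<in>?S. l x)) \<in> pos_simplex R T")
      case True
      have "0 \<le> l x \<and> l x \<le> T" if "x \<in> ?S" for x
        using pos_simplex_bounds[OF assms(1) True, of x] that by auto
      then have "l \<in> ?S \<rightarrow>\<^sub>E {0..T}" using l by (auto simp: space_PiM PiE_def Pi_def)
      then show ?thesis by (simp add: indicator_def)
    qed simp
  qed
  also have "\<dots> = (\<Prod>x\<in>?S. emeasure lborel {0..T})"
    using assms(1) by (subst nn_integral_indicator) (auto simp: emeasure_PiM intro!: sets_PiM_I_finite)
  also have "\<dots> = ennreal (T ^ (card R - 1))"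
    using assms x0 by (simp add: ennreal_power)
  finally show ?thesis .
qed

lemma finite_measure_simplex_measure:
  assumes "finite R" "R \<noteq> {}"
  shows "finite_measure (simplex_measure R T)"
proof (rule finite_measureI)
  show "emeasure (simplex_measure R T) (space (simplex_measure R T)) \<noteq> \<infinity>"
  proof (cases "0 \<le> T")
    case True
    show ?thesis using emeasure_simplex_measure_le[OF assms True]
      by (metis ennreal_neq_top infinity_ennreal_def neq_top_trans)
  next
    case False
    then show ?thesis using pos_simplex_empty[OF assms, of T] by (simp add: space_simplex_measure)
  qed
qed

text \<open>
The value at \<open>T = 0\<close>, where the simplex is empty, is the limit from the right: the total mass is of
order \<open>T ^ (card R - 1)\<close>.
\<close>

definition simplex_exp :: "'a set \<Rightarrow> real \<Rightarrow> ('a \<Rightarrow> complex) \<Rightarrow> complex" where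
  "simplex_exp R T u =
     (if T = 0 then of_bool (card R = 1) else LINT l|simplex_measure R T. exp (\<Sum>x\<in>R. of_real (l x) * u x))"

lemma norm_exp_simplex_le:
  assumes "finite R" "\<And>x. x \<in> R \<Longrightarrow> norm (u x) \<le> U" "l \<in> pos_simplex R T"
  shows "norm (exp (\<Sum>x\<in>R. complex_of_real (l x) * u x)) \<le> exp (U * T)"
proof -
  have "norm (\<Sum>x\<in>R. complex_of_real (l x) * u x) \<le> (\<Sum>x\<in>R. l x * U)"
    using assms(2) pos_simplex_bounds(1)[OF assms(1,3)]
    by (intro sum_norm_le) (auto simp: norm_mult less_imp_le intro!: mult_mono)
  also have "\<dots> = U * T"
    using assms(3) by (simp add: pos_simplex_def mult.commute flip: sum_distrib_left)
  finally show ?thesis by (intro order_trans[OF norm_exp]) simp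
qed

lemma integrable_exp_simplex:
  assumes "finite R" "R \<noteq> {}"
  shows "integrable (simplex_measure R T) (\<lambda>l. exp (\<Sum>x\<in>R. complex_of_real (l x) * u x))"
proof -
  note [measurable] = measurable_simplex_measure_component
  interpret finite_measure "simplex_measure R T" by (rule finite_measure_simplex_measure[OF assms])
  define U where "U = (\<Sum>x\<in>R. norm (u x))"
  have "norm (u x) \<le> U" if "x \<in> R" for x
    unfolding U_def using assms that by (intro member_le_sum) auto
  from norm_exp_simplex_le[OF assms(1) this] show ?thesis
    by (intro integrable_const_bound[where B = "exp (U * T)"] AE_I2)
      (auto simp: space_simplex_measure)
qed

lemma norm_simplex_exp_le:
  assumes "finite R" "R \<noteq> {}" "\<And>x. x \<in> R \<Longrightarrow> norm (u x) \<le> U" "0 \<le> U" "0 \<le> T" "T \<le> T1"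
  shows "norm (simplex_exp R T u) \<le> exp (U * T1) * T1 ^ (card R - 1) + 1"
proof (cases "T = 0")
  case True
  have "0 \<le> exp (U * T1) * T1 ^ (card R - 1)" using assms by simp
  with True show ?thesis by (simp add: simplex_exp_def)
next
  case False
  interpret finite_measure "simplex_measure R T" by (rule finite_measure_simplex_measure[OF assms(1,2)])
  have m: "measure (simplex_measure R T) (space (simplex_measure R T)) \<le> T ^ (card R - 1)"
    using emeasure_simplex_measure_le[OF assms(1,2,5)] assms(5) by (simp add: emeasure_eq_measure)
  have "norm (simplex_exp R T u) \<le> (LINT l|simplex_measure R T. exp (U * T))"
    unfolding simplex_exp_def if_not_P[OF False]
    by (intro order_trans[OF integral_norm_bound integral_mono] integrable_norm integrable_exp_simplex assms)
      (use norm_exp_simplex_le[OF assms(1,3)] in \<open>simp_all add: space_simplex_measure\<close>)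
  also have "\<dots> = measure (simplex_measure R T) (space (simplex_measure R T)) * exp (U * T)" by simp
  also have "\<dots> \<le> T1 ^ (card R - 1) * exp (U * T1)"
    using assms m power_mono[OF assms(6,5), of "card R - 1"] by (intro mult_mono) (auto intro: mult_left_mono)
  finally show ?thesis by (simp add: mult.commute)
qed

lemma integral_simplex_measure_coord:
  fixes f :: "('a \<Rightarrow> real) \<Rightarrow> complex" and T :: real
  assumes "finite R" "x0 \<in> R" and [measurable]: "f \<in> borel_measurable (\<Pi>\<^sub>M x\<in>R. borel)"
  defines "g \<equiv> \<lambda>l. l(x0 := T - (\<Sum>x\<in>R - {x0}. l x))"
  shows "(LINT l|simplex_measure R T. f l) =
      (LINT l|(\<Pi>\<^sub>M x\<in>R - {x0}. lborel). indicator (pos_simplex R T) (g l) *\<^sub>R f (g l))"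
    and "integrable (simplex_measure R T) f \<Longrightarrow>
      integrable (\<Pi>\<^sub>M x\<in>R - {x0}. lborel) (\<lambda>l. indicator (pos_simplex R T) (g l) *\<^sub>R f (g l))"
proof -
  note [measurable] = pos_simplex_measurable[OF assms(1)]
  have g[measurable]: "g \<in> measurable (\<Pi>\<^sub>M x\<in>R - {x0}. lborel) (\<Pi>\<^sub>M x\<in>R. borel)"
    unfolding g_def by (rule coord_map_measurable'[OF assms(2)])
  show "(LINT l|simplex_measure R T. f l) =
      (LINT l|(\<Pi>\<^sub>M x\<in>R - {x0}. lborel). indicator (pos_simplex R T) (g l) *\<^sub>R f (g l))"
    unfolding simplex_measure_eq_coord[OF assms(1,2)] simplex_measure_coord_def
    by (subst integral_restrict_space) (auto simp: g_def[symmetric] integral_distr)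
  show "integrable (simplex_measure R T) f \<Longrightarrow>
      integrable (\<Pi>\<^sub>M x\<in>R - {x0}. lborel) (\<lambda>l. indicator (pos_simplex R T) (g l) *\<^sub>R f (g l))"
    unfolding simplex_measure_eq_coord[OF assms(1,2)] simplex_measure_coord_def
    by (subst (asm) integrable_restrict_space) (auto simp: g_def[symmetric] integrable_distr_eq)
qed

lemma simplex_exp_singleton:
  assumes "0 \<le> T"
  shows "simplex_exp {b} T u = exp (of_real T * u b)"
proof (cases "T = 0")
  case False
  interpret product_sigma_finite "\<lambda>_ :: 'a. lborel :: real measure" by standard
  let ?g = "\<lambda>l :: 'a \<Rightarrow> real. l(b := T - (\<Sum>x\<in>{b} - {b}. l x))"
  have "simplex_exp {b} T u = (LINT l|(\<Pi>\<^sub>M x\<in>{b} - {b}. lborel). indicator (pos_simplex {b} T) (?g l) *\<^sub>R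
      exp (\<Sum>x\<in>{b}. of_real (?g l x) * u x))"
    using False by (subst integral_simplex_measure_coord(1)[symmetric]) (auto simp: simplex_exp_def)
  also have "\<dots> = exp (of_real T * u b)"
    using False assms by (simp add: PiM_empty lebesgue_integral_count_space_finite pos_simplex_def indicator_def PiE_def extensional_def)
  finally show ?thesis .
qed (simp add: simplex_exp_def)

lemma simplex_exp_empty: "simplex_exp {} T u = 0"
proof (cases "T = 0")
  case False
  then have "space (simplex_measure {} T :: ('a \<Rightarrow> real) measure) = {}"
    by (simp add: space_simplex_measure pos_simplex_def)
  with False show ?thesis by (auto simp: simplex_exp_def intro!: integral_eq_zero_AE AE_I2)
qed (simp add: simplex_exp_def)

lemma simplex_exp_neg: "finite R \<Longrightarrow> R \<noteq> {} \<Longrightarrow> T < 0 \<Longrightarrow> simplex_exp R T u = 0"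
  using pos_simplex_empty[of R T] by (auto simp: simplex_exp_def space_simplex_measure intro!: integral_eq_zero_AE AE_I2)

text \<open>
Integrate first over the coordinate \<open>c\<close>; given that it equals \<open>s\<close>, the others range over the
simplex of size \<open>T - s\<close>. The eliminated coordinate \<open>x0\<close> is taken in \<open>S\<close>, so that it is the same for
both simplices. The point \<open>s = T\<close> is left out because the value of \<open>simplex_exp\<close> at size zero is a
convention and not the integral.
\<close>

lemma simplex_exp_insert_lborel:
  fixes S :: "'a set"
  assumes "finite S" "S \<noteq> {}" "c \<notin> S" "0 < T"
  shows "simplex_exp (insert c S) T u =
    (LINT s|lborel. indicator ({0<..} - {T}) s *\<^sub>R (exp (of_real s * u c) * simplex_exp S (T - s) u))"
proof -
  interpret product_sigma_finite "\<lambda>_ :: 'a. lborel :: real measure" by standard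
  obtain x0 where x0: "x0 \<in> S" using assms(2) by auto
  define S' where "S' = S - {x0}"
  have S': "finite S'" "x0 \<notin> S'" "c \<notin> S'" "c \<noteq> x0" "S = insert x0 S'" "insert c S - {x0} = insert c S'"
    using assms x0 by (auto simp: S'_def)
  let ?R = "insert c S"
  let ?f = "\<lambda>R l. exp (\<Sum>x\<in>R. complex_of_real (l x) * u x)"
  have fm[measurable]: "?f R \<in> borel_measurable (\<Pi>\<^sub>M x\<in>R. borel)" if "finite R" for R by measurable
  note pm[measurable] = pos_simplex_measurable[of ?R] pos_simplex_measurable[of S]
  define G where "G l = indicator (pos_simplex ?R T) (l(x0 := T - (\<Sum>x\<in>insert c S'. l x))) *\<^sub>R
      ?f ?R (l(x0 := T - (\<Sum>x\<in>insert c S'. l x)))" for l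
  define H where "H t l = indicator (pos_simplex S t) (l(x0 := t - (\<Sum>x\<in>S'. l x))) *\<^sub>R
      ?f S (l(x0 := t - (\<Sum>x\<in>S'. l x)))" for t l
  have G_eq: "simplex_exp ?R T u = (LINT l|(\<Pi>\<^sub>M x\<in>insert c S'. lborel). G l)"
    using assms(1,4) x0 integral_simplex_measure_coord(1)[of ?R x0 "?f ?R" T]
    by (simp only: simplex_exp_def G_def S'(6)) simp
  have G_int: "integrable (\<Pi>\<^sub>M x\<in>insert c S'. lborel) G"
    unfolding G_def S'(6)[symmetric]
    by (rule integral_simplex_measure_coord(2)[OF _ _ _ integrable_exp_simplex]) (use assms x0 in auto)
  have H_eq: "simplex_exp S t u = (LINT l|(\<Pi>\<^sub>M x\<in>S'. lborel). H t l)" if "t \<noteq> 0" for t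
    using assms(1) x0 that integral_simplex_measure_coord(1)[of S x0 "?f S" t]
    by (simp only: simplex_exp_def H_def S'_def) simp
  have GH: "G (l(c := s)) = indicator {0<..} s *\<^sub>R (exp (of_real s * u c) * H (T - s) l)"
    if l: "l \<in> space (\<Pi>\<^sub>M x\<in>S'. lborel)" for l s
  proof -
    let ?l = "l(x0 := T - s - (\<Sum>x\<in>S'. l x))"
    have "(\<Sum>x\<in>S'. (l(c := s)) x) = (\<Sum>x\<in>S'. l x)" using S'(3) by (intro sum.cong) auto
    then have e: "(l(c := s))(x0 := T - (\<Sum>x\<in>insert c S'. (l(c := s)) x)) = ?l(c := s)"
      using S'(1-4) by (auto simp: fun_eq_iff)
    have sum: "(\<Sum>x\<in>S. (?l(c := s)) x) = (\<Sum>x\<in>S. ?l x)"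
      "(\<Sum>x\<in>S. of_real ((?l(c := s)) x) * u x) = (\<Sum>x\<in>S. of_real (?l x) * u x)"
      using assms(3) by (auto intro!: sum.cong)
    have "?l \<in> extensional S" using l by (auto simp: space_PiM S'(5) PiE_def extensional_def)
    then have ext: "?l(c := s) \<in> extensional ?R" by (auto simp: extensional_def)
    have "?l(c := s) \<in> pos_simplex ?R T \<longleftrightarrow> 0 < s \<and> ?l \<in> pos_simplex S (T - s)"
    proof -
      have 1: "(\<Sum>x\<in>?R. (?l(c := s)) x) = s + (\<Sum>x\<in>S. ?l x)"
        using assms(1,3) sum(1) by simp
      have 2: "(\<forall>x\<in>?R. 0 < (?l(c := s)) x) \<longleftrightarrow> 0 < s \<and> (\<forall>x\<in>S. 0 < ?l x)"
      proof -
        have "x \<noteq> c" if "x \<in> S" for x using that assms(3) by auto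
        then show ?thesis by auto
      qed
      show ?thesis
        unfolding pos_simplex_iff 1 2 using ext \<open>?l \<in> extensional S\<close> by (auto simp del: fun_upd_apply)
    qed
    then have i: "indicator (pos_simplex ?R T) (?l(c := s)) = (indicator {0<..} s * indicator (pos_simplex S (T - s)) ?l :: real)"
      by (simp add: indicator_def)
    have f: "?f ?R (?l(c := s)) = exp (of_real s * u c) * ?f S ?l"
      using assms(1,3) sum(2) by (simp add: exp_add del: fun_upd_apply) simp
    show ?thesis
      unfolding G_def H_def e i f by simp
  qed
  have mm: "(\<lambda>(s, l). l(c := s)) \<in> measurable (lborel \<Otimes>\<^sub>M (\<Pi>\<^sub>M x\<in>S'. lborel)) (\<Pi>\<^sub>M x\<in>insert c S'. lborel)"
  proof -
    have "(\<lambda>z. (snd z, fst z)) \<in> measurable (lborel \<Otimes>\<^sub>M (\<Pi>\<^sub>M x\<in>S'. lborel)) ((\<Pi>\<^sub>M x\<in>S'. lborel) \<Otimes>\<^sub>M (lborel :: real measure))"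
      by measurable
    from measurable_compose[OF this measurable_add_dim] show ?thesis by (simp add: case_prod_beta')
  qed
  have meas: "(\<lambda>s. LINT l|(\<Pi>\<^sub>M x\<in>S'. lborel). G (l(c := s))) \<in> borel_measurable lborel"
  proof -
    interpret S': finite_product_sigma_finite "\<lambda>_ :: 'a. lborel :: real measure" S'
      by standard (rule S'(1))
    have "(\<lambda>(s, l). G (l(c := s))) \<in> borel_measurable (lborel \<Otimes>\<^sub>M (\<Pi>\<^sub>M x\<in>S'. lborel))"
      using measurable_compose[OF mm borel_measurable_integrable[OF G_int]] by (simp add: case_prod_beta')
    from S'.borel_measurable_lebesgue_integral[OF this] show ?thesis by simp
  qed
  have GH': "(LINT l|(\<Pi>\<^sub>M x\<in>S'. lborel). G (l(c := s))) =
      indicator {0<..} s *\<^sub>R (exp (of_real s * u c) * (LINT l|(\<Pi>\<^sub>M x\<in>S'. lborel). H (T - s) l))" for s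
  proof -
    have "(LINT l|(\<Pi>\<^sub>M x\<in>S'. lborel). G (l(c := s))) =
        (LINT l|(\<Pi>\<^sub>M x\<in>S'. lborel). indicator {0<..} s *\<^sub>R (exp (of_real s * u c) * H (T - s) l))"
      by (intro Bochner_Integration.integral_cong refl GH)
    then show ?thesis by simp
  qed
  have "simplex_exp ?R T u = (LINT l|(\<Pi>\<^sub>M x\<in>{c} \<union> S'. lborel). G l)" by (simp add: G_eq)
  also have "\<dots> = (LINT x|(\<Pi>\<^sub>M x\<in>{c}. lborel). LINT l|(\<Pi>\<^sub>M x\<in>S'. lborel). G (merge {c} S' (x, l)))"
    by (rule product_integral_fold) (use S' G_int in auto)
  also have "\<dots> = (LINT x|(\<Pi>\<^sub>M x\<in>{c}. lborel). LINT l|(\<Pi>\<^sub>M x\<in>S'. lborel). G (l(c := x c)))"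
  proof (intro Bochner_Integration.integral_cong refl arg_cong[where f = G])
    fix x l :: "'a \<Rightarrow> real" assume "l \<in> space (\<Pi>\<^sub>M x\<in>S'. lborel)"
    then show "merge {c} S' (x, l) = l(c := x c)"
      using S'(3) by (auto simp: merge_def fun_eq_iff space_PiM PiE_def extensional_def)
  qed
  also have "\<dots> = (LINT s|lborel. LINT l|(\<Pi>\<^sub>M x\<in>S'. lborel). G (l(c := s)))"
    by (rule product_integral_singleton) (use meas in simp)
  also have "\<dots> = (LINT s|lborel. indicator {0<..} s *\<^sub>R (exp (of_real s * u c) * (LINT l|(\<Pi>\<^sub>M x\<in>S'. lborel). H (T - s) l)))"
    by (simp only: GH')
  also have "\<dots> = (LINT s|lborel. indicator ({0<..} - {T}) s *\<^sub>R (exp (of_real s * u c) * simplex_exp S (T - s) u))"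
  proof (rule integral_cong_AE)
    have m1: "(\<lambda>s. indicator {0<..} s *\<^sub>R (exp (of_real s * u c) * (LINT l|(\<Pi>\<^sub>M x\<in>S'. lborel). H (T - s) l))) \<in> borel_measurable lborel"
      using meas by (simp only: GH')
    then show "(\<lambda>s. indicator {0<..} s *\<^sub>R (exp (of_real s * u c) * (LINT l|(\<Pi>\<^sub>M x\<in>S'. lborel). H (T - s) l))) \<in> borel_measurable lborel" .
    have "(\<lambda>s. indicator (- {T}) s *\<^sub>R (indicator {0<..} s *\<^sub>R (exp (of_real s * u c) * (LINT l|(\<Pi>\<^sub>M x\<in>S'. lborel). H (T - s) l)))) \<in> borel_measurable lborel"
      by (rule borel_measurable_scaleR[OF _ m1]) simp
    also have "(\<lambda>s. indicator (- {T}) s *\<^sub>R (indicator {0<..} s *\<^sub>R (exp (of_real s * u c) * (LINT l|(\<Pi>\<^sub>M x\<in>S'. lborel). H (T - s) l)))) =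
       (\<lambda>s. indicator ({0<..} - {T}) s *\<^sub>R (exp (of_real s * u c) * simplex_exp S (T - s) u))"
      by (auto simp: fun_eq_iff indicator_def H_eq)
    finally show "(\<lambda>s. indicator ({0<..} - {T}) s *\<^sub>R (exp (of_real s * u c) * simplex_exp S (T - s) u)) \<in> borel_measurable lborel" .
    show "AE s in lborel. indicator {0<..} s *\<^sub>R (exp (of_real s * u c) * (LINT l|(\<Pi>\<^sub>M x\<in>S'. lborel). H (T - s) l)) =
       indicator ({0<..} - {T}) s *\<^sub>R (exp (of_real s * u c) * simplex_exp S (T - s) u)"
      using AE_lborel_singleton[of T] by eventually_elim (auto simp: indicator_def H_eq)
  qed
  finally show ?thesis .
qed

lemma simplex_exp_insert:
  fixes S :: "'a set"
  assumes "finite S" "S \<noteq> {}" "c \<notin> S" "0 \<le> T" and cont: "continuous_on {0..} (\<lambda>t. simplex_exp S t u)"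
  shows "simplex_exp (insert c S) T u =
    exp (of_real T * u c) * integral {0..T} (\<lambda>t. exp (- of_real t * u c) * simplex_exp S t u)"
proof (cases "T = 0")
  case True
  have "card (insert c S) \<noteq> 1" using assms by simp
  with True show ?thesis by (simp add: simplex_exp_def)
next
  case False
  then have T: "0 < T" using assms(4) by simp
  let ?F = "\<lambda>t. exp (- of_real t * u c) * simplex_exp S t u"
  have contF: "continuous_on {0..T} ?F"
    by (intro continuous_intros continuous_on_subset[OF cont]) auto
  have bi: "set_integrable lborel {0..T} ?F"
    unfolding set_integrable_def by (rule borel_integrable_atLeastAtMost'[OF contF, unfolded set_integrable_def])
  have "simplex_exp (insert c S) T u =
      (LINT s|lborel. indicator ({0<..} - {T}) s *\<^sub>R (exp (of_real s * u c) * simplex_exp S (T - s) u))"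
    by (rule simplex_exp_insert_lborel[OF assms(1-3) T])
  also have "\<dots> = (LINT t|lborel. indicator ({0<..} - {T}) (T - t) *\<^sub>R (exp (of_real (T - t) * u c) * simplex_exp S t u))"
    by (subst lborel_integral_real_affine[where c = "-1" and t = T]) simp_all
  also have "\<dots> = (LINT t|lborel. exp (of_real T * u c) * (indicator ({0..T} - {0, T}) t *\<^sub>R ?F t))"
  proof (intro Bochner_Integration.integral_cong refl)
    fix t :: real
    have "exp (of_real (T - t) * u c) = exp (of_real T * u c) * exp (- of_real t * u c)"
      by (simp add: left_diff_distrib flip: exp_add)
    then show "indicator ({0<..} - {T}) (T - t) *\<^sub>R (exp (of_real (T - t) * u c) * simplex_exp S t u) =
       exp (of_real T * u c) * (indicator ({0..T} - {0, T}) t *\<^sub>R ?F t)"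
      using simplex_exp_neg[OF assms(1,2), of t u] by (cases "t < 0") (auto simp: indicator_def)
  qed
  also have "\<dots> = exp (of_real T * u c) * (LINT t|lborel. indicator ({0..T} - {0, T}) t *\<^sub>R ?F t)"
    by (rule integral_mult_right_zero)
  also have "(LINT t|lborel. indicator ({0..T} - {0, T}) t *\<^sub>R ?F t) = (LINT t:{0..T}|lborel. ?F t)"
    unfolding set_lebesgue_integral_def
  proof (rule integral_cong_AE)
    have m: "(\<lambda>t. indicator {0..T} t *\<^sub>R ?F t) \<in> borel_measurable lborel"
      using bi unfolding set_integrable_def by (rule borel_measurable_integrable)
    then show "(\<lambda>t. indicator {0..T} t *\<^sub>R ?F t) \<in> borel_measurable lborel" .
    have "(\<lambda>t. indicator (- {0, T}) t *\<^sub>R (indicator {0..T} t *\<^sub>R ?F t)) \<in> borel_measurable lborel"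
      by (rule borel_measurable_scaleR[OF _ m]) simp
    also have "(\<lambda>t. indicator (- {0, T}) t *\<^sub>R (indicator {0..T} t *\<^sub>R ?F t)) =
       (\<lambda>t. indicator ({0..T} - {0, T}) t *\<^sub>R ?F t)"
      by (auto simp: fun_eq_iff indicator_def)
    finally show "(\<lambda>t. indicator ({0..T} - {0, T}) t *\<^sub>R ?F t) \<in> borel_measurable lborel" .
    show "AE t in lborel. indicator ({0..T} - {0, T}) t *\<^sub>R ?F t = indicator {0..T} t *\<^sub>R ?F t"
      using AE_lborel_singleton[of T] AE_lborel_singleton[of 0] by eventually_elim (auto simp: indicator_def)
  qed
  also have "\<dots> = integral {0..T} ?F"
    by (rule set_borel_integral_eq_integral(2)[OF bi])
  finally show ?thesis .
qed

text \<open>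
When \<open>T\<close> grows, either the coordinate \<open>b\<close> grows, which gives the factor \<open>u b\<close>, or the simplex is
extended at the face where it vanishes.
\<close>

lemma simplex_exp_has_vector_derivative:
  fixes R :: "'a set"
  assumes "finite R" "b \<in> R" "0 \<le> T"
  shows "((\<lambda>T. simplex_exp R T u) has_vector_derivative
     (u b * simplex_exp R T u + simplex_exp (R - {b}) T u)) (at T within {0..})"
  using assms
proof (induction "card R" arbitrary: R b T rule: less_induct)
  case less
  define S where "S = R - {b}"
  have S: "finite S" "b \<notin> S" "R = insert b S" using less.prems by (auto simp: S_def)
  show ?case
  proof (cases "S = {}")
    case True
    then have R: "R = {b}" using S by simp
    have "((\<lambda>T. exp (of_real T * u b)) has_vector_derivative u b * exp (of_real T * u b)) (at T within {0..})"
      by (rule has_vector_derivative_real_field) (auto intro!: derivative_eq_intros)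
    then have "((\<lambda>T. simplex_exp R T u) has_vector_derivative u b * exp (of_real T * u b)) (at T within {0..})"
      by (rule has_vector_derivative_transform[rotated 2]) (use less.prems R in \<open>auto simp: simplex_exp_singleton\<close>)
    then show ?thesis using less.prems by (simp add: R simplex_exp_singleton simplex_exp_empty)
  next
    case False
    then obtain b' where "b' \<in> S" by auto
    have "card S < card R" using less.prems S by simp
    then have "continuous_on {0..} (\<lambda>t. simplex_exp S t u)"
      using less.hyps[OF _ S(1) \<open>b' \<in> S\<close>] has_vector_derivative_continuous
      by (fastforce simp: continuous_on_eq_continuous_within)
    note cont = this and rec = simplex_exp_insert[OF S(1) False S(2) _ this]
    let ?F = "\<lambda>t. exp (- of_real t * u b) * simplex_exp S t u"
    have contF: "continuous_on {0..T + 1} ?F"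
      by (intro continuous_intros continuous_on_subset[OF cont]) auto
    have w: "at T within {0..} = at T within {0..T + 1}"
      by (rule at_within_nhd[of _ "{..<T + 1}"]) (use less.prems in auto)
    have I: "((\<lambda>t. integral {0..t} ?F) has_vector_derivative ?F T) (at T within {0..})"
      unfolding w using integral_has_vector_derivative[OF contF, of T] less.prems by simp
    have E: "((\<lambda>T. exp (of_real T * u b)) has_vector_derivative u b * exp (of_real T * u b)) (at T within {0..})"
      by (rule has_vector_derivative_real_field) (auto intro!: derivative_eq_intros)
    have "((\<lambda>t. exp (of_real t * u b) * integral {0..t} ?F) has_vector_derivative
       exp (of_real T * u b) * ?F T + u b * exp (of_real T * u b) * integral {0..T} ?F) (at T within {0..})"
      by (rule has_vector_derivative_mult[OF E I])
    also have "exp (of_real T * u b) * ?F T = simplex_exp S T u"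
      by (simp flip: exp_add mult.assoc)
    also have "u b * exp (of_real T * u b) * integral {0..T} ?F = u b * simplex_exp R T u"
      using rec[of T] less.prems by (simp add: S(3))
    finally have "((\<lambda>t. exp (of_real t * u b) * integral {0..t} ?F) has_vector_derivative
       simplex_exp S T u + u b * simplex_exp R T u) (at T within {0..})" .
    then have "((\<lambda>T. simplex_exp R T u) has_vector_derivative
       simplex_exp S T u + u b * simplex_exp R T u) (at T within {0..})"
      by (rule has_vector_derivative_transform[rotated 2]) (use less.prems rec in \<open>auto simp: S(3)\<close>)
    then show ?thesis by (simp add: S_def add.commute)
  qed
qed

section \<open>The forward equation for the integrated density\<close>

text \<open>
The integral of the density over the simplex, with the order of integration exchanged
(\<open>simplex_mass_eq_integral_density\<close>). It is set to zero unless \<open>a\<close> and \<open>b\<close> belong to \<open>R\<close>, as no path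
from \<open>a\<close> to \<open>b\<close> has another range.
\<close>

definition simplex_mass :: "'a set \<Rightarrow> ('a \<Rightarrow> 'a \<Rightarrow> complex) \<Rightarrow> 'a \<Rightarrow> 'a \<Rightarrow> real \<Rightarrow> complex" where
  "simplex_mass R M a b T = (if a \<in> R \<and> b \<in> R
     then LINT \<theta>|angles R. cofactor_on R a b (phase_matrix R M \<theta>) * simplex_exp R T (rate R M \<theta>) else 0)"

text \<open>
The deleted row \<open>b\<close> was the only place with \<open>cis (\<theta> b)\<close>, so at \<open>l b = 0\<close> the integrand is an
entire function of \<open>z = cis (- \<theta> b)\<close>. At \<open>z = 0\<close> the rates of \<open>R\<close> turn into those of
\<open>R - {b}\<close>. For \<open>a = b\<close> what remains is the determinant of a phase matrix, which vanishes.
\<close>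

lemma integral_boundary_phase:
  fixes R :: "'a set"
  assumes "finite R" "a \<in> R" "b \<in> R" "R - {b} \<noteq> {}"
  shows "(LINT \<theta>|angles R. cofactor_on R a b (phase_matrix R M \<theta>) *
      exp (\<Sum>x\<in>R - {b}. of_real (l x) * rate R M \<theta> x)) =
    (if a = b then 0 else \<Sum>c\<in>R - {b}. phase_density (R - {b}) M a c l * M c b)"
proof -
  interpret product_sigma_finite "\<lambda>_ :: 'a. circ" by (rule product_sigma_finite_circ)
  interpret prob_space "angles R" by (rule prob_space_angles)
  define S where "S = R - {b}"
  have S: "finite S" "b \<notin> S" "R = insert b S" "S \<noteq> {}" using assms by (auto simp: S_def)
  define r where "r \<theta> z x = (if x \<in> S then cis (\<theta> x) * ((\<Sum>y\<in>S. M x y * cis (- \<theta> y)) + M x b * z) else 0)"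
    for \<theta> :: "'a \<Rightarrow> real" and z x
  define N where "N \<theta> z x y = (if x = y then r \<theta> z x else 0) - M x y" for \<theta> z x y
  define g where "g \<theta> z = (if a = b then det_on S (N \<theta> z) else \<Sum>c\<in>S. M c b * cofactor_on S a c (N \<theta> z)) *
      exp (\<Sum>x\<in>S. of_real (l x) * r \<theta> z x)" for \<theta> z
  have r: "rate R M (\<theta>(b := t)) x = r \<theta> (cis (- t)) x" if "x \<in> S" for \<theta> t x
  proof -
    have "x \<noteq> b" using that S(2) by auto
    have "(\<Sum>y\<in>R. M x y * cis (- (\<theta>(b := t)) y)) = M x b * cis (- t) + (\<Sum>y\<in>S. M x y * cis (- (\<theta>(b := t)) y))"
      using S(1,2) by (simp add: S(3))
    also have "(\<Sum>y\<in>S. M x y * cis (- (\<theta>(b := t)) y)) = (\<Sum>y\<in>S. M x y * cis (- \<theta> y))"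
      using S(2) by (intro sum.cong) auto
    finally show ?thesis using that \<open>x \<noteq> b\<close> by (simp add: rate_def r_def S(3) add.commute)
  qed
  have r0: "r \<theta> 0 = rate S M \<theta>" for \<theta> by (auto simp: r_def rate_def fun_eq_iff)
  then have N0: "N \<theta> 0 = phase_matrix S M \<theta>" for \<theta> by (auto simp: N_def phase_matrix_def fun_eq_iff)
  have Nr: "phase_matrix R M (\<theta>(b := t)) x y = N \<theta> (cis (- t)) x y" if "x \<in> S" "y \<in> S" for \<theta> t x y
    using r that by (simp add: phase_matrix_def N_def)
  have G: "cofactor_on R a b (phase_matrix R M (\<theta>(b := t))) * exp (\<Sum>x\<in>S. of_real (l x) * rate R M (\<theta>(b := t)) x) =
      g \<theta> (cis (- t))" for \<theta> t
  proof -
    have e: "(\<Sum>x\<in>S. of_real (l x) * rate R M (\<theta>(b := t)) x) = (\<Sum>x\<in>S. of_real (l x) * r \<theta> (cis (- t)) x)"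
      by (intro sum.cong refl) (simp add: r)
    have "cofactor_on R a b (phase_matrix R M (\<theta>(b := t))) =
       (if a = b then det_on S (N \<theta> (cis (- t))) else \<Sum>c\<in>S. M c b * cofactor_on S a c (N \<theta> (cis (- t))))"
    proof (cases "a = b")
      case True
      have "det_on S (phase_matrix R M (\<theta>(b := t))) = det_on S (N \<theta> (cis (- t)))"
        by (rule det_on_cong) (rule Nr)
      with True show ?thesis
        using cofactor_on_same[OF assms(1,2), of "phase_matrix R M (\<theta>(b := t))"] by (simp add: S_def)
    next
      case False
      have "cofactor_on R a b (phase_matrix R M (\<theta>(b := t))) =
        - (\<Sum>c\<in>S. phase_matrix R M (\<theta>(b := t)) c b * cofactor_on S a c (phase_matrix R M (\<theta>(b := t))))"
        unfolding S_def by (rule cofactor_on_neq[OF assms(1-3) False])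
      also have "\<dots> = - (\<Sum>c\<in>S. (- M c b) * cofactor_on S a c (N \<theta> (cis (- t))))"
      proof (intro arg_cong[where f = uminus] sum.cong refl arg_cong2[where f = "(*)"])
        fix c assume "c \<in> S"
        then show "phase_matrix R M (\<theta>(b := t)) c b = - M c b" using S(2) by (auto simp: phase_matrix_def)
        show "cofactor_on S a c (phase_matrix R M (\<theta>(b := t))) = cofactor_on S a c (N \<theta> (cis (- t)))"
          by (rule cofactor_on_cong) (rule Nr)
      qed
      finally show ?thesis using False by (simp add: sum_negf)
    qed
    then show ?thesis by (simp add: g_def e)
  qed
  have hol_r: "(\<lambda>z. r \<theta> z x) holomorphic_on UNIV" for \<theta> x
    unfolding r_def by (cases "x \<in> S") (simp_all, intro holomorphic_intros)
  have hol_N: "(\<lambda>z. N \<theta> z x y) holomorphic_on UNIV" for \<theta> x y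
    unfolding N_def by (cases "x = y") (auto intro!: holomorphic_intros hol_r)
  have hol: "g \<theta> holomorphic_on UNIV" for \<theta>
    unfolding g_def cofactor_on_def det_on_def
    by (cases "a = b") (simp_all, (intro holomorphic_intros hol_r hol_N)+)
  obtain C where C: "0 \<le> C" "\<And>\<theta>. norm (cofactor_on R a b (phase_matrix R M \<theta>)) \<le> C"
    using cofactor_bounded[OF assms(1) subset_refl] by blast
  have int: "integrable (angles R) (\<lambda>\<theta>. cofactor_on R a b (phase_matrix R M \<theta>) *
      exp (\<Sum>x\<in>S. of_real (l x) * rate R M \<theta> x))"
  proof (rule integrable_const_bound)
    have "norm (exp (\<Sum>x\<in>S. of_real (l x) * rate R M \<theta> x)) \<le> exp (\<Sum>x\<in>S. \<bar>l x\<bar> * rate_bound R M)" for \<theta>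
      by (intro order_trans[OF norm_exp]) (simp, intro sum_norm_le, simp add: norm_mult mult_left_mono norm_rate_le assms(1))
    then show "AE \<theta> in angles R. norm (cofactor_on R a b (phase_matrix R M \<theta>) *
      exp (\<Sum>x\<in>S. of_real (l x) * rate R M \<theta> x)) \<le> C * exp (\<Sum>x\<in>S. \<bar>l x\<bar> * rate_bound R M)"
      using C by (intro AE_I2) (auto simp: norm_mult intro!: mult_mono)
  qed measurable
  have "(LINT \<theta>|angles R. cofactor_on R a b (phase_matrix R M \<theta>) *
      exp (\<Sum>x\<in>S. of_real (l x) * rate R M \<theta> x)) =
    (LINT \<theta>|angles S. LINT t|circ. cofactor_on R a b (phase_matrix R M (\<theta>(b := t))) *
      exp (\<Sum>x\<in>S. of_real (l x) * rate R M (\<theta>(b := t)) x))"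
    using product_integral_insert[OF S(1,2) int[unfolded S(3)]] unfolding S(3) .
  also have "\<dots> = (LINT \<theta>|angles S. g \<theta> 0)"
    unfolding G by (simp only: integral_circ_entire_mean_value[OF hol])
  also have "\<dots> = (if a = b then 0 else \<Sum>c\<in>S. phase_density S M a c l * M c b)"
  proof (cases "a = b")
    case True
    then show ?thesis by (simp add: g_def N0 det_phase_matrix[OF S(1,4)])
  next
    case False
    interpret S: prob_space "angles S" by (rule prob_space_angles)
    have int: "integrable (angles S) (\<lambda>\<theta>. cofactor_on S a c (phase_matrix S M \<theta>) * phase_exp S M l \<theta>)" for c
    proof -
      obtain C where C: "0 \<le> C" "\<And>\<theta>. norm (cofactor_on S a c (phase_matrix S M \<theta>)) \<le> C"
        using cofactor_bounded[OF S(1) subset_refl] by blast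
      then show ?thesis
        using norm_phase_exp_le[OF S(1), of M l]
        by (intro S.integrable_const_bound[where B = "C * exp (rate_bound S M * (\<Sum>x\<in>S. \<bar>l x\<bar>))"] AE_I2)
          (auto simp: norm_mult intro!: mult_mono)
    qed
    have "(LINT \<theta>|angles S. g \<theta> 0) =
      (LINT \<theta>|angles S. (\<Sum>c\<in>S. M c b * (cofactor_on S a c (phase_matrix S M \<theta>) * phase_exp S M l \<theta>)))"
      using False by (simp add: g_def N0 r0 phase_exp_def sum_distrib_right mult.assoc)
    also have "\<dots> = (\<Sum>c\<in>S. M c b * phase_density S M a c l)"
      using int by (simp add: Bochner_Integration.integral_sum phase_density_def)
    finally show ?thesis using False by (simp add: mult.commute)
  qed
  finally show ?thesis by (simp add: S_def)
qed

lemma simplex_exp_measurable: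
  assumes "finite S" "S \<noteq> {}"
  shows "(\<lambda>\<theta>. simplex_exp S T (rate R M \<theta>)) \<in> borel_measurable (angles R)"
proof (cases "T = 0")
  case False
  interpret finite_measure "simplex_measure S T" by (rule finite_measure_simplex_measure[OF assms])
  note [measurable] = measurable_simplex_measure_component
  have "(\<lambda>(\<theta>, l). exp (\<Sum>x\<in>S. of_real (l x) * rate R M \<theta> x)) \<in> borel_measurable (angles R \<Otimes>\<^sub>M simplex_measure S T)"
    by measurable
  from borel_measurable_lebesgue_integral[OF this] False show ?thesis
    by (simp add: simplex_exp_def)
qed (simp add: simplex_exp_def)

lemma integral_simplex_exp_swap:
  fixes S :: "'a set"
  assumes "finite R" "finite S" "S \<noteq> {}" "T \<noteq> 0"
    and H[measurable]: "H \<in> borel_measurable (angles R)" and C: "\<And>\<theta>. norm (H \<theta>) \<le> C"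
  shows "(LINT \<theta>|angles R. H \<theta> * simplex_exp S T (rate R M \<theta>)) =
    (LINT l|simplex_measure S T. LINT \<theta>|angles R. H \<theta> * exp (\<Sum>x\<in>S. of_real (l x) * rate R M \<theta> x))"
    and "integrable (simplex_measure S T) (\<lambda>l. LINT \<theta>|angles R. H \<theta> * exp (\<Sum>x\<in>S. of_real (l x) * rate R M \<theta> x))"
proof -
  note [measurable] = measurable_simplex_measure_component
  interpret A: prob_space "angles R" by (rule prob_space_angles)
  interpret S: finite_measure "simplex_measure S T" by (rule finite_measure_simplex_measure[OF assms(2,3)])
  interpret P: pair_sigma_finite "angles R" "simplex_measure S T" by standard
  interpret PF: finite_measure "angles R \<Otimes>\<^sub>M simplex_measure S T"
    by (rule finite_measure_pair_measure) (rule S.finite_measure_axioms A.finite_measure_axioms)+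
  have "0 \<le> C" using C norm_ge_zero order_trans by blast
  let ?f = "\<lambda>\<theta> l. H \<theta> * exp (\<Sum>x\<in>S. of_real (l x) * rate R M \<theta> x)"
  have int: "integrable (angles R \<Otimes>\<^sub>M simplex_measure S T) (\<lambda>(\<theta>, l). ?f \<theta> l)"
  proof (rule PF.integrable_const_bound[where B = "C * exp (rate_bound R M * T)"])
    show "AE z in angles R \<Otimes>\<^sub>M simplex_measure S T. norm (case z of (\<theta>, l) \<Rightarrow> ?f \<theta> l) \<le> C * exp (rate_bound R M * T)"
      by (intro AE_I2)
        (auto simp: space_pair_measure space_simplex_measure norm_mult
          intro!: mult_mono C norm_exp_simplex_le assms norm_rate_le \<open>0 \<le> C\<close> simp del: norm_exp_eq_Re)
  qed measurable
  have "(LINT \<theta>|angles R. H \<theta> * simplex_exp S T (rate R M \<theta>)) = (LINT \<theta>|angles R. LINT l|simplex_measure S T. ?f \<theta> l)"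
    using assms(4) by (simp add: simplex_exp_def)
  also have "\<dots> = (LINT l|simplex_measure S T. LINT \<theta>|angles R. ?f \<theta> l)"
    by (rule P.Fubini_integral[OF int, symmetric])
  finally show "(LINT \<theta>|angles R. H \<theta> * simplex_exp S T (rate R M \<theta>)) =
    (LINT l|simplex_measure S T. LINT \<theta>|angles R. ?f \<theta> l)" .
  show "integrable (simplex_measure S T) (\<lambda>l. LINT \<theta>|angles R. ?f \<theta> l)"
    by (rule P.integrable_snd[OF int])
qed

lemma simplex_mass_eq_integral_density:
  assumes "finite R" "a \<in> R" "b \<in> R" "T \<noteq> 0"
  shows "simplex_mass R M a b T = (LINT l|simplex_measure R T. phase_density R M a b l)"
    and "integrable (simplex_measure R T) (phase_density R M a b)"
proof -
  obtain C where "\<And>\<theta>. norm (cofactor_on R a b (phase_matrix R M \<theta>)) \<le> C"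
    using cofactor_bounded[OF assms(1) subset_refl] by blast
  from integral_simplex_exp_swap[OF assms(1,1) _ assms(4) cofactor_measurable this] assms(2,3)
  show "simplex_mass R M a b T = (LINT l|simplex_measure R T. phase_density R M a b l)"
    "integrable (simplex_measure R T) (phase_density R M a b)"
    unfolding simplex_mass_def phase_density_def phase_exp_def by auto
qed

lemma integral_boundary_simplex:
  fixes R :: "'a set"
  assumes "finite R" "a \<in> R" "b \<in> R"
  shows "(LINT \<theta>|angles R. cofactor_on R a b (phase_matrix R M \<theta>) * simplex_exp (R - {b}) T (rate R M \<theta>)) =
    (\<Sum>c\<in>R - {b}. simplex_mass (R - {b}) M a c T * M c b)"
proof (cases "R - {b} = {}")
  case True
  then show ?thesis by (simp only: simplex_exp_empty) simp
next
  case False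
  define S where "S = R - {b}"
  have S: "finite S" "S \<noteq> {}" "a \<in> S \<longleftrightarrow> a \<noteq> b" using assms False by (auto simp: S_def)
  note bd = integral_boundary_phase[OF assms False, folded S_def]
  obtain C where C: "\<And>\<theta>. norm (cofactor_on R a b (phase_matrix R M \<theta>)) \<le> C"
    using cofactor_bounded[OF assms(1) subset_refl] by blast
  show ?thesis
  proof (cases "T = 0")
    case True
    have "(LINT \<theta>|angles R. cofactor_on R a b (phase_matrix R M \<theta>) * simplex_exp S T (rate R M \<theta>)) =
       (LINT \<theta>|angles R. cofactor_on R a b (phase_matrix R M \<theta>)) * of_bool (card S = 1)"
      using True by (simp add: simplex_exp_def)
    also have "\<dots> = (if a = b then 0 else \<Sum>c\<in>S. phase_density S M a c (\<lambda>_. 0) * M c b) * of_bool (card S = 1)"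
      using bd[of M "\<lambda>_. 0"] by simp
    also have "\<dots> = (\<Sum>c\<in>S. simplex_mass S M a c T * M c b)"
      using True S by (auto simp: simplex_mass_def phase_density_def phase_exp_def simplex_exp_def)
    finally show ?thesis by (simp add: S_def)
  next
    case False
    have "(LINT \<theta>|angles R. cofactor_on R a b (phase_matrix R M \<theta>) * simplex_exp S T (rate R M \<theta>)) =
      (LINT l|simplex_measure S T. (if a = b then 0 else \<Sum>c\<in>S. phase_density S M a c l * M c b))"
      using integral_simplex_exp_swap(1)[OF assms(1) S(1,2) False cofactor_measurable C]
      by (simp only: bd)
    also have "\<dots> = (\<Sum>c\<in>S. simplex_mass S M a c T * M c b)"
    proof (cases "a = b")
      case True
      with S show ?thesis by (simp add: simplex_mass_def)
    next
      case ab: False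
      have "(LINT l|simplex_measure S T. (\<Sum>c\<in>S. phase_density S M a c l * M c b)) =
         (\<Sum>c\<in>S. (LINT l|simplex_measure S T. phase_density S M a c l * M c b))"
        using simplex_mass_eq_integral_density(2)[OF S(1) _ _ False] S ab
        by (intro Bochner_Integration.integral_sum integrable_mult_left) auto
      then show ?thesis
        using simplex_mass_eq_integral_density(1)[OF S(1) _ _ False] S ab by simp
    qed
    finally show ?thesis by (simp add: S_def)
  qed
qed

text \<open>
The first sum is the interior contribution, rewritten by the adjugate identity with
\<open>det_phase_matrix\<close>; the second is the flux through the face \<open>l b = 0\<close>.
\<close>

lemma simplex_mass_has_vector_derivative:
  fixes R :: "'a set"
  assumes "finite R" "a \<in> R" "b \<in> R" "0 \<le> T"
  shows "(simplex_mass R M a b has_vector_derivative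
    ((\<Sum>c\<in>R. simplex_mass R M a c T * M c b) + (\<Sum>c\<in>R - {b}. simplex_mass (R - {b}) M a c T * M c b)))
    (at T within {0..})"
proof -
  interpret prob_space "angles R" by (rule prob_space_angles)
  have R: "R \<noteq> {}" using assms by auto
  let ?cof = "\<lambda>c \<theta>. cofactor_on R a c (phase_matrix R M \<theta>)"
  let ?u = "\<lambda>\<theta>. rate R M \<theta>"
  let ?f' = "\<lambda>\<theta> t. ?cof b \<theta> * (?u \<theta> b * simplex_exp R t (?u \<theta>) + simplex_exp (R - {b}) t (?u \<theta>))"
  have [measurable]: "(\<lambda>\<theta>. simplex_exp R t (?u \<theta>)) \<in> borel_measurable (angles R)" for t
    by (rule simplex_exp_measurable[OF assms(1) R])
  have [measurable]: "(\<lambda>\<theta>. simplex_exp (R - {b}) t (?u \<theta>)) \<in> borel_measurable (angles R)" for t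
    using simplex_exp_measurable[of "R - {b}"] assms(1) by (cases "R - {b} = {}") (simp_all only: simplex_exp_empty, auto)
  obtain C where C: "\<And>c \<theta>. c \<in> R \<Longrightarrow> norm (?cof c \<theta>) \<le> C" "0 \<le> C"
  proof -
    have "\<forall>c. \<exists>C. 0 \<le> C \<and> (\<forall>\<theta>. norm (?cof c \<theta>) \<le> C)"
      using cofactor_bounded[OF assms(1) subset_refl] by metis
    then obtain D where D: "\<And>c. 0 \<le> D c" "\<And>c \<theta>. norm (?cof c \<theta>) \<le> D c" by metis
    have "norm (?cof c \<theta>) \<le> (\<Sum>c\<in>R. D c)" if "c \<in> R" for c \<theta>
      using D that assms(1) member_le_sum[of c R D] order_trans by blast
    then show thesis using that D(1) by (meson sum_nonneg)
  qed
  define U where "U = rate_bound R M"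
  have U: "0 \<le> U" "\<And>\<theta> x. norm (?u \<theta> x) \<le> U" by (simp_all add: U_def rate_bound_nonneg norm_rate_le assms(1))
  define B where "B = exp (U * (T + 1)) * (T + 1) ^ (card R - 1) + 1"
  define B' where "B' = exp (U * (T + 1)) * (T + 1) ^ (card (R - {b}) - 1) + 1"
  have B: "norm (simplex_exp R t (?u \<theta>)) \<le> B" if "t \<in> {0..T + 1}" for t \<theta>
    unfolding B_def using assms R U that by (intro norm_simplex_exp_le) auto
  have B': "norm (simplex_exp (R - {b}) t (?u \<theta>)) \<le> B'" if "t \<in> {0..T + 1}" for t \<theta>
  proof (cases "R - {b} = {}")
    case True
    show ?thesis unfolding True simplex_exp_empty using assms(4) by (simp add: B'_def)
  next
    case False
    then show ?thesis unfolding B'_def using assms U that by (intro norm_simplex_exp_le) auto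
  qed
  have pos: "0 \<le> B" "0 \<le> B'" using assms(4) by (simp_all add: B_def B'_def)
  have w: "at t within {0..} = at t within {0..T + 1}" if "t \<in> {0..<T + 1}" for t
    by (rule at_within_nhd[of _ "{..<T + 1}"]) (use that in auto)
  have T: "T \<in> {0..T + 1}" using assms(4) by simp
  have int: "integrable (angles R) (\<lambda>\<theta>. ?cof c \<theta> * simplex_exp R T (?u \<theta>))" if "c \<in> R" for c
    by (rule integrable_const_bound[where B = "C * B"])
      (use C that B T pos in \<open>auto simp: norm_mult intro!: mult_mono\<close>)
  have int': "integrable (angles R) (\<lambda>\<theta>. ?cof b \<theta> * simplex_exp (R - {b}) T (?u \<theta>))"
    by (rule integrable_const_bound[where B = "C * B'"])
      (use C assms B' T pos in \<open>auto simp: norm_mult intro!: mult_mono\<close>)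
  have "((\<lambda>t. LINT \<theta>|angles R. ?cof b \<theta> * simplex_exp R t (?u \<theta>)) has_vector_derivative
      (LINT \<theta>|angles R. ?f' \<theta> T)) (at T within {0..T + 1})"
  proof (rule has_vector_derivative_integral[where B = "C * B" and C = "C * (U * B + B')"])
    show "norm (?cof b \<theta> * simplex_exp R T (?u \<theta>)) \<le> C * B" for \<theta>
      unfolding norm_mult using C assms(3) B T pos by (intro mult_mono) auto
    show "norm (?f' \<theta> t) \<le> C * (U * B + B')" if "t \<in> {0..T + 1}" for \<theta> t
    proof -
      have "norm (?u \<theta> b * simplex_exp R t (?u \<theta>)) \<le> U * B"
        unfolding norm_mult using U B[OF that] by (intro mult_mono) auto
      then have "norm (?u \<theta> b * simplex_exp R t (?u \<theta>) + simplex_exp (R - {b}) t (?u \<theta>)) \<le> U * B + B'"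
        using B'[OF that] by (rule norm_triangle_mono)
      then show ?thesis unfolding norm_mult using C assms(3) by (intro mult_mono) auto
    qed
    show "((\<lambda>t. ?cof b \<theta> * simplex_exp R t (?u \<theta>)) has_vector_derivative ?f' \<theta> t) (at t within {0..T + 1})"
      if "t \<in> {0..T + 1}" for \<theta> t
      using that
      by (intro has_vector_derivative_mult_right has_vector_derivative_within_subset[OF simplex_exp_has_vector_derivative] assms) auto
  qed (use finite_measure_axioms T in auto)
  then have "((\<lambda>t. LINT \<theta>|angles R. ?cof b \<theta> * simplex_exp R t (?u \<theta>)) has_vector_derivative
      (LINT \<theta>|angles R. ?f' \<theta> T)) (at T within {0..})"
    using w[of T] assms(4) by simp
  moreover have "(LINT \<theta>|angles R. ?f' \<theta> T) =
    (\<Sum>c\<in>R. simplex_mass R M a c T * M c b) + (\<Sum>c\<in>R - {b}. simplex_mass (R - {b}) M a c T * M c b)"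
  proof -
    have adj: "?cof b \<theta> * ?u \<theta> b = (\<Sum>c\<in>R. ?cof c \<theta> * M c b)" for \<theta>
    proof -
      have "(\<Sum>c\<in>R. phase_matrix R M \<theta> c b * ?cof c \<theta>) = 0"
        using cofactor_on_adjugate[OF assms(1-3), of "phase_matrix R M \<theta>"] det_phase_matrix[OF assms(1) R] by simp
      also have "(\<Sum>c\<in>R. phase_matrix R M \<theta> c b * ?cof c \<theta>) =
          (\<Sum>c\<in>R. if c = b then ?cof c \<theta> * ?u \<theta> c else 0) - (\<Sum>c\<in>R. ?cof c \<theta> * M c b)"
        unfolding sum_subtractf[symmetric]
        by (intro sum.cong refl) (auto simp: phase_matrix_def algebra_simps)
      finally show ?thesis using assms(1,3) by simp
    qed
    have "(LINT \<theta>|angles R. ?f' \<theta> T) =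
      (LINT \<theta>|angles R. (\<Sum>c\<in>R. ?cof c \<theta> * simplex_exp R T (?u \<theta>) * M c b) + ?cof b \<theta> * simplex_exp (R - {b}) T (?u \<theta>))"
    proof (intro Bochner_Integration.integral_cong refl)
      fix \<theta>
      have "?f' \<theta> T = (?cof b \<theta> * ?u \<theta> b) * simplex_exp R T (?u \<theta>) + ?cof b \<theta> * simplex_exp (R - {b}) T (?u \<theta>)"
        by (simp add: algebra_simps)
      also have "(?cof b \<theta> * ?u \<theta> b) * simplex_exp R T (?u \<theta>) = (\<Sum>c\<in>R. ?cof c \<theta> * simplex_exp R T (?u \<theta>) * M c b)"
        unfolding adj by (simp add: sum_distrib_left sum_distrib_right mult_ac)
      finally show "?f' \<theta> T = (\<Sum>c\<in>R. ?cof c \<theta> * simplex_exp R T (?u \<theta>) * M c b) + ?cof b \<theta> * simplex_exp (R - {b}) T (?u \<theta>)" .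
    qed
    also have "\<dots> = (\<Sum>c\<in>R. LINT \<theta>|angles R. ?cof c \<theta> * simplex_exp R T (?u \<theta>) * M c b) +
        (LINT \<theta>|angles R. ?cof b \<theta> * simplex_exp (R - {b}) T (?u \<theta>))"
      using int int'
      by (subst Bochner_Integration.integral_add)
        (auto intro!: Bochner_Integration.integrable_sum integrable_mult_left Bochner_Integration.integral_sum)
    also have "(\<Sum>c\<in>R. LINT \<theta>|angles R. ?cof c \<theta> * simplex_exp R T (?u \<theta>) * M c b) = (\<Sum>c\<in>R. simplex_mass R M a c T * M c b)"
      using assms(2) by (simp add: simplex_mass_def)
    also have "(LINT \<theta>|angles R. ?cof b \<theta> * simplex_exp (R - {b}) T (?u \<theta>)) =
       (\<Sum>c\<in>R - {b}. simplex_mass (R - {b}) M a c T * M c b)"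
      by (rule integral_boundary_simplex[OF assms(1-3)])
    finally show ?thesis .
  qed
  moreover have "simplex_mass R M a b = (\<lambda>t. LINT \<theta>|angles R. ?cof b \<theta> * simplex_exp R t (?u \<theta>))"
    using assms by (simp add: simplex_mass_def fun_eq_iff)
  ultimately show ?thesis by simp
qed

definition total_mass :: "'a set \<Rightarrow> ('a \<Rightarrow> 'a \<Rightarrow> complex) \<Rightarrow> 'a \<Rightarrow> 'a \<Rightarrow> real \<Rightarrow> complex" where
  "total_mass R M a b T = (\<Sum>R'\<in>Pow R. simplex_mass R' M a b T)"

lemma sum_Pow_insert:
  assumes "finite S" "b \<notin> S"
  shows "(\<Sum>R\<in>Pow (insert b S). F R) = (\<Sum>R\<in>Pow S. F R + F (insert b R))"
proof -
  have "inj_on (insert b) (Pow S)" using assms(2) by (intro inj_onI) (metis PowD insert_ident subsetD)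
  moreover have "Pow S \<inter> insert b ` Pow S = {}" using assms(2) by auto
  ultimately show ?thesis
    using assms(1) by (simp add: Pow_insert sum.union_disjoint sum.reindex sum.distrib)
qed

text \<open>
Sets \<open>R'\<close> without \<open>b\<close> and their extensions \<open>insert b R'\<close> pair up: the boundary term of the
extension is exactly the forward term missing from the set \<open>R'\<close>, whose mass at \<open>b\<close> is zero.
\<close>

lemma total_mass_has_vector_derivative:
  fixes R :: "'a set"
  assumes "finite R" "b \<in> R" "0 \<le> T"
  shows "(total_mass R M a b has_vector_derivative (\<Sum>c\<in>R. total_mass R M a c T * M c b)) (at T within {0..})"
proof -
  define S where "S = R - {b}"
  have S: "finite S" "b \<notin> S" "R = insert b S" using assms by (auto simp: S_def)
  let ?g = "\<lambda>R'. \<Sum>c\<in>R. simplex_mass R' M a c T * M c b"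
  have restrict: "(\<Sum>c\<in>R'. simplex_mass R' M a c T * M c b) = ?g R'" if "R' \<subseteq> R" for R'
    using that assms(1) by (intro sum.mono_neutral_left) (auto simp: simplex_mass_def)
  have d: "((\<lambda>t. simplex_mass R' M a b t + simplex_mass (insert b R') M a b t) has_vector_derivative
      (?g R' + ?g (insert b R'))) (at T within {0..})" if "R' \<in> Pow S" for R'
  proof -
    have R': "R' \<subseteq> R" "insert b R' \<subseteq> R" "b \<notin> R'" "finite (insert b R')"
      using that S by (auto intro: finite_subset)
    have "(\<lambda>t. simplex_mass R' M a b t) = (\<lambda>_. 0)" using R'(3) by (simp add: simplex_mass_def)
    moreover have "(simplex_mass (insert b R') M a b has_vector_derivative (?g R' + ?g (insert b R'))) (at T within {0..})"
    proof (cases "a \<in> insert b R'")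
      case True
      have "insert b R' - {b} = R'" using R'(3) by auto
      with simplex_mass_has_vector_derivative[OF R'(4) True insertI1 assms(3), of M]
      show ?thesis by (simp only: restrict[OF R'(1)] restrict[OF R'(2)] add.commute)
    next
      case False
      then have "simplex_mass (insert b R') M a b = (\<lambda>_. 0)" "?g R' + ?g (insert b R') = 0"
        by (auto simp: simplex_mass_def fun_eq_iff)
      then show ?thesis by simp
    qed
    ultimately show ?thesis by simp
  qed
  have "total_mass R M a b = (\<lambda>t. \<Sum>R'\<in>Pow S. simplex_mass R' M a b t + simplex_mass (insert b R') M a b t)"
    unfolding total_mass_def S(3) by (rule ext) (rule sum_Pow_insert[OF S(1,2)])
  moreover have "(\<Sum>c\<in>R. total_mass R M a c T * M c b) = (\<Sum>R'\<in>Pow S. ?g R' + ?g (insert b R'))"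
  proof -
    have "(\<Sum>c\<in>R. total_mass R M a c T * M c b) = (\<Sum>R'\<in>Pow R. ?g R')"
      unfolding total_mass_def by (simp add: sum_distrib_right) (rule sum.swap)
    then show ?thesis using sum_Pow_insert[OF S(1,2), of ?g] by (simp only: S(3))
  qed
  ultimately show ?thesis by (simp only:) (rule has_vector_derivative_sum, rule d)
qed

lemma total_mass_0:
  assumes "finite R" "a \<in> R"
  shows "total_mass R M a b 0 = of_bool (a = b)"
proof -
  interpret prob_space "angles {a}" by (rule prob_space_angles)
  have 0: "simplex_mass R' M a b 0 = of_bool (R' = {a} \<and> a = b)" if "finite R'" for R'
  proof (cases "a \<in> R' \<and> b \<in> R' \<and> card R' = 1")
    case True
    then have R': "R' = {a}" "a = b" by (auto simp: card_Suc_eq)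
    have "cofactor_on {a} a a N = 1" for N :: "'a \<Rightarrow> 'a \<Rightarrow> complex"
      by (subst cofactor_on_same) (simp_all add: det_on_def)
    then show ?thesis using R' prob_space by (simp add: simplex_mass_def simplex_exp_def)
  next
    case False
    then show ?thesis by (auto simp: simplex_mass_def simplex_exp_def)
  qed
  have "total_mass R M a b 0 = (\<Sum>R'\<in>Pow R. if {a} = R' then of_bool (a = b) else 0)"
    unfolding total_mass_def using assms(1) by (intro sum.cong refl) (auto simp: 0 finite_subset)
  also have "\<dots> = of_bool (a = b)" using assms by simp
  finally show ?thesis .
qed

section \<open>Euler schemes and Riemann sums\<close>

text \<open>
The one-step error is \<open>o(1/n)\<close>, by a first-order Taylor expansion and the assumed limit of the
difference quotients of \<open>B\<close>. As \<open>B\<close> is substochastic, errors do not grow when they are propagated in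
the \<open>\<ell>\<^sup>1\<close> norm, so \<open>n\<close> steps give \<open>o(1)\<close>.
\<close>

lemma euler_scheme_tendsto:
  fixes Q :: "'a \<Rightarrow> real \<Rightarrow> complex" and B :: "nat \<Rightarrow> 'a \<Rightarrow> 'a \<Rightarrow> real" and W :: "nat \<Rightarrow> nat \<Rightarrow> 'a \<Rightarrow> real"
  assumes "finite R" "0 < T"
    and Q: "\<And>b t. b \<in> R \<Longrightarrow> 0 \<le> t \<Longrightarrow> (Q b has_vector_derivative (\<Sum>c\<in>R. Q c t * M c b)) (at t within {0..})"
    and W0: "\<And>n b. b \<in> R \<Longrightarrow> of_real (W n 0 b) = Q b 0"
    and WS: "\<And>n k b. b \<in> R \<Longrightarrow> 0 < n \<Longrightarrow> W n (Suc k) b = (\<Sum>c\<in>R. W n k c * B n c b)"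
    and B: "\<And>n c b. 0 < n \<Longrightarrow> 0 \<le> B n c b" "\<And>n c. 0 < n \<Longrightarrow> c \<in> R \<Longrightarrow> (\<Sum>b\<in>R. B n c b) \<le> 1"
    and lim: "\<And>c b. c \<in> R \<Longrightarrow> b \<in> R \<Longrightarrow>
      (\<lambda>n. of_real ((B n c b - of_bool (c = b)) / (T / real n))) \<longlonglongrightarrow> M c b"
    and "b \<in> R"
  shows "(\<lambda>n. complex_of_real (W n n b)) \<longlonglongrightarrow> Q b T"
proof -
  have R: "0 < card R" using assms(1) \<open>b \<in> R\<close> by (auto simp: card_gt_0_iff)
  have cont: "continuous_on {0..T} (Q b)" if "b \<in> R" for b
    by (rule continuous_on_subset[of "{0..}"])
      (use Q[OF that] in \<open>auto simp: continuous_on_eq_continuous_within intro!: has_vector_derivative_continuous\<close>)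
  obtain K where K: "\<And>c t. c \<in> R \<Longrightarrow> t \<in> {0..T} \<Longrightarrow> norm (Q c t) \<le> K" "0 \<le> K"
  proof -
    have "\<forall>c\<in>R. \<exists>k. \<forall>t\<in>{0..T}. norm (Q c t) \<le> k"
      using compact_imp_norm_bounded[OF compact_Icc cont] by metis
    then obtain k where k: "\<And>c t. c \<in> R \<Longrightarrow> t \<in> {0..T} \<Longrightarrow> norm (Q c t) \<le> k c" by metis
    have "norm (Q c t) \<le> (\<Sum>c\<in>R. \<bar>k c\<bar>)" if "c \<in> R" "t \<in> {0..T}" for c t
    proof -
      have "k c \<le> \<bar>k c\<bar>" by simp
      also have "\<bar>k c\<bar> \<le> (\<Sum>c\<in>R. \<bar>k c\<bar>)" using that assms(1) by (intro member_le_sum) auto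
      finally show ?thesis using k[OF that] by linarith
    qed
    then show thesis using that[of "\<Sum>c\<in>R. \<bar>k c\<bar>"] by (simp add: sum_nonneg)
  qed
  define m where "m = rate_bound R M"
  have m: "norm (M c b) \<le> m" "0 \<le> m" if "c \<in> R" "b \<in> R" for c b
    using that assms(1) by (simp_all add: m_def norm_le_rate_bound rate_bound_nonneg)
  have m0: "0 \<le> m" by (simp add: m_def rate_bound_nonneg)
  define Q' where "Q' b t = (\<Sum>c\<in>R. Q c t * M c b)" for b t
  have Q'_bound: "norm (Q' b t) \<le> card R * (K * m)" if "b \<in> R" "t \<in> {0..T}" for b t
    unfolding Q'_def using K m that by (intro sum_bounded_above[THEN order_trans[OF norm_sum]]) (auto simp: norm_mult intro!: mult_mono)
  have D: "(Q b has_vector_derivative Q' b t) (at t within {0..T})" if "b \<in> R" "t \<in> {0..T}" for b t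
    using Q[of b t] that by (auto simp: Q'_def intro: has_vector_derivative_within_subset)
  define L where "L = card R * (K * m)"
  have L0: "0 \<le> L" using K m0 by (simp add: L_def)
  have lip: "norm (Q b t - Q b s) \<le> L * norm (t - s)" if "b \<in> R" "t \<in> {0..T}" "s \<in> {0..T}" for b s t
  proof (rule differentiable_bound[of "{0..T}"])
    show "(Q b has_derivative (\<lambda>h. h *\<^sub>R Q' b r)) (at r within {0..T})" if "r \<in> {0..T}" for r
      using D[OF \<open>b \<in> R\<close> that] by (simp add: has_vector_derivative_def)
    show "onorm (\<lambda>h. h *\<^sub>R Q' b r) \<le> L" if "r \<in> {0..T}" for r
      using Q'_bound[OF \<open>b \<in> R\<close> that]
      by (intro onorm_le) (simp add: L_def mult.commute[of _ "\<bar>_\<bar>"] mult_left_mono)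
  qed (use that in auto)
  have taylor: "norm (Q b (t + h) - Q b t - of_real h * Q' b t) \<le> h * (card R * (L * h * m))"
    if "b \<in> R" "0 \<le> t" "0 \<le> h" "t + h \<le> T" for b t h
  proof -
    have "norm (Q b (t + h) - Q b t - (t + h - t) *\<^sub>R Q' b t) \<le> norm (t + h - t) * (card R * (L * h * m))"
    proof (rule vector_differentiable_bound_linearization[of "{t..t + h}"])
      show "(Q b has_vector_derivative Q' b x) (at x within {t..t + h})" if "x \<in> {t..t + h}" for x
        using that \<open>b \<in> R\<close> \<open>0 \<le> t\<close> \<open>t + h \<le> T\<close> by (intro has_vector_derivative_within_subset[OF D]) auto
      show "closed_segment t (t + h) \<subseteq> {t..t + h}" using that by (simp add: closed_segment_eq_real_ivl)
      show "t \<in> {t..t + h}" using that by simp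
      show "norm (Q' b x - Q' b t) \<le> card R * (L * h * m)" if x: "x \<in> {t..t + h}" for x
      proof -
        have "norm (Q c x * M c b - Q c t * M c b) \<le> L * h * m" if "c \<in> R" for c
        proof -
          have "norm (Q c x - Q c t) \<le> L * norm (x - t)"
            using x \<open>0 \<le> t\<close> \<open>t + h \<le> T\<close> that by (intro lip) auto
          also have "\<dots> \<le> L * h" using x L0 by (intro mult_left_mono) auto
          finally have "norm (Q c x - Q c t) \<le> L * h" .
          then show ?thesis
            using m[OF that \<open>b \<in> R\<close>] L0 \<open>0 \<le> h\<close>
            by (auto simp: norm_mult simp flip: left_diff_distrib intro!: mult_mono)
        qed
        then show ?thesis unfolding Q'_def sum_subtractf[symmetric]
          by (intro sum_bounded_above[THEN order_trans[OF norm_sum]])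
      qed
    qed
    then show ?thesis using that by (simp add: scaleR_conv_of_real)
  qed
  \<comment> \<open>\<open>\<delta>\<close> is the error of the difference quotient, and \<open>T / n * \<epsilon> n\<close> bounds the one-step error.\<close>
  define \<delta> where "\<delta> n c b = norm (of_real ((B n c b - of_bool (c = b)) / (T / real n)) - M c b)" for n c b
  define \<epsilon> where "\<epsilon> n = (\<Sum>b\<in>R. card R * (L * (T / real n) * m) + K * (\<Sum>c\<in>R. \<delta> n c b))" for n
  have \<delta>: "(\<lambda>n. \<delta> n c b) \<longlonglongrightarrow> 0" if "c \<in> R" "b \<in> R" for c b
    unfolding \<delta>_def using tendsto_diff[OF lim[OF that] tendsto_const[of "M c b"]] by (intro tendsto_norm_zero) simp
  have "(\<lambda>n. \<epsilon> n) \<longlonglongrightarrow> (\<Sum>b\<in>R. card R * (L * 0 * m) + K * (\<Sum>c\<in>R. 0))"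
  proof -
    have "(\<lambda>n. T / real n) \<longlonglongrightarrow> 0" by (rule lim_const_over_n)
    then show ?thesis unfolding \<epsilon>_def by (intro tendsto_intros \<delta>)
  qed
  then have \<epsilon>: "(\<lambda>n. T * \<epsilon> n) \<longlonglongrightarrow> 0" using tendsto_mult_right_zero by simp
  \<comment> \<open>The \<open>\<ell>\<^sup>1\<close> distance after \<open>k\<close> of \<open>n\<close> steps.\<close>
  define e where "e n k = (\<Sum>b\<in>R. norm (of_real (W n k b) - Q b (real k * (T / real n))))" for n k
  have e: "e n k \<le> real k * (T / real n) * \<epsilon> n" if "0 < n" "k \<le> n" for n k
    using that(2)
  proof (induction k)
    case 0
    then show ?case by (simp add: e_def W0)
  next
    case (Suc k)
    define h where "h = T / real n"
    define t where "t = real k * h"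
    have h: "0 < h" using assms(2) that by (simp add: h_def)
    have th: "0 \<le> t" "t + h \<le> T" "t \<in> {0..T}"
    proof -
      have "t + h = real (Suc k) * h" by (simp add: t_def algebra_simps)
      also have "\<dots> \<le> real n * h" using Suc.prems h by (intro mult_right_mono) auto
      also have "\<dots> = T" using that by (simp add: h_def)
      finally show "t + h \<le> T" .
      then show "0 \<le> t" "t \<in> {0..T}" using h by (simp_all add: t_def)
    qed
    have loc: "norm ((\<Sum>c\<in>R. Q c t * of_real (B n c b)) - Q b (t + h)) \<le>
        h * (card R * (L * h * m) + K * (\<Sum>c\<in>R. \<delta> n c b))" if b: "b \<in> R" for b
    proof -
      define D where "D c = of_real ((B n c b - of_bool (c = b)) / h) - M c b" for c
      have "(\<Sum>c\<in>R. Q c t * of_real (B n c b)) =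
          (\<Sum>c\<in>R. (if c = b then Q c t else 0) + of_real h * (Q c t * M c b) + of_real h * (Q c t * D c))"
      proof (intro sum.cong refl)
        fix c
        have "complex_of_real (B n c b) = of_bool (c = b) + of_real h * M c b + of_real h * D c"
          using h by (simp add: D_def field_simps)
        then show "Q c t * of_real (B n c b) =
            (if c = b then Q c t else 0) + of_real h * (Q c t * M c b) + of_real h * (Q c t * D c)"
          by (simp only:) (simp add: algebra_simps)
      qed
      also have "\<dots> = Q b t + of_real h * Q' b t + of_real h * (\<Sum>c\<in>R. Q c t * D c)"
        using assms(1) b by (simp add: sum.distrib Q'_def sum_distrib_left)
      finally have "(\<Sum>c\<in>R. Q c t * of_real (B n c b)) - Q b (t + h) =
          - (Q b (t + h) - Q b t - of_real h * Q' b t) + of_real h * (\<Sum>c\<in>R. Q c t * D c)"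
        by simp
      also have "norm \<dots> \<le> norm (Q b (t + h) - Q b t - of_real h * Q' b t) + norm (of_real h * (\<Sum>c\<in>R. Q c t * D c))"
        by (rule order_trans[OF norm_triangle_ineq]) (simp only: norm_minus_cancel order_refl)
      also have "\<dots> \<le> h * (card R * (L * h * m)) + h * (K * (\<Sum>c\<in>R. \<delta> n c b))"
      proof (rule add_mono)
        show "norm (Q b (t + h) - Q b t - of_real h * Q' b t) \<le> h * (card R * (L * h * m))"
          using taylor[OF b th(1) _ th(2)] h by simp
        have "norm (\<Sum>c\<in>R. Q c t * D c) \<le> (\<Sum>c\<in>R. K * \<delta> n c b)"
          using K th(3) by (intro sum_norm_le) (auto simp: norm_mult \<delta>_def h_def D_def intro!: mult_right_mono)
        then show "norm (of_real h * (\<Sum>c\<in>R. Q c t * D c)) \<le> h * (K * (\<Sum>c\<in>R. \<delta> n c b))"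
          using h by (simp add: norm_mult flip: sum_distrib_left)
      qed
      finally show ?thesis by (simp add: distrib_left)
    qed
    have "e n (Suc k) = (\<Sum>b\<in>R. norm ((\<Sum>c\<in>R. (of_real (W n k c) - Q c t) * of_real (B n c b)) +
        ((\<Sum>c\<in>R. Q c t * of_real (B n c b)) - Q b (t + h))))"
      unfolding e_def
    proof (intro sum.cong refl arg_cong[where f = norm])
      fix b assume "b \<in> R"
      have "real (Suc k) * (T / real n) = t + h"
        by (simp only: t_def h_def of_nat_Suc distrib_right mult_1_left add.commute)
      then show "of_real (W n (Suc k) b) - Q b (real (Suc k) * (T / real n)) =
        (\<Sum>c\<in>R. (of_real (W n k c) - Q c t) * of_real (B n c b)) + ((\<Sum>c\<in>R. Q c t * of_real (B n c b)) - Q b (t + h))"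
        using WS[OF \<open>b \<in> R\<close> \<open>0 < n\<close>, of k] by (simp add: left_diff_distrib sum_subtractf)
    qed
    also have "\<dots> \<le> (\<Sum>b\<in>R. (\<Sum>c\<in>R. norm (of_real (W n k c) - Q c t) * B n c b) +
        h * (card R * (L * h * m) + K * (\<Sum>c\<in>R. \<delta> n c b)))"
      using B(1)[OF \<open>0 < n\<close>]
      by (intro sum_mono norm_triangle_mono loc) (auto intro!: sum_norm_le simp: norm_mult)
    also have "\<dots> = (\<Sum>c\<in>R. norm (of_real (W n k c) - Q c t) * (\<Sum>b\<in>R. B n c b)) + h * \<epsilon> n"
    proof -
      have "(\<Sum>b\<in>R. \<Sum>c\<in>R. norm (of_real (W n k c) - Q c t) * B n c b) =
          (\<Sum>c\<in>R. norm (of_real (W n k c) - Q c t) * (\<Sum>b\<in>R. B n c b))"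
        by (subst sum.swap) (simp add: sum_distrib_left)
      moreover have "(\<Sum>b\<in>R. h * (card R * (L * h * m) + K * (\<Sum>c\<in>R. \<delta> n c b))) = h * \<epsilon> n"
        unfolding \<epsilon>_def h_def by (rule sum_distrib_left[symmetric])
      ultimately show ?thesis by (simp only: sum.distrib)
    qed
    also have "(\<Sum>c\<in>R. norm (of_real (W n k c) - Q c t) * (\<Sum>b\<in>R. B n c b)) \<le> (\<Sum>c\<in>R. norm (of_real (W n k c) - Q c t) * 1)"
      using B(2)[OF \<open>0 < n\<close>] by (intro sum_mono mult_left_mono) auto
    also have "\<dots> = e n k" by (simp add: e_def t_def h_def)
    also have "e n k \<le> real k * (T / real n) * \<epsilon> n" using Suc by simp
    finally show ?case by (simp add: h_def algebra_simps add_divide_distrib)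
  qed
  have "(\<lambda>n. complex_of_real (W n n b) - Q b T) \<longlonglongrightarrow> 0"
  proof (rule Lim_null_comparison[OF _ \<epsilon>])
    show "\<forall>\<^sub>F n in sequentially. norm (complex_of_real (W n n b) - Q b T) \<le> T * \<epsilon> n"
      using eventually_gt_at_top[of 0]
    proof eventually_elim
      case (elim n)
      have "norm (complex_of_real (W n n b) - Q b T) = norm (complex_of_real (W n n b) - Q b (real n * (T / real n)))"
        using elim by simp
      also have "\<dots> \<le> e n n"
        unfolding e_def using assms(1) \<open>b \<in> R\<close>
        by (intro member_le_sum[of b R "\<lambda>b. norm (complex_of_real (W n n b) - Q b (real n * (T / real n)))"]) auto
      also have "\<dots> \<le> T * \<epsilon> n" using e[OF elim order_refl] elim by simp
      finally show ?case .
    qed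
  qed
  then show ?thesis by (simp add: LIM_zero_iff)
qed

lemma emeasure_lborel_Ioc_finite: "emeasure lborel {u<..w :: real} < \<top>"
  using emeasure_bounded_finite[of "{u<..w}"] by (simp add: bounded_subset[OF bounded_closed_interval[of u w]])

lemma integral_step_function:
  fixes f :: "real \<Rightarrow> real"
  assumes "0 < h" and bound: "\<And>t. \<bar>f t\<bar> \<le> B"
  shows "set_integrable lborel {0<..real k * h} (\<lambda>s. f (h * of_int \<lceil>s / h\<rceil>))"
    and "(LINT s:{0<..real k * h}|lborel. f (h * of_int \<lceil>s / h\<rceil>)) = h * (\<Sum>i=1..k. f (real i * h))"
proof -
  have [measurable]: "(\<lambda>s. f (h * of_int \<lceil>s / h\<rceil>)) \<in> borel_measurable borel"
  proof -
    have "(\<lambda>k :: int. f (h * of_int k)) \<circ> (\<lambda>s. \<lceil>s / h\<rceil>) \<in> borel_measurable borel"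
      by (rule measurable_comp[of _ _ "count_space UNIV"]) measurable
    then show ?thesis by (simp add: o_def)
  qed
  have int: "set_integrable lborel {u<..w} (\<lambda>s. f (h * of_int \<lceil>s / h\<rceil>))" for u w
    unfolding set_integrable_def
    by (rule integrableI_bounded_set[where A = "{u<..w}" and B = B])
      (use bound in \<open>auto simp: indicator_def simp: emeasure_lborel_Ioc_finite split: if_splits\<close>)
  show "set_integrable lborel {0<..real k * h} (\<lambda>s. f (h * of_int \<lceil>s / h\<rceil>))" by (rule int)
  show "(LINT s:{0<..real k * h}|lborel. f (h * of_int \<lceil>s / h\<rceil>)) = h * (\<Sum>i=1..k. f (real i * h))"
  proof (induction k)
    case (Suc k)
    have "{0<..real (Suc k) * h} = {0<..real k * h} \<union> {real k * h<..real (Suc k) * h}"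
    proof -
      have "0 \<le> real k * h" "real k * h \<le> real (Suc k) * h"
        using assms(1) by (simp_all add: mult_right_mono)
      then show ?thesis by auto
    qed
    then have "(LINT s:{0<..real (Suc k) * h}|lborel. f (h * of_int \<lceil>s / h\<rceil>)) =
       (LINT s:{0<..real k * h}|lborel. f (h * of_int \<lceil>s / h\<rceil>)) +
       (LINT s:{real k * h<..real (Suc k) * h}|lborel. f (h * of_int \<lceil>s / h\<rceil>))"
      by (simp only:) (rule set_integral_Un, auto intro: int)
    also have "(LINT s:{real k * h<..real (Suc k) * h}|lborel. f (h * of_int \<lceil>s / h\<rceil>)) =
       (LINT s:{real k * h<..real (Suc k) * h}|lborel. f (real (Suc k) * h))"
    proof (rule set_lebesgue_integral_cong)
      show "\<forall>s. s \<in> {real k * h<..real (Suc k) * h} \<longrightarrow> f (h * of_int \<lceil>s / h\<rceil>) = f (real (Suc k) * h)"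
      proof (intro allI impI)
        fix s assume "s \<in> {real k * h<..real (Suc k) * h}"
        then have "\<lceil>s / h\<rceil> = int (Suc k)"
          using assms(1) by (intro ceiling_unique) (auto simp: field_simps)
        then show "f (h * of_int \<lceil>s / h\<rceil>) = f (real (Suc k) * h)" by (simp add: mult.commute)
      qed
    qed simp
    also have "\<dots> = h * f (real (Suc k) * h)"
    proof -
      have "real k * h \<le> real (Suc k) * h" using assms(1) by (intro mult_right_mono) auto
      then have "measure lborel {real k * h<..real (Suc k) * h} = h" by (simp add: algebra_simps)
      then show ?thesis by (simp add: set_lebesgue_integral_def)
    qed
    finally show ?case using Suc by (simp add: distrib_left)
  qed (simp add: set_lebesgue_integral_def)
qed

text \<open>
The sum is the integral of \<open>f\<close> evaluated at the next grid point. That point approaches \<open>s\<close> from the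
right, so right-continuity suffices.
\<close>

lemma riemann_sum_tendsto:
  fixes f :: "real \<Rightarrow> real"
  assumes "0 < T" and bound: "\<And>t. \<bar>f t\<bar> \<le> B"
    and rc: "\<And>t. 0 \<le> t \<Longrightarrow> (f \<longlongrightarrow> f t) (at_right t)"
  shows "(\<lambda>n. T / real n * (\<Sum>i=1..n. f (real i * (T / real n)))) \<longlonglongrightarrow> (LINT s:{0..T}|lborel. f s)"
proof -
  define g where "g n s = f (T / real n * of_int \<lceil>s / (T / real n)\<rceil>)" for n s
  have lim: "(\<lambda>n. g (Suc n) s) \<longlonglongrightarrow> f s" if "0 \<le> s" for s
  proof -
    define x where "x n = T / real (Suc n) * of_int \<lceil>s / (T / real (Suc n))\<rceil>" for n
    have x: "s \<le> x n" "x n \<le> s + T / real (Suc n)" for n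
    proof -
      define h where "h = T / real (Suc n)"
      have h: "0 < h" using assms(1) by (simp add: h_def)
      have "s / h \<le> of_int \<lceil>s / h\<rceil>" "of_int \<lceil>s / h\<rceil> \<le> s / h + 1" by linarith+
      then have "s \<le> h * of_int \<lceil>s / h\<rceil>" "h * of_int \<lceil>s / h\<rceil> \<le> s + h"
        using h mult_left_mono[of "s / h" "of_int \<lceil>s / h\<rceil>" h] mult_left_mono[of "of_int \<lceil>s / h\<rceil>" "s / h + 1" h]
        by (simp_all add: distrib_left)
      then show "s \<le> x n" "x n \<le> s + T / real (Suc n)" by (simp_all add: x_def h_def)
    qed
    have "x \<longlonglongrightarrow> s"
    proof (rule tendsto_sandwich[OF _ _ tendsto_const])
      show "(\<lambda>n. s + T / real (Suc n)) \<longlonglongrightarrow> s"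
        using tendsto_add[OF tendsto_const LIMSEQ_Suc[OF lim_const_over_n[of T]], of s] by simp
    qed (use x in auto)
    moreover have "continuous (at s within {s..}) f"
      using rc[OF that] by (simp add: continuous_within at_within_Ici_at_right)
    ultimately have "(f \<circ> x) \<longlonglongrightarrow> f s"
      using x(1) unfolding continuous_within_sequentially by auto
    then show ?thesis by (simp add: g_def x_def o_def)
  qed
  have gm: "(\<lambda>s. indicator {0<..T} s *\<^sub>R g (Suc n) s) \<in> borel_measurable lborel" for n
    using integral_step_function(1)[of "T / real (Suc n)" f B "Suc n"] assms(1) bound
    by (auto simp: g_def set_integrable_def dest: borel_measurable_integrable)
  have lim': "(\<lambda>n. indicator {0<..T} s *\<^sub>R g (Suc n) s) \<longlonglongrightarrow> indicator {0<..T} s *\<^sub>R f s" for s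
    using lim[of s] by (auto simp: indicator_def)
  have fm: "(\<lambda>s. indicator {0<..T} s *\<^sub>R f s) \<in> borel_measurable lborel"
    by (rule borel_measurable_LIMSEQ_real[OF lim' gm])
  have "(\<lambda>n. LINT s|lborel. indicator {0<..T} s *\<^sub>R g (Suc n) s) \<longlonglongrightarrow> (LINT s|lborel. indicator {0<..T} s *\<^sub>R f s)"
  proof (rule integral_dominated_convergence[where w = "\<lambda>s. indicator {0<..T} s *\<^sub>R B"])
    show "integrable lborel (\<lambda>s. indicator {0<..T} s *\<^sub>R B)"
      by (rule integrableI_bounded_set[where A = "{0<..T}" and B = B])
        (use order_trans[OF abs_ge_zero bound] in \<open>auto simp: indicator_def emeasure_lborel_Ioc_finite\<close>)
    show "AE s in lborel. norm (indicator {0<..T} s *\<^sub>R g (Suc n) s) \<le> indicator {0<..T} s *\<^sub>R B" for n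
      using bound by (intro AE_I2) (auto simp: g_def indicator_def)
  qed (use lim' fm gm in auto)
  moreover have "(LINT s|lborel. indicator {0<..T} s *\<^sub>R g (Suc n) s) =
      T / real (Suc n) * (\<Sum>i=1..Suc n. f (real i * (T / real (Suc n))))" for n
    using integral_step_function(2)[of "T / real (Suc n)" f B "Suc n"] assms(1) bound
    unfolding g_def set_lebesgue_integral_def by (simp del: of_nat_Suc sum.cl_ivl_Suc)
  moreover have "(LINT s|lborel. indicator {0<..T} s *\<^sub>R f s) = (LINT s:{0..T}|lborel. f s)"
    unfolding set_lebesgue_integral_def
  proof (rule integral_cong_AE[OF fm])
    have "(\<lambda>s. indicator {0<..T} s *\<^sub>R f s + indicator {0} s * f 0) \<in> borel_measurable lborel"
      using fm by (intro borel_measurable_add) auto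
    also have "(\<lambda>s. indicator {0<..T} s *\<^sub>R f s + indicator {0} s * f 0) = (\<lambda>s. indicator {0..T} s *\<^sub>R f s)"
      using assms(1) by (auto simp: fun_eq_iff indicator_def)
    finally show "(\<lambda>s. indicator {0..T} s *\<^sub>R f s) \<in> borel_measurable lborel" .
    show "AE s in lborel. indicator {0<..T} s *\<^sub>R f s = indicator {0..T} s *\<^sub>R f s"
      using AE_lborel_singleton[of 0] by eventually_elim (auto simp: indicator_def)
  qed
  ultimately have "(\<lambda>n. T / real (Suc n) * (\<Sum>i=1..Suc n. f (real i * (T / real (Suc n))))) \<longlonglongrightarrow> (LINT s:{0..T}|lborel. f s)"
    by (simp only:)
  then show ?thesis by (rule LIMSEQ_imp_Suc)
qed

section \<open>The chain killed outside a finite set\<close>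

context continuous_time_markov_chain
begin

abbreviation transition :: "real \<Rightarrow> 'a \<Rightarrow> 'a \<Rightarrow> real" where
  "transition t x y \<equiv> measure (P x) {\<omega> \<in> space (P x). X t \<omega> = y}"

declare measurable_X [measurable (raw)]

lemma sets_cylinder:
  assumes "\<And>i. i \<in> I \<Longrightarrow> 0 \<le> t i" "finite I"
  shows "{\<omega> \<in> space (P a). \<forall>i\<in>I. X (t i) \<omega> = x i} \<in> sets (P a)"
proof -
  have "{\<omega> \<in> space (P a). X (t i) \<omega> = x i} \<in> sets (P a)" if "i \<in> I" for i
    using measurable_sets[OF measurable_X[OF assms(1)[OF that]], of "{x i}" a]
    by (simp add: vimage_def Int_def conj_commute)
  then show ?thesis by (intro sets.sets_Collect_finite_All assms(2))
qed

lemma sets_X_eq: "0 \<le> t \<Longrightarrow> {\<omega> \<in> space (P a). X t \<omega> = y} \<in> sets (P a)"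
  using sets_cylinder[of "{0 :: nat}" "\<lambda>_. t" a "\<lambda>_. y"] by simp

lemma sets_X_in: "0 \<le> t \<Longrightarrow> {\<omega> \<in> space (P a). X t \<omega> \<in> R} \<in> sets (P a)"
  using measurable_sets[OF measurable_X, of t R a] by (simp add: vimage_def Int_def conj_commute)

lemma sum_trans_le_1:
  assumes "finite R" "0 \<le> t"
  shows "(\<Sum>y\<in>R. transition t x y) \<le> 1"
proof -
  interpret prob_space "P x" by (rule prob_space_P)
  have "(\<Sum>y\<in>R. transition t x y) = prob (\<Union>y\<in>R. {\<omega> \<in> space (P x). X t \<omega> = y})"
    using assms by (intro finite_measure_finite_Union[symmetric]) (auto simp: disjoint_family_on_def sets_X_eq)
  also have "\<dots> \<le> 1" by (rule prob_le_1)
  finally show ?thesis .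
qed

lemma trans_0: "transition 0 x y = of_bool (x = y)"
proof -
  interpret prob_space "P x" by (rule prob_space_P)
  have "prob {\<omega> \<in> space (P x). X 0 \<omega> = y} = prob {\<omega> \<in> space (P x). x = y}"
    by (rule finite_measure_eq_AE) (use start[of x] sets_X_eq[of 0 x y] in auto)
  then show ?thesis by (cases "x = y") (use prob_space in auto)
qed

definition grid_weight :: "'a set \<Rightarrow> ('a \<Rightarrow> real) \<Rightarrow> real \<Rightarrow> nat \<Rightarrow> 'w \<Rightarrow> real" where
  "grid_weight R v h k \<omega> =
     (\<Prod>i=1..k. exp (- h * v (X (real i * h) \<omega>))) * of_bool (\<forall>i\<le>k. X (real i * h) \<omega> \<in> R)"

lemma grid_weight_bounds:
  assumes "\<And>x. 0 \<le> v x" "0 < h"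
  shows "0 \<le> grid_weight R v h k \<omega>" "grid_weight R v h k \<omega> \<le> 1"
proof -
  have "(\<Prod>i=1..k. exp (- h * v (X (real i * h) \<omega>))) \<le> 1"
    using assms by (intro prod_le_1) (auto simp: mult_nonneg_nonneg)
  then show "0 \<le> grid_weight R v h k \<omega>" "grid_weight R v h k \<omega> \<le> 1"
    by (auto simp: grid_weight_def prod_nonneg)
qed

lemma grid_weight_eq_sum:
  assumes "finite R" "\<omega> \<in> space (P a)"
  shows "grid_weight R v h k \<omega> = (\<Sum>x\<in>{..k} \<rightarrow>\<^sub>E R. (\<Prod>i=1..k. exp (- h * v (x i))) *
     indicator {\<omega> \<in> space (P a). \<forall>i\<in>{..k}. X (real i * h) \<omega> = x i} \<omega>)"
proof -
  \<comment> \<open>Exactly one path through \<open>R\<close> can match, the observed one.\<close>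
  let ?p = "restrict (\<lambda>i. X (real i * h) \<omega>) {..k}"
  have "(\<Sum>x\<in>{..k} \<rightarrow>\<^sub>E R. (\<Prod>i=1..k. exp (- h * v (x i))) *
     indicator {\<omega> \<in> space (P a). \<forall>i\<in>{..k}. X (real i * h) \<omega> = x i} \<omega>) =
     (\<Sum>x\<in>{..k} \<rightarrow>\<^sub>E R. if ?p = x then (\<Prod>i=1..k. exp (- h * v (x i))) else 0)"
  proof (intro sum.cong refl)
    fix x assume x: "x \<in> {..k} \<rightarrow>\<^sub>E R"
    have "?p = x \<longleftrightarrow> (\<forall>i\<in>{..k}. X (real i * h) \<omega> = x i)"
      using x by (auto simp: fun_eq_iff restrict_def PiE_def extensional_def)
    then show "(\<Prod>i=1..k. exp (- h * v (x i))) *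
       indicator {\<omega> \<in> space (P a). \<forall>i\<in>{..k}. X (real i * h) \<omega> = x i} \<omega> =
       (if ?p = x then (\<Prod>i=1..k. exp (- h * v (x i))) else 0)"
      using assms(2) by (simp add: indicator_def)
  qed
  also have "\<dots> = (if ?p \<in> {..k} \<rightarrow>\<^sub>E R then \<Prod>i=1..k. exp (- h * v (?p i)) else 0)"
    using assms(1) by (simp add: finite_PiE)
  also have "\<dots> = grid_weight R v h k \<omega>"
    by (auto simp: grid_weight_def PiE_def Pi_def intro!: prod.cong)
  finally show ?thesis ..
qed

lemma grid_weight_measurable:
  assumes "finite R" "0 < h"
  shows "grid_weight R v h k \<in> borel_measurable (P a)"
proof -
  have "(\<lambda>\<omega>. \<Sum>x\<in>{..k} \<rightarrow>\<^sub>E R. (\<Prod>i=1..k. exp (- h * v (x i))) *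
     indicator {\<omega> \<in> space (P a). \<forall>i\<in>{..k}. X (real i * h) \<omega> = x i} \<omega>) \<in> borel_measurable (P a)"
    using assms(2) by (intro borel_measurable_sum borel_measurable_times borel_measurable_const
        borel_measurable_indicator sets_cylinder) auto
  then show ?thesis
    by (rule measurable_cong[THEN iffD2, rotated]) (rule grid_weight_eq_sum[OF assms(1)])
qed

lemma integral_grid_weight:
  assumes "finite R" "0 < h" and E: "E \<in> sets (P a)"
  shows "(LINT \<omega>|P a. grid_weight R v h k \<omega> * indicator E \<omega>) =
    (\<Sum>x\<in>{..k} \<rightarrow>\<^sub>E R. (\<Prod>i=1..k. exp (- h * v (x i))) *
      measure (P a) ({\<omega> \<in> space (P a). \<forall>i\<in>{..k}. X (real i * h) \<omega> = x i} \<inter> E))"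
proof -
  interpret prob_space "P a" by (rule prob_space_P)
  let ?c = "\<lambda>x. {\<omega> \<in> space (P a). \<forall>i\<in>{..k}. X (real i * h) \<omega> = x i}"
  have c: "?c x \<in> sets (P a)" for x using assms(2) by (intro sets_cylinder) auto
  have "(LINT \<omega>|P a. grid_weight R v h k \<omega> * indicator E \<omega>) =
    (LINT \<omega>|P a. (\<Sum>x\<in>{..k} \<rightarrow>\<^sub>E R. (\<Prod>i=1..k. exp (- h * v (x i))) * indicator (?c x \<inter> E) \<omega>))"
    by (intro Bochner_Integration.integral_cong refl)
      (simp add: grid_weight_eq_sum[OF assms(1)] sum_distrib_right indicator_inter_arith mult.assoc)
  also have "\<dots> = (\<Sum>x\<in>{..k} \<rightarrow>\<^sub>E R. LINT \<omega>|P a. (\<Prod>i=1..k. exp (- h * v (x i))) * indicator (?c x \<inter> E) \<omega>)"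
    using c E by (intro Bochner_Integration.integral_sum integrable_mult_right integrable_real_indicator)
      (auto simp: emeasure_eq_measure)
  also have "\<dots> = (\<Sum>x\<in>{..k} \<rightarrow>\<^sub>E R. (\<Prod>i=1..k. exp (- h * v (x i))) * measure (P a) (?c x \<inter> E))"
    using c E by (intro sum.cong refl) simp
  finally show ?thesis .
qed

lemma integral_grid_weight_markov:
  assumes "finite R" "0 < h"
  shows "(LINT \<omega>|P a. grid_weight R v h k \<omega> *
      indicator {\<omega> \<in> space (P a). X (real k * h) \<omega> = c \<and> X (real (Suc k) * h) \<omega> = b} \<omega>) =
    (LINT \<omega>|P a. grid_weight R v h k \<omega> * indicator {\<omega> \<in> space (P a). X (real k * h) \<omega> = c} \<omega>) * transition h c b"
proof -
  let ?C = "\<lambda>x. {\<omega> \<in> space (P a). \<forall>i\<in>{..k}. X (real i * h) \<omega> = x i}"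
  let ?A = "{\<omega> \<in> space (P a). X (real k * h) \<omega> = c}"
  let ?E = "{\<omega> \<in> space (P a). X (real k * h) \<omega> = c \<and> X (real (Suc k) * h) \<omega> = b}"
  have A: "?A \<in> sets (P a)" using assms(2) by (intro sets_X_eq) simp
  have "?E = ?A \<inter> {\<omega> \<in> space (P a). X (real (Suc k) * h) \<omega> = b}" by auto
  then have E: "?E \<in> sets (P a)" using A sets_X_eq[of "real (Suc k) * h" a b] assms(2) by (simp add: sets.Int)
  have "measure (P a) (?C x \<inter> ?E) = measure (P a) (?C x \<inter> ?A) * transition h c b" for x
  proof (cases "x k = c")
    case True
    have "strict_mono_on {..k} (\<lambda>i. real i * h)"
      using assms(2) by (intro strict_mono_onI) simp
    from markov[OF this, of h a x b] assms(2)
    have "measure (P a) {\<omega> \<in> space (P a). (\<forall>i\<le>k. X (real i * h) \<omega> = x i) \<and> X (real k * h + h) \<omega> = b} =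
       measure (P a) {\<omega> \<in> space (P a). \<forall>i\<le>k. X (real i * h) \<omega> = x i} * transition h (x k) b" by simp
    moreover have "?C x \<inter> ?E = {\<omega> \<in> space (P a). (\<forall>i\<le>k. X (real i * h) \<omega> = x i) \<and> X (real k * h + h) \<omega> = b}"
      using True by (auto simp: algebra_simps)
    moreover have "?C x \<inter> ?A = {\<omega> \<in> space (P a). \<forall>i\<le>k. X (real i * h) \<omega> = x i}"
      using True by auto
    ultimately show ?thesis using True by simp
  next
    case False
    then have "?C x \<inter> ?E = {}" "?C x \<inter> ?A = {}" by auto
    then show ?thesis by simp
  qed
  then show ?thesis
    unfolding integral_grid_weight[OF assms E] integral_grid_weight[OF assms A]
    by (simp add: sum_distrib_right mult.assoc)
qed

definition grid_mean :: "'a set \<Rightarrow> ('a \<Rightarrow> real) \<Rightarrow> 'a \<Rightarrow> real \<Rightarrow> nat \<Rightarrow> 'a \<Rightarrow> real" where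
  "grid_mean R v a h k b = (LINT \<omega>|P a. grid_weight R v h k \<omega> * indicator {\<omega> \<in> space (P a). X (real k * h) \<omega> = b} \<omega>)"

lemma grid_mean_0:
  assumes "finite R" "b \<in> R"
  shows "grid_mean R v a h 0 b = of_bool (a = b)"
proof -
  have "grid_mean R v a h 0 b = (LINT \<omega>|P a. indicator {\<omega> \<in> space (P a). X 0 \<omega> = b} \<omega>)"
    unfolding grid_mean_def using assms
    by (intro Bochner_Integration.integral_cong) (auto simp: grid_weight_def indicator_def)
  then show ?thesis by (simp add: trans_0)
qed

lemma grid_mean_Suc:
  assumes "finite R" "b \<in> R" "0 < h" "\<And>x. 0 \<le> v x"
  shows "grid_mean R v a h (Suc k) b = (\<Sum>c\<in>R. grid_mean R v a h k c * (transition h c b * exp (- h * v b)))"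
proof -
  interpret prob_space "P a" by (rule prob_space_P)
  let ?E = "\<lambda>c. {\<omega> \<in> space (P a). X (real k * h) \<omega> = c \<and> X (real (Suc k) * h) \<omega> = b}"
  have E: "?E c \<in> sets (P a)" for c
  proof -
    have "?E c = {\<omega> \<in> space (P a). X (real k * h) \<omega> = c} \<inter> {\<omega> \<in> space (P a). X (real (Suc k) * h) \<omega> = b}" by auto
    then show ?thesis using sets_X_eq[of "real (Suc k) * h" a b] sets_X_eq[of "real k * h" a c] assms(3)
      by (simp add: sets.Int)
  qed
  have gm[measurable]: "grid_weight R v h k \<in> borel_measurable (P a)" by (rule grid_weight_measurable) (rule assms)+
  have split: "grid_weight R v h (Suc k) \<omega> * indicator {\<omega> \<in> space (P a). X (real (Suc k) * h) \<omega> = b} \<omega> =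
     (\<Sum>c\<in>R. grid_weight R v h k \<omega> * indicator (?E c) \<omega> * exp (- h * v b))" for \<omega>
  proof (cases "\<omega> \<in> space (P a) \<and> X (real (Suc k) * h) \<omega> = b")
    case True
    have "(\<Sum>c\<in>R. grid_weight R v h k \<omega> * indicator (?E c) \<omega> * exp (- h * v b)) =
      (\<Sum>c\<in>R. if X (real k * h) \<omega> = c then grid_weight R v h k \<omega> * exp (- h * v b) else 0)"
      using True by (intro sum.cong refl) (auto simp: indicator_def)
    also have "\<dots> = (if X (real k * h) \<omega> \<in> R then grid_weight R v h k \<omega> * exp (- h * v b) else 0)"
      using assms(1) by simp
    also have "\<dots> = grid_weight R v h (Suc k) \<omega>"
      using True assms(2) by (auto simp: grid_weight_def le_Suc_eq)
    finally show ?thesis using True by simp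
  qed (auto simp: indicator_def)
  have "grid_mean R v a h (Suc k) b = (\<Sum>c\<in>R. LINT \<omega>|P a. grid_weight R v h k \<omega> * indicator (?E c) \<omega> * exp (- h * v b))"
    unfolding grid_mean_def split
  proof (rule Bochner_Integration.integral_sum)
    fix c
    show "integrable (P a) (\<lambda>\<omega>. grid_weight R v h k \<omega> * indicator (?E c) \<omega> * exp (- h * v b))"
      using grid_weight_bounds[of v h R k] assms(3,4) E[of c]
      by (intro integrable_mult_left integrable_const_bound[where B = 1] AE_I2 borel_measurable_times gm
          borel_measurable_indicator) (auto simp: indicator_def)
  qed
  also have "\<dots> = (\<Sum>c\<in>R. grid_mean R v a h k c * (transition h c b * exp (- h * v b)))"
    unfolding grid_mean_def
  proof (intro sum.cong refl)
    fix c
    have "(LINT \<omega>|P a. grid_weight R v h k \<omega> * indicator (?E c) \<omega> * exp (- h * v b)) =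
        (LINT \<omega>|P a. grid_weight R v h k \<omega> * indicator (?E c) \<omega>) * exp (- h * v b)"
      by (rule integral_mult_left_zero)
    also have "(LINT \<omega>|P a. grid_weight R v h k \<omega> * indicator (?E c) \<omega>) =
        (LINT \<omega>|P a. grid_weight R v h k \<omega> * indicator {\<omega> \<in> space (P a). X (real k * h) \<omega> = c} \<omega>) * transition h c b"
      by (rule integral_grid_weight_markov[OF assms(1,3)])
    finally show "(LINT \<omega>|P a. grid_weight R v h k \<omega> * indicator (?E c) \<omega> * exp (- h * v b)) =
        (LINT \<omega>|P a. grid_weight R v h k \<omega> * indicator {\<omega> \<in> space (P a). X (real k * h) \<omega> = c} \<omega>) *
        (transition h c b * exp (- h * v b))"
      by (simp only: mult.assoc)
  qed
  finally show ?thesis .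
qed

text \<open>
The killed one-step matrix \<open>P\<^sub>h(c,b) exp (- h v\<^sub>b)\<close> is the identity plus
\<open>h (A - diag v) + o(h)\<close>.
\<close>

lemma grid_mean_tendsto:
  assumes "finite R" "a \<in> R" "b \<in> R" "0 < T" "\<And>x. 0 \<le> v x"
  shows "(\<lambda>n. complex_of_real (grid_mean R v a (T / real n) n b)) \<longlonglongrightarrow>
    total_mass R (\<lambda>x y. of_real (A x y - of_bool (x = y) * v x)) a b T"
proof -
  let ?M = "\<lambda>x y. complex_of_real (A x y - of_bool (x = y) * v x)"
  let ?B = "\<lambda>n c b. transition (T / real n) c b * exp (- (T / real n) * v b)"
  show ?thesis
  proof (rule euler_scheme_tendsto[where R = R and M = ?M and B = ?B and W = "\<lambda>n. grid_mean R v a (T / real n)"])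
    show "(total_mass R ?M a b has_vector_derivative (\<Sum>c\<in>R. total_mass R ?M a c t * ?M c b)) (at t within {0..})"
      if "b \<in> R" "0 \<le> t" for b t
      by (rule total_mass_has_vector_derivative) (use assms that in auto)
    show "complex_of_real (grid_mean R v a (T / real n) 0 b) = total_mass R ?M a b 0" if "b \<in> R" for n b
      using assms that by (simp add: grid_mean_0 total_mass_0)
    show "grid_mean R v a (T / real n) (Suc k) b = (\<Sum>c\<in>R. grid_mean R v a (T / real n) k c * ?B n c b)"
      if "b \<in> R" "0 < n" for n k b
      using assms that by (intro grid_mean_Suc) auto
    show "(\<Sum>b\<in>R. ?B n c b) \<le> 1" if "0 < n" "c \<in> R" for n c
    proof -
      have "(\<Sum>b\<in>R. ?B n c b) \<le> (\<Sum>b\<in>R. transition (T / real n) c b)"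
        using assms that by (intro sum_mono mult_left_le) (auto simp: mult_nonneg_nonneg)
      also have "\<dots> \<le> 1" using assms by (intro sum_trans_le_1) auto
      finally show ?thesis .
    qed
    show "(\<lambda>n. complex_of_real ((?B n c b - of_bool (c = b)) / (T / real n))) \<longlonglongrightarrow> ?M c b"
      if "c \<in> R" "b \<in> R" for c b
    proof -
      let ?f = "\<lambda>t. transition t c b * exp (- t * v b)"
      have "(?f has_real_derivative (A c b * exp (- 0 * v b) + (- v b * exp (- 0 * v b)) * transition 0 c b)) (at 0 within {0..})"
        by (rule DERIV_mult[OF generator]) (auto intro!: derivative_eq_intros)
      then have "(?f has_real_derivative (A c b - of_bool (c = b) * v c)) (at 0 within {0..})"
        by (rule back_subst[where P = "\<lambda>d. (?f has_real_derivative d) (at 0 within {0..})"]) (simp add: trans_0)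
      then have "((\<lambda>t. (?f t - ?f 0) / (t - 0)) \<longlongrightarrow> (A c b - of_bool (c = b) * v c)) (at 0 within {0..})"
        by (simp only: has_field_derivative_iff)
      moreover have "filterlim (\<lambda>n. T / real (Suc n)) (at 0 within {0..}) sequentially"
        using LIMSEQ_Suc[OF lim_const_over_n[of T]] assms(4) by (auto simp: filterlim_at)
      ultimately have "((\<lambda>n. (?f (T / real (Suc n)) - ?f 0) / (T / real (Suc n) - 0)) \<longlonglongrightarrow> (A c b - of_bool (c = b) * v c))"
        by (rule filterlim_compose)
      then have "(\<lambda>n. (?B (Suc n) c b - of_bool (c = b)) / (T / real (Suc n))) \<longlonglongrightarrow> A c b - of_bool (c = b) * v c"
        by (simp add: trans_0 del: of_nat_Suc)
      then have "(\<lambda>n. (?B n c b - of_bool (c = b)) / (T / real n)) \<longlonglongrightarrow> A c b - of_bool (c = b) * v c"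
        by (rule LIMSEQ_imp_Suc)
      then show ?thesis by (rule tendsto_of_real)
    qed
  qed (use assms in auto)
qed

lemma local_time_limit:
  assumes "\<omega> \<in> space (P a)" "0 < T"
  shows "(\<lambda>n. T / real n * (\<Sum>i=1..n. indicator {x} (X (real i * (T / real n)) \<omega>))) \<longlonglongrightarrow> local_time X T \<omega> x"
  unfolding local_time_def
proof (rule riemann_sum_tendsto[OF assms(2), where B = 1])
  fix t :: real assume "0 \<le> t"
  then have "eventually (\<lambda>s. X s \<omega> = X t \<omega>) (at_right t)" by (rule right_continuous[OF assms(1)])
  then show "((\<lambda>s. indicator {x} (X s \<omega>) :: real) \<longlongrightarrow> indicator {x} (X t \<omega>)) (at_right t)"
    by (intro tendsto_eventually) (auto elim: eventually_mono)
qed (simp add: indicator_def)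

lemma local_time_measurable [measurable]:
  assumes "0 < T"
  shows "(\<lambda>\<omega>. local_time X T \<omega> x) \<in> borel_measurable (P a)"
proof (rule borel_measurable_LIMSEQ_real)
  show "(\<lambda>n. T / real n * (\<Sum>i=1..n. indicator {x} (X (real i * (T / real n)) \<omega>))) \<longlonglongrightarrow> local_time X T \<omega> x"
    if "\<omega> \<in> space (P a)" for \<omega>
    by (rule local_time_limit[OF that assms])
  show "(\<lambda>\<omega>. T / real n * (\<Sum>i=1..n. indicator {x} (X (real i * (T / real n)) \<omega>))) \<in> borel_measurable (P a)" for n
  proof (intro borel_measurable_times borel_measurable_const borel_measurable_sum)
    fix i
    show "(\<lambda>\<omega>. indicator {x} (X (real i * (T / real n)) \<omega>) :: real) \<in> borel_measurable (P a)"
      by (rule measurable_compose[OF measurable_X]) (use assms in auto)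
  qed
qed

text \<open>
If the path leaves \<open>R\<close>, right-continuity keeps it outside for a positive time, which every sufficiently
fine grid detects.
\<close>

lemma grid_stays_tendsto:
  assumes "\<omega> \<in> space (P a)" "0 < T"
  shows "\<forall>\<^sub>F n in sequentially. (\<forall>i\<le>n. X (real i * (T / real n)) \<omega> \<in> R) \<longleftrightarrow> (\<forall>s\<in>{0..T}. X s \<omega> \<in> R)"
proof (cases "\<forall>s\<in>{0..T}. X s \<omega> \<in> R")
  case True
  have "\<forall>\<^sub>F n :: nat in sequentially. 0 < n" by (rule eventually_gt_at_top)
  then show ?thesis
  proof eventually_elim
    case (elim n)
    have "real i * (T / real n) \<in> {0..T}" if "i \<le> n" for i
      using that assms(2) elim by (auto simp: field_simps)
    with True show ?case by blast
  qed
next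
  case False
  then obtain s where s: "0 \<le> s" "s \<le> T" "X s \<omega> \<notin> R" by auto
  obtain u where u: "s < u" "\<And>r. s < r \<Longrightarrow> r < u \<Longrightarrow> X r \<omega> = X s \<omega>"
    using right_continuous[OF assms(1) s(1)] unfolding eventually_at_right_field by blast
  have "(\<lambda>n. T / real n) \<longlonglongrightarrow> 0" by (rule lim_const_over_n)
  then have "\<forall>\<^sub>F n in sequentially. T / real n < u - s" using u(1) by (intro order_tendstoD) auto
  with eventually_gt_at_top[of 0] show ?thesis
  proof eventually_elim
    case (elim n)
    define h where "h = T / real n"
    have h: "0 < h" "h < u - s" "real n * h = T" using elim assms(2) by (simp_all add: h_def)
    define i where "i = nat \<lceil>s / h\<rceil>"
    have ri: "real i = of_int \<lceil>s / h\<rceil>" using s(1) h(1) by (simp add: i_def)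
    have "s / h \<le> real i" "real i < s / h + 1" unfolding ri by linarith+
    then have r: "s \<le> real i * h" "real i * h < s + h" using h(1) by (simp_all add: field_simps)
    have "s / h \<le> real n" using s(2) h by (simp add: field_simps)
    then have "s / h \<le> of_int (int n)" by (simp only: of_int_of_nat_eq)
    then have "\<lceil>s / h\<rceil> \<le> int n" by (rule ceiling_le)
    then have "i \<le> n" unfolding i_def by (simp only: nat_le_iff)
    moreover have "X (real i * h) \<omega> = X s \<omega>"
      using r h(2) u(2)[of "real i * h"] by (cases "real i * h = s") auto
    ultimately show ?case using s False unfolding h_def by metis
  qed
qed

lemma sets_stays [measurable]:
  assumes "0 < T"
  shows "{\<omega> \<in> space (P a). \<forall>s\<in>{0..T}. X s \<omega> \<in> R} \<in> sets (P a)"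
proof -
  have "(\<lambda>\<omega>. of_bool (\<forall>s\<in>{0..T}. X s \<omega> \<in> R) :: real) \<in> borel_measurable (P a)"
  proof (rule borel_measurable_LIMSEQ_real)
    show "(\<lambda>n. of_bool (\<forall>i\<le>n. X (real i * (T / real n)) \<omega> \<in> R) :: real) \<longlonglongrightarrow> of_bool (\<forall>s\<in>{0..T}. X s \<omega> \<in> R)"
      if "\<omega> \<in> space (P a)" for \<omega>
      using grid_stays_tendsto[OF that assms, of R] by (intro tendsto_eventually) (auto elim: eventually_mono)
    show "(\<lambda>\<omega>. of_bool (\<forall>i\<le>n. X (real i * (T / real n)) \<omega> \<in> R) :: real) \<in> borel_measurable (P a)" for n
    proof -
      have "{\<omega> \<in> space (P a). \<forall>i\<in>{..n}. X (real i * (T / real n)) \<omega> \<in> R} \<in> sets (P a)"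
        using assms by (intro sets.sets_Collect_finite_All sets_X_in) auto
      then have "(indicator {\<omega> \<in> space (P a). \<forall>i\<in>{..n}. X (real i * (T / real n)) \<omega> \<in> R} :: _ \<Rightarrow> real) \<in> borel_measurable (P a)"
        by simp
      then show ?thesis by (rule measurable_cong[THEN iffD1, rotated]) (auto simp: indicator_def)
    qed
  qed
  from measurable_sets[OF this, of "{1}"] show ?thesis
    by (simp add: vimage_def Int_def conj_commute)
qed

text \<open>
On the grid the weight is \<open>exp (- \<Sum>\<^sub>i h v(X\<^sub>i\<^sub>h))\<close>, whose exponent is a Riemann sum for
\<open>\<Sum>\<^sub>x v x \<ell>\<^sub>T(x)\<close>.
\<close>

lemma laplace_transform_stays:
  assumes "finite R" "a \<in> R" "b \<in> R" "0 < T" "\<And>x. 0 \<le> v x"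
  shows "complex_of_real (LINT \<omega>|P a. exp (- (\<Sum>x\<in>R. v x * local_time X T \<omega> x)) *
      of_bool (X T \<omega> = b \<and> (\<forall>s\<in>{0..T}. X s \<omega> \<in> R))) =
    total_mass R (\<lambda>x y. of_real (A x y - of_bool (x = y) * v x)) a b T"
proof -
  interpret prob_space "P a" by (rule prob_space_P)
  let ?E = "{\<omega> \<in> space (P a). X T \<omega> = b}"
  let ?L = "\<lambda>\<omega>. exp (- (\<Sum>x\<in>R. v x * local_time X T \<omega> x)) * of_bool (X T \<omega> = b \<and> (\<forall>s\<in>{0..T}. X s \<omega> \<in> R))"
  let ?w = "\<lambda>n \<omega>. grid_weight R v (T / real (Suc n)) (Suc n) \<omega> * indicator ?E \<omega>"
  have [measurable]: "?E \<in> sets (P a)" using assms(4) by (intro sets_X_eq) simp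
  have wm: "?w n \<in> borel_measurable (P a)" for n
    using assms by (intro borel_measurable_times grid_weight_measurable borel_measurable_indicator) auto
  have lim: "(\<lambda>n. ?w n \<omega>) \<longlonglongrightarrow> ?L \<omega>" if \<omega>: "\<omega> \<in> space (P a)" for \<omega>
  proof -
    let ?h = "\<lambda>n. T / real n"
    let ?N = "\<lambda>n x. ?h n * (\<Sum>i=1..n. indicator {x} (X (real i * ?h n) \<omega>))"
    have "(\<lambda>n. exp (- (\<Sum>x\<in>R. v x * ?N n x)) * of_bool (X T \<omega> = b \<and> (\<forall>s\<in>{0..T}. X s \<omega> \<in> R))) \<longlonglongrightarrow> ?L \<omega>"
      by (intro tendsto_intros local_time_limit[OF \<omega> assms(4)])
    moreover have "\<forall>\<^sub>F n in sequentially. exp (- (\<Sum>x\<in>R. v x * ?N n x)) * of_bool (X T \<omega> = b \<and> (\<forall>s\<in>{0..T}. X s \<omega> \<in> R)) =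
        grid_weight R v (?h n) n \<omega> * indicator ?E \<omega>"
      using grid_stays_tendsto[OF \<omega> assms(4), of R]
    proof eventually_elim
      case (elim n)
      show ?case
      proof (cases "\<forall>i\<le>n. X (real i * ?h n) \<omega> \<in> R")
        case True
        have swap: "(\<Sum>x\<in>R. v x * (r * (\<Sum>i\<in>I. f i x))) = r * (\<Sum>i\<in>I. \<Sum>x\<in>R. v x * f i x)"
          for r :: real and I :: "nat set" and f
          by (subst sum.swap) (simp add: sum_distrib_left mult_ac)
        have "(\<Sum>x\<in>R. v x * ?N n x) = ?h n * (\<Sum>i=1..n. \<Sum>x\<in>R. v x * indicator {x} (X (real i * ?h n) \<omega>))"
          by (rule swap)
        also have "(\<Sum>i=1..n. \<Sum>x\<in>R. v x * indicator {x} (X (real i * ?h n) \<omega>)) = (\<Sum>i=1..n. v (X (real i * ?h n) \<omega>))"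
        proof (intro sum.cong refl)
          fix i assume "i \<in> {1..n}"
          then have "X (real i * ?h n) \<omega> \<in> R" using True by auto
          moreover have "(\<Sum>x\<in>R. v x * indicator {x} (X (real i * ?h n) \<omega>)) =
             (\<Sum>x\<in>R. if X (real i * ?h n) \<omega> = x then v x else 0)"
            by (intro sum.cong refl) (auto simp: indicator_def)
          ultimately show "(\<Sum>x\<in>R. v x * indicator {x} (X (real i * ?h n) \<omega>)) = v (X (real i * ?h n) \<omega>)"
            using assms(1) by simp
        qed
        finally have "exp (- (\<Sum>x\<in>R. v x * ?N n x)) = (\<Prod>i=1..n. exp (- ?h n * v (X (real i * ?h n) \<omega>)))"
          by (simp add: sum_distrib_left sum_negf flip: exp_sum)
        with True elim \<omega> show ?thesis by (simp add: grid_weight_def indicator_def)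
      next
        case False
        then show ?thesis using elim by (auto simp: grid_weight_def)
      qed
    qed
    ultimately have "(\<lambda>n. grid_weight R v (?h n) n \<omega> * indicator ?E \<omega>) \<longlonglongrightarrow> ?L \<omega>"
      by (rule Lim_transform_eventually)
    then show ?thesis by (rule LIMSEQ_Suc)
  qed
  have Lm: "?L \<in> borel_measurable (P a)"
    by (rule borel_measurable_LIMSEQ_real[OF lim wm])
  have "(\<lambda>n. LINT \<omega>|P a. ?w n \<omega>) \<longlonglongrightarrow> (LINT \<omega>|P a. ?L \<omega>)"
  proof (rule integral_dominated_convergence[where w = "\<lambda>_. 1"])
    show "AE \<omega> in P a. norm (?w n \<omega>) \<le> 1" for n
      using grid_weight_bounds[of v "T / real (Suc n)" R "Suc n"] assms(4,5)
      by (intro AE_I2) (auto simp: indicator_def)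
    show "AE \<omega> in P a. (\<lambda>n. ?w n \<omega>) \<longlonglongrightarrow> ?L \<omega>" by (intro AE_I2 lim)
    show "?w n \<in> borel_measurable (P a)" for n by (rule wm)
    show "?L \<in> borel_measurable (P a)" by (rule Lm)
  qed simp
  moreover have "(LINT \<omega>|P a. ?w n \<omega>) = grid_mean R v a (T / real (Suc n)) (Suc n) b" for n
    by (simp add: grid_mean_def del: of_nat_Suc)
  ultimately have "(\<lambda>n. complex_of_real (grid_mean R v a (T / real (Suc n)) (Suc n) b)) \<longlonglongrightarrow> of_real (LINT \<omega>|P a. ?L \<omega>)"
    by (intro tendsto_of_real) simp
  moreover have "(\<lambda>n. complex_of_real (grid_mean R v a (T / real (Suc n)) (Suc n) b)) \<longlonglongrightarrow>
    total_mass R (\<lambda>x y. of_real (A x y - of_bool (x = y) * v x)) a b T"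
    by (rule LIMSEQ_Suc[OF grid_mean_tendsto[OF assms]])
  ultimately show ?thesis by (rule LIMSEQ_unique)
qed

end

section \<open>Uniqueness of Laplace transforms on a box\<close>

text \<open>
Steps are limits of continuous piecewise linear functions, and after the substitution
\<open>y = exp (- s)\<close> Weierstrass approximation on \<open>{exp (- T)..1}\<close> applies. Natural exponents are enough,
and the approximations stay bounded, as dominated convergence requires.
\<close>

lemma real_polynomials_in_exp_approximate_step:
  fixes t T :: real
  assumes "0 < T"
  obtains p :: "nat \<Rightarrow> real \<Rightarrow> real"
  where "\<And>n. \<exists>a N. p n = (\<lambda>s. \<Sum>k\<le>N. a k * exp (- real k * s))"
    and "\<And>n s. s \<in> {0..T} \<Longrightarrow> \<bar>p n s\<bar> \<le> 2"
    and "\<And>s. s \<in> {0..T} \<Longrightarrow> (\<lambda>n. p n s) \<longlonglongrightarrow> indicator {..t} s"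
proof -
  define f where "f n s = max 0 (min 1 (1 - real n * (s - t)))" for n s
  have f01: "0 \<le> f n s" "f n s \<le> 1" for n s by (auto simp: f_def)
  have lim_f: "(\<lambda>n. f n s) \<longlonglongrightarrow> indicator {..t} s" for s
  proof (cases "s \<le> t")
    case True
    have "f n s = 1" for n
    proof -
      have "real n * (s - t) \<le> 0" using True by (simp add: mult_nonneg_nonpos)
      then show ?thesis by (simp add: f_def)
    qed
    then show ?thesis using True by simp
  next
    case False
    obtain m :: nat where m: "1 / (s - t) < real m" using reals_Archimedean2 by blast
    have "\<forall>\<^sub>F n in sequentially. f n s = 0"
      using eventually_ge_at_top[of m]
    proof eventually_elim
      case (elim n)
      have "1 < real m * (s - t)" using m False by (simp add: field_simps)
      also have "\<dots> \<le> real n * (s - t)" using elim False by (intro mult_right_mono) auto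
      finally show ?case by (simp add: f_def)
    qed
    then show ?thesis using False by (simp add: tendsto_eventually)
  qed
  have "\<exists>q. real_polynomial_function q \<and> (\<forall>y\<in>{exp (- T)..1}. \<bar>f n (- ln y) - q y\<bar> < inverse (real (Suc n)))" for n
  proof -
    have pos: "y \<noteq> 0" if "y \<in> {exp (- T)..1}" for y
      using that less_le_trans[OF exp_gt_zero[of "- T"], of y] by (simp only: atLeastAtMost_iff) blast
    have "continuous_on {exp (- T)..1} (\<lambda>y. f n (- ln y))"
      unfolding f_def by (intro continuous_intros ballI pos)
    moreover have "0 < inverse (real (Suc n))" by simp
    ultimately obtain q where "real_polynomial_function q" "\<And>y. y \<in> {exp (- T)..1} \<Longrightarrow> \<bar>f n (- ln y) - q y\<bar> < inverse (real (Suc n))"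
      using Stone_Weierstrass_real_polynomial_function[OF compact_Icc] by metis
    then show ?thesis by blast
  qed
  then obtain q where q: "\<And>n. real_polynomial_function (q n)"
    "\<And>n y. y \<in> {exp (- T)..1} \<Longrightarrow> \<bar>f n (- ln y) - q n y\<bar> < inverse (real (Suc n))" by metis
  have close: "\<bar>f n s - q n (exp (- s))\<bar> < inverse (real (Suc n))" if "s \<in> {0..T}" for n s
    using q(2)[of "exp (- s)" n] that by simp
  show thesis
  proof (rule that[of "\<lambda>n s. q n (exp (- s))"])
    show "\<exists>a N. (\<lambda>s. q n (exp (- s))) = (\<lambda>s. \<Sum>k\<le>N. a k * exp (- real k * s))" for n
    proof -
      obtain a N where "q n = (\<lambda>y. \<Sum>k\<le>N. a k * y ^ k)"
        using q(1)[of n] unfolding real_polynomial_function_iff_sum by blast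
      then show ?thesis by (auto simp: exp_of_nat_mult[symmetric] intro!: exI[of _ a] exI[of _ N])
    qed
    show "\<bar>q n (exp (- s))\<bar> \<le> 2" if "s \<in> {0..T}" for n s
    proof -
      have "inverse (real (Suc n)) \<le> 1" by (simp add: field_simps)
      then show ?thesis using close[OF that, of n] f01[of n s] by linarith
    qed
    show "(\<lambda>n. q n (exp (- s))) \<longlonglongrightarrow> indicator {..t} s" if s: "s \<in> {0..T}" for s
    proof -
      have "(\<lambda>n. q n (exp (- s)) - f n s) \<longlonglongrightarrow> 0"
      proof (rule Lim_null_comparison)
        show "(\<lambda>n. inverse (real (Suc n))) \<longlonglongrightarrow> 0" by (rule LIMSEQ_inverse_real_of_nat)
        show "\<forall>\<^sub>F n in sequentially. norm (q n (exp (- s)) - f n s) \<le> inverse (real (Suc n))"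
        proof (rule always_eventually, rule allI)
          fix n show "norm (q n (exp (- s)) - f n s) \<le> inverse (real (Suc n))"
            using close[OF s, of n] by (simp add: abs_minus_commute)
        qed
      qed
      from tendsto_add[OF this lim_f[of s]] show ?thesis by simp
    qed
  qed
qed

lemma sets_PiM_borel_atMost:
  fixes R :: "'a set"
  assumes "finite R"
  shows "sets (\<Pi>\<^sub>M x\<in>R. (borel :: real measure)) =
    sigma_sets (R \<rightarrow>\<^sub>E UNIV) (range (\<lambda>t. {l \<in> R \<rightarrow>\<^sub>E UNIV. \<forall>x\<in>R. l x \<le> t x}))"
proof -
  let ?E = "\<lambda>_ :: 'a. range (\<lambda>a :: real. {..a})"
  let ?P = "{{f \<in> (\<Pi>\<^sub>E i\<in>R. UNIV). \<forall>i\<in>j. f i \<in> A i} | A j. j \<in> {R} \<and> A \<in> Pi j ?E}"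
  have "sets (\<Pi>\<^sub>M x\<in>R. (borel :: real measure)) = sets (\<Pi>\<^sub>M x\<in>R. sigma UNIV (?E x))"
    by (simp only: borel_eq_atMost)
  also have "\<dots> = sets (sigma (\<Pi>\<^sub>E x\<in>R. UNIV) ?P)"
  proof (rule sets_PiM_sigma)
    show "\<exists>S\<subseteq>range (\<lambda>a :: real. {..a}). countable S \<and> UNIV = \<Union> S"
    proof (intro exI conjI)
      show "range (\<lambda>n :: nat. {..real n}) \<subseteq> range (\<lambda>a. {..a})" by auto
      show "UNIV = (\<Union>n :: nat. {..real n})" by (auto intro: real_arch_simple)
    qed simp
  qed (use assms in auto)
  also have "\<dots> = sigma_sets (R \<rightarrow>\<^sub>E UNIV) ?P" by (rule sets_measure_of) auto
  also have "?P = range (\<lambda>t. {l \<in> R \<rightarrow>\<^sub>E UNIV. \<forall>x\<in>R. l x \<le> t x})"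
  proof (intro set_eqI iffI)
    fix B :: "('a \<Rightarrow> real) set" assume "B \<in> ?P"
    then obtain A where A: "A \<in> Pi R ?E" "B = {f \<in> (\<Pi>\<^sub>E i\<in>R. UNIV). \<forall>i\<in>R. f i \<in> A i}" by auto
    then have "\<forall>x\<in>R. \<exists>a. A x = {..a}" by auto
    then obtain t where "\<forall>x\<in>R. A x = {..t x}" by metis
    then have "B = {l \<in> R \<rightarrow>\<^sub>E UNIV. \<forall>x\<in>R. l x \<le> t x}" unfolding A(2) by auto
    then show "B \<in> range (\<lambda>t. {l \<in> R \<rightarrow>\<^sub>E UNIV. \<forall>x\<in>R. l x \<le> t x})" by blast
  next
    fix B :: "('a \<Rightarrow> real) set" assume "B \<in> range (\<lambda>t. {l \<in> R \<rightarrow>\<^sub>E UNIV. \<forall>x\<in>R. l x \<le> t x})"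
    then obtain t where "B = {l \<in> R \<rightarrow>\<^sub>E UNIV. \<forall>x\<in>R. l x \<le> t x}" by auto
    then show "B \<in> ?P" by (auto intro!: exI[of _ "\<lambda>x. {..t x}"])
  qed
  finally show ?thesis .
qed

text \<open>
The weights \<open>w1\<close> and \<open>w2\<close> are complex, so this compares complex measures. The exponentials are
replaced by indicators of half-lines one coordinate at a time, which reduces the approximation to one
dimension; a Dynkin argument and simple functions do the rest.
\<close>

lemma laplace_transform_unique:
  fixes R :: "'a set" and T :: real
    and Z1 :: "'b \<Rightarrow> 'a \<Rightarrow> real" and Z2 :: "'c \<Rightarrow> 'a \<Rightarrow> real" and w1 :: "'b \<Rightarrow> complex" and w2 :: "'c \<Rightarrow> complex"
    and F :: "('a \<Rightarrow> real) \<Rightarrow> real"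
  assumes "finite R" "0 < T"
    and Z1: "Z1 \<in> measurable M1 (\<Pi>\<^sub>M x\<in>R. borel)" "\<And>\<omega>. \<omega> \<in> space M1 \<Longrightarrow> Z1 \<omega> \<in> R \<rightarrow>\<^sub>E {0..T}"
    and Z2: "Z2 \<in> measurable M2 (\<Pi>\<^sub>M x\<in>R. borel)" "\<And>\<omega>. \<omega> \<in> space M2 \<Longrightarrow> Z2 \<omega> \<in> R \<rightarrow>\<^sub>E {0..T}"
    and w: "integrable M1 w1" "integrable M2 w2"
    and laplace: "\<And>v. (LINT \<omega>|M1. of_real (\<Prod>x\<in>R. exp (- real (v x) * Z1 \<omega> x)) * w1 \<omega>) =
      (LINT \<omega>|M2. of_real (\<Prod>x\<in>R. exp (- real (v x) * Z2 \<omega> x)) * w2 \<omega>)"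
    and F: "F \<in> borel_measurable (\<Pi>\<^sub>M x\<in>R. borel)" "\<And>l. l \<in> R \<rightarrow>\<^sub>E {0..T} \<Longrightarrow> \<bar>F l\<bar> \<le> B"
  shows "integrable M2 (\<lambda>\<omega>. of_real (F (Z2 \<omega>)) * w2 \<omega>)"
    and "(LINT \<omega>|M1. of_real (F (Z1 \<omega>)) * w1 \<omega>) = (LINT \<omega>|M2. of_real (F (Z2 \<omega>)) * w2 \<omega>)"
proof -
  let ?B = "\<Pi>\<^sub>M x\<in>R. (borel :: real measure)"
  let ?K = "R \<rightarrow>\<^sub>E {0..T}"
  define bm where "bm f \<longleftrightarrow> f \<in> borel_measurable ?B \<and> (\<exists>C. \<forall>l\<in>?K. \<bar>f l\<bar> \<le> C)" for f :: "('a \<Rightarrow> real) \<Rightarrow> real"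
  define agree where "agree f \<longleftrightarrow> bm f \<and>
    (LINT \<omega>|M1. of_real (f (Z1 \<omega>)) * w1 \<omega>) = (LINT \<omega>|M2. of_real (f (Z2 \<omega>)) * w2 \<omega>)" for f :: "('a \<Rightarrow> real) \<Rightarrow> real"
  have bmD: "f \<in> borel_measurable ?B" if "bm f" for f using that unfolding bm_def by blast
  have agreeD: "bm f" if "agree f" for f using that unfolding agree_def by blast
  have int_aux: "integrable M (\<lambda>\<omega>. of_real (f (Z \<omega>)) * w \<omega>)"
    if bf: "bm f" and that: "Z \<in> measurable M ?B" "\<And>\<omega>. \<omega> \<in> space M \<Longrightarrow> Z \<omega> \<in> ?K" "integrable M w"
    for f and M :: "'d measure" and Z and w :: "'d \<Rightarrow> complex"
  proof -
    obtain C where C: "\<And>l. l \<in> ?K \<Longrightarrow> \<bar>f l\<bar> \<le> C" using bf unfolding bm_def by blast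
    have fZ: "(\<lambda>\<omega>. f (Z \<omega>)) \<in> borel_measurable M" by (rule measurable_compose[OF that(1) bmD[OF bf]])
    show ?thesis
    proof (rule Bochner_Integration.integrable_bound)
      show "integrable M (\<lambda>\<omega>. of_real C * w \<omega>)" using that(3) by simp
      show "AE \<omega> in M. norm (of_real (f (Z \<omega>)) * w \<omega>) \<le> norm (of_real C * w \<omega>)"
      proof (rule AE_I2)
        fix \<omega> assume "\<omega> \<in> space M"
        from C[OF that(2)[OF this]] have "\<bar>f (Z \<omega>)\<bar> \<le> \<bar>C\<bar>" by linarith
        then show "norm (of_real (f (Z \<omega>)) * w \<omega>) \<le> norm (of_real C * w \<omega>)"
          by (simp add: norm_mult mult_right_mono)
      qed
      show "(\<lambda>\<omega>. of_real (f (Z \<omega>)) * w \<omega>) \<in> borel_measurable M"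
        by (rule borel_measurable_times[OF measurable_compose[OF fZ borel_measurable_of_real] borel_measurable_integrable[OF that(3)]])
    qed
  qed
  have int: "integrable M1 (\<lambda>\<omega>. of_real (f (Z1 \<omega>)) * w1 \<omega>)" "integrable M2 (\<lambda>\<omega>. of_real (f (Z2 \<omega>)) * w2 \<omega>)"
    if "bm f" for f
    using int_aux[OF that Z1 w(1)] int_aux[OF that Z2 w(2)] by auto
  have sum_aux: "(LINT \<omega>|M. of_real (\<Sum>i\<in>I. c i * f i (Z \<omega>)) * w \<omega>) =
      (\<Sum>i\<in>I. of_real (c i) * (LINT \<omega>|M. of_real (f i (Z \<omega>)) * w \<omega>))"
    if "finite I" "\<And>i. i \<in> I \<Longrightarrow> integrable M (\<lambda>\<omega>. of_real (f i (Z \<omega>)) * w \<omega>)"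
    for I :: "'i set" and c and f :: "'i \<Rightarrow> ('a \<Rightarrow> real) \<Rightarrow> real" and M :: "'d measure" and Z and w :: "'d \<Rightarrow> complex"
  proof -
    have "(LINT \<omega>|M. of_real (\<Sum>i\<in>I. c i * f i (Z \<omega>)) * w \<omega>) =
       (LINT \<omega>|M. (\<Sum>i\<in>I. of_real (c i) * (of_real (f i (Z \<omega>)) * w \<omega>)))"
      by (simp add: sum_distrib_right mult.assoc)
    also have "\<dots> = (\<Sum>i\<in>I. LINT \<omega>|M. of_real (c i) * (of_real (f i (Z \<omega>)) * w \<omega>))"
      by (intro Bochner_Integration.integral_sum integrable_mult_right that(2))
    finally show ?thesis by simp
  qed
  have sum: "agree (\<lambda>l. \<Sum>i\<in>I. c i * f i l)" if "finite I" "\<And>i. i \<in> I \<Longrightarrow> agree (f i)" for I :: "'i set" and c f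
  proof -
    have "bm (\<lambda>l. \<Sum>i\<in>I. c i * f i l)"
    proof -
      have "\<forall>i\<in>I. \<exists>C. \<forall>l\<in>?K. \<bar>f i l\<bar> \<le> C" using that(2) unfolding agree_def bm_def by blast
      then obtain C where C: "\<And>i l. i \<in> I \<Longrightarrow> l \<in> ?K \<Longrightarrow> \<bar>f i l\<bar> \<le> C i" by metis
      have "\<bar>\<Sum>i\<in>I. c i * f i l\<bar> \<le> (\<Sum>i\<in>I. \<bar>c i\<bar> * C i)" if "l \<in> ?K" for l
        using C[OF _ that] by (intro order_trans[OF sum_abs] sum_mono) (auto simp: abs_mult intro: mult_left_mono)
      moreover have "(\<lambda>l. \<Sum>i\<in>I. c i * f i l) \<in> borel_measurable ?B"
        by (intro borel_measurable_sum borel_measurable_times borel_measurable_const bmD agreeD that(2))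
      ultimately show ?thesis unfolding bm_def by blast
    qed
    then show ?thesis
      using that(2) sum_aux[of I M1 f Z1 w1 c, OF that(1) int(1)[OF agreeD[OF that(2)]]]
        sum_aux[of I M2 f Z2 w2 c, OF that(1) int(2)[OF agreeD[OF that(2)]]]
      by (simp add: agree_def)
  qed
  have lim_aux: "(\<lambda>n. LINT \<omega>|M. of_real (f n (Z \<omega>)) * w \<omega>) \<longlonglongrightarrow> (LINT \<omega>|M. of_real (g (Z \<omega>)) * w \<omega>)"
    if fm: "\<And>n. f n \<in> borel_measurable ?B" and gm: "g \<in> borel_measurable ?B" and b: "\<And>n l. l \<in> ?K \<Longrightarrow> \<bar>f n l\<bar> \<le> C"
      and fg: "\<And>l. l \<in> ?K \<Longrightarrow> (\<lambda>n. f n l) \<longlonglongrightarrow> g l"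
      and Z: "Z \<in> measurable M ?B" and ZK: "\<And>\<omega>. \<omega> \<in> space M \<Longrightarrow> Z \<omega> \<in> ?K" and wi: "integrable M w"
    for f g C and M :: "'d measure" and Z and w :: "'d \<Rightarrow> complex"
  proof (rule integral_dominated_convergence[where w = "\<lambda>\<omega>. C * norm (w \<omega>)"])
    have m: "(\<lambda>\<omega>. of_real (h (Z \<omega>)) * w \<omega>) \<in> borel_measurable M" if "h \<in> borel_measurable ?B" for h
      by (rule borel_measurable_times[OF measurable_compose[OF measurable_compose[OF Z that] borel_measurable_of_real]
            borel_measurable_integrable[OF wi]])
    show "(\<lambda>\<omega>. of_real (g (Z \<omega>)) * w \<omega>) \<in> borel_measurable M"
      "(\<lambda>\<omega>. of_real (f n (Z \<omega>)) * w \<omega>) \<in> borel_measurable M" for n by (rule m[OF gm], rule m[OF fm])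
    show "integrable M (\<lambda>\<omega>. C * norm (w \<omega>))" using wi by simp
    show "AE \<omega> in M. (\<lambda>n. of_real (f n (Z \<omega>)) * w \<omega>) \<longlonglongrightarrow> of_real (g (Z \<omega>)) * w \<omega>"
      by (intro AE_I2 tendsto_intros fg ZK)
    show "AE \<omega> in M. norm (of_real (f n (Z \<omega>)) * w \<omega>) \<le> C * norm (w \<omega>)" for n
      using b[OF ZK] by (intro AE_I2) (simp add: norm_mult mult_right_mono)
  qed
  have lim: "agree g" if g: "g \<in> borel_measurable ?B" and f: "\<And>n. agree (f n)" and b: "\<And>n l. l \<in> ?K \<Longrightarrow> \<bar>f n l\<bar> \<le> C"
      and fg: "\<And>l. l \<in> ?K \<Longrightarrow> (\<lambda>n. f n l) \<longlonglongrightarrow> g l" for f g C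
  proof -
    have fm: "f n \<in> borel_measurable ?B" for n by (rule bmD[OF agreeD[OF f]])
    have "\<bar>g l\<bar> \<le> C" if "l \<in> ?K" for l
      by (rule LIMSEQ_le_const2[OF tendsto_rabs[OF fg[OF that]]]) (use b[OF that] in auto)
    then have "bm g" using g unfolding bm_def by blast
    moreover have "(LINT \<omega>|M1. of_real (g (Z1 \<omega>)) * w1 \<omega>) = (LINT \<omega>|M2. of_real (g (Z2 \<omega>)) * w2 \<omega>)"
    proof (rule LIMSEQ_unique)
      show "(\<lambda>n. LINT \<omega>|M1. of_real (f n (Z1 \<omega>)) * w1 \<omega>) \<longlonglongrightarrow> (LINT \<omega>|M1. of_real (g (Z1 \<omega>)) * w1 \<omega>)"
        by (rule lim_aux[OF fm g b fg Z1 w(1)])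
      have "(\<lambda>n. LINT \<omega>|M2. of_real (f n (Z2 \<omega>)) * w2 \<omega>) \<longlonglongrightarrow> (LINT \<omega>|M2. of_real (g (Z2 \<omega>)) * w2 \<omega>)"
        by (rule lim_aux[OF fm g b fg Z2 w(2)])
      then show "(\<lambda>n. LINT \<omega>|M1. of_real (f n (Z1 \<omega>)) * w1 \<omega>) \<longlonglongrightarrow> (LINT \<omega>|M2. of_real (g (Z2 \<omega>)) * w2 \<omega>)"
        using f by (simp add: agree_def)
    qed
    ultimately show ?thesis by (simp add: agree_def)
  qed
  have mixed_meas: "(\<lambda>l. (\<Prod>x\<in>D. indicator {..t x} (l x)) * (\<Prod>x\<in>R - D. exp (- real (v x) * l x))) \<in> borel_measurable ?B"
    if "D \<subseteq> R" for D t and v :: "'a \<Rightarrow> nat"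
    using that
    by (intro borel_measurable_times borel_measurable_prod)
      (auto intro!: measurable_compose[OF measurable_component_singleton, of _ R])
  have mixed: "agree (\<lambda>l. (\<Prod>x\<in>D. indicator {..t x} (l x)) * (\<Prod>x\<in>R - D. exp (- real (v x) * l x)))"
    if "finite D" "D \<subseteq> R" for D t and v :: "'a \<Rightarrow> nat"
    using that
  proof (induction D arbitrary: v rule: finite_induct)
    case empty
    have "\<bar>\<Prod>x\<in>R. exp (- real (v x) * l x)\<bar> \<le> 1" if "l \<in> ?K" for l
      using that unfolding abs_prod by (intro prod_le_1) (auto simp: PiE_def Pi_def)
    moreover have "(\<lambda>l. \<Prod>x\<in>R. exp (- real (v x) * l x)) \<in> borel_measurable ?B"
      using mixed_meas[of "{}" t v] by simp
    ultimately have "bm (\<lambda>l. \<Prod>x\<in>R. exp (- real (v x) * l x))" unfolding bm_def by blast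
    with laplace[of v] show ?case by (simp add: agree_def)
  next
    case (insert y D)
    then have y: "y \<in> R" "y \<notin> D" "D \<subseteq> R" by auto
    define rest where "rest l = (\<Prod>x\<in>D. indicator {..t x} (l x)) * (\<Prod>x\<in>R - insert y D. exp (- real (v x) * l x))" for l :: "'a \<Rightarrow> real"
    have rest1: "\<bar>rest l\<bar> \<le> 1" if "l \<in> ?K" for l
    proof -
      have "\<bar>\<Prod>x\<in>D. indicator {..t x} (l x)\<bar> \<le> (1 :: real)"
        unfolding abs_prod by (intro prod_le_1) (auto simp: indicator_def)
      moreover have "\<bar>\<Prod>x\<in>R - insert y D. exp (- real (v x) * l x)\<bar> \<le> 1"
        using that unfolding abs_prod by (intro prod_le_1) (auto simp: PiE_def Pi_def)
      ultimately show ?thesis unfolding rest_def abs_mult by (intro mult_le_one) auto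
    qed
    have split: "(\<Prod>x\<in>D. indicator {..t x} (l x)) * (\<Prod>x\<in>R - D. exp (- real ((v(y := k)) x) * l x)) =
        exp (- real k * l y) * rest l" for k l
    proof -
      have "(\<Prod>x\<in>R - D. g x) = g y * (\<Prod>x\<in>R - insert y D. g x)" for g :: "'a \<Rightarrow> real"
      proof -
        have "R - insert y D = R - D - {y}" by auto
        then show ?thesis using prod.remove[of "R - D" y g] assms(1) y by simp
      qed
      moreover have "(\<Prod>x\<in>R - insert y D. exp (- real ((v(y := k)) x) * l x)) = (\<Prod>x\<in>R - insert y D. exp (- real (v x) * l x))"
        by (intro prod.cong) auto
      ultimately show ?thesis by (simp only: rest_def fun_upd_same mult_ac)
    qed
    have expo: "agree (\<lambda>l. exp (- real k * l y) * rest l)" for k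
      using insert.IH[OF y(3), of "v(y := k)"] by (simp only: split)
    obtain p where p: "\<And>n. \<exists>a N. p n = (\<lambda>s. \<Sum>k\<le>N. a k * exp (- real k * s))"
      "\<And>n s. s \<in> {0..T} \<Longrightarrow> \<bar>p n s\<bar> \<le> 2" "\<And>s. s \<in> {0..T} \<Longrightarrow> (\<lambda>n. p n s) \<longlonglongrightarrow> indicator {..t y} s"
      by (rule real_polynomials_in_exp_approximate_step[OF assms(2), of "t y"]) blast
    have poly: "agree (\<lambda>l. p n (l y) * rest l)" for n
    proof -
      obtain a N where "p n = (\<lambda>s. \<Sum>k\<le>N. a k * exp (- real k * s))" using p(1) by blast
      then have "(\<lambda>l. p n (l y) * rest l) = (\<lambda>l. \<Sum>k\<le>N. a k * (exp (- real k * l y) * rest l))"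
        by (simp add: sum_distrib_right mult.assoc)
      then show ?thesis using sum[of "{..N}" "\<lambda>k l. exp (- real k * l y) * rest l" a] expo by simp
    qed
    have E: "(\<Prod>x\<in>insert y D. indicator {..t x} (l x)) * (\<Prod>x\<in>R - insert y D. exp (- real (v x) * l x)) =
        indicator {..t y} (l y) * rest l" for l
      using insert.hyps by (simp add: rest_def mult.assoc)
    have "agree (\<lambda>l. indicator {..t y} (l y) * rest l)"
    proof (rule lim[of _ "\<lambda>n l. p n (l y) * rest l" 2])
      show "(\<lambda>l. indicator {..t y} (l y) * rest l) \<in> borel_measurable ?B"
        using mixed_meas[OF insert.prems, of t v] by (simp only: E)
      show "\<bar>p n (l y) * rest l\<bar> \<le> 2" if "l \<in> ?K" for n l
      proof -
        have "l y \<in> {0..T}" using that y(1) by (auto simp: PiE_def Pi_def)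
        then have "\<bar>p n (l y)\<bar> * \<bar>rest l\<bar> \<le> 2 * 1" using p(2) rest1[OF that] by (intro mult_mono) auto
        then show ?thesis by (simp add: abs_mult)
      qed
      show "(\<lambda>n. p n (l y) * rest l) \<longlonglongrightarrow> indicator {..t y} (l y) * rest l" if "l \<in> ?K" for l
        using that y(1) by (intro tendsto_intros p(3)) (auto simp: PiE_def Pi_def)
    qed (rule poly)
    then show ?case by (simp only: E)
  qed
  let ?\<Omega> = "R \<rightarrow>\<^sub>E (UNIV :: real set)"
  let ?G = "range (\<lambda>t. {l \<in> ?\<Omega>. \<forall>x\<in>R. l x \<le> t x})"
  have gen: "sets ?B = sigma_sets ?\<Omega> ?G" by (rule sets_PiM_borel_atMost[OF assms(1)])
  have cong: "agree g" if af: "agree f" and gm: "g \<in> borel_measurable ?B" and eq: "\<And>l. l \<in> ?K \<Longrightarrow> f l = g l" for f g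
  proof -
    obtain C where C: "\<And>l. l \<in> ?K \<Longrightarrow> \<bar>f l\<bar> \<le> C" using af unfolding agree_def bm_def by blast
    show ?thesis
    proof (rule lim[of g "\<lambda>_. f" C])
      show "(\<lambda>n :: nat. f l) \<longlonglongrightarrow> g l" if "l \<in> ?K" for l
        unfolding eq[OF that] by (rule tendsto_const)
    qed (rule gm, rule af, rule C)
  qed
  have ind: "agree (indicator S)" if "S \<in> sets ?B" for S
  proof -
    have "S \<in> sigma_sets ?\<Omega> ?G" using that gen by simp
    have Int: "Int_stable ?G"
    proof (rule Int_stableI)
      fix S S' assume "S \<in> ?G" "S' \<in> ?G"
      then obtain t t' where "S = {l \<in> ?\<Omega>. \<forall>x\<in>R. l x \<le> t x}" "S' = {l \<in> ?\<Omega>. \<forall>x\<in>R. l x \<le> t' x}" by auto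
      then have "S \<inter> S' = {l \<in> ?\<Omega>. \<forall>x\<in>R. l x \<le> min (t x) (t' x)}" by auto
      then show "S \<inter> S' \<in> ?G" by (intro image_eqI[where x = "\<lambda>x. min (t x) (t' x)"]) auto
    qed
    have "?G \<subseteq> Pow ?\<Omega>" by auto
    from Int this \<open>S \<in> sigma_sets ?\<Omega> ?G\<close> show ?thesis
    proof (induction rule: sigma_sets_induct_disjoint)
      case (basic S)
      then obtain t where t: "S = {l \<in> ?\<Omega>. \<forall>x\<in>R. l x \<le> t x}" by auto
      show ?case
      proof (rule cong[OF mixed[OF assms(1) subset_refl, of t "\<lambda>_. 0"]])
        have "S \<in> sets ?B" using basic gen by (auto intro: sigma_sets.Basic)
        then show "(indicator S :: _ \<Rightarrow> real) \<in> borel_measurable ?B" by simp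
        fix l assume l: "l \<in> ?K"
        show "(\<Prod>x\<in>R. indicator {..t x} (l x)) * (\<Prod>x\<in>R - R. exp (- real 0 * l x)) = indicator S l"
        proof (cases "\<forall>x\<in>R. l x \<le> t x")
          case True
          then show ?thesis using l by (auto simp: t indicator_def PiE_def)
        next
          case False
          then show ?thesis using assms(1) by (auto simp: t indicator_def intro!: prod_zero)
        qed
      qed
    next
      case empty
      show ?case using sum[of "{} :: nat set"] by simp
    next
      case (compl S)
      have one: "agree (\<lambda>_. 1)"
        by (rule cong[OF mixed[of "{}" undefined "\<lambda>_. 0"]]) auto
      have "agree (\<lambda>l. \<Sum>i\<in>{True, False}. (if i then 1 else - 1) * (if i then (\<lambda>_. 1) else indicator S) l)"
        by (rule sum) (use one compl in auto)
      then show ?case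
      proof (rule cong)
        have "?\<Omega> - S \<in> sets ?B" using compl.hyps gen by (auto intro: sigma_sets.Compl)
        then show "(indicator (?\<Omega> - S) :: _ \<Rightarrow> real) \<in> borel_measurable ?B" by simp
      qed (auto simp: indicator_def PiE_def)
    next
      case (union S)
      have "agree (\<lambda>l. \<Sum>i<n. 1 * indicator (S i) l)" for n
        by (rule sum) (use union in auto)
      then show ?case
      proof (rule lim[of _ "\<lambda>n l. \<Sum>i<n. 1 * indicator (S i) l" 1, rotated])
        have "(\<Union>i. S i) \<in> sets ?B" unfolding gen using union.hyps by (intro sigma_sets.Union) auto
        then show "(indicator (\<Union>i. S i) :: _ \<Rightarrow> real) \<in> borel_measurable ?B" by simp
        have disj: "(\<Sum>i<n. 1 * indicator (S i) l) = (indicator (\<Union>i<n. S i) l :: real)" for n l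
          using union.hyps(1) by (simp add: indicator_UN_disjoint disjoint_family_on_mono[OF subset_UNIV])
        show "\<bar>\<Sum>i<n. 1 * indicator (S i) l\<bar> \<le> (1 :: real)" for n l
          unfolding disj by (simp add: indicator_def)
        show "(\<lambda>n. \<Sum>i<n. 1 * indicator (S i) l) \<longlonglongrightarrow> (indicator (\<Union>i. S i) l :: real)" for l
          unfolding disj by (rule LIMSEQ_indicator_UN)
      qed
    qed
  qed
  have "bm F" using F unfolding bm_def by blast
  then show "integrable M2 (\<lambda>\<omega>. of_real (F (Z2 \<omega>)) * w2 \<omega>)" by (rule int)
  obtain s where s: "\<And>i. simple_function ?B (s i)" "\<And>l. l \<in> space ?B \<Longrightarrow> (\<lambda>i. s i l) \<longlonglongrightarrow> F l"
    "\<And>i l. l \<in> space ?B \<Longrightarrow> dist (s i l) 0 \<le> 2 * dist (F l) 0"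
    using borel_measurable_implies_sequence_metric[OF F(1), of 0] by metis
  have K: "l \<in> space ?B" if "l \<in> ?K" for l using that by (auto simp: space_PiM PiE_def)
  have "agree F"
  proof (rule lim[of _ s "2 * B"])
    show "agree (s i)" for i
    proof (rule cong)
      show "agree (\<lambda>l. \<Sum>y\<in>s i ` space ?B. y * indicator (s i -` {y} \<inter> space ?B) l)"
        using s(1)[of i] by (intro sum ind) (auto simp: simple_function_def)
      show "s i \<in> borel_measurable ?B" using s(1) by (rule borel_measurable_simple_function)
      fix l assume "l \<in> ?K"
      from K[OF this] have "(\<Sum>y\<in>s i ` space ?B. y * indicator (s i -` {y} \<inter> space ?B) l) =
          (\<Sum>y\<in>s i ` space ?B. if s i l = y then y else 0)"
        by (intro sum.cong refl) (auto simp: indicator_def)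
      also have "\<dots> = s i l" using s(1)[of i] K[OF \<open>l \<in> ?K\<close>] by (simp add: simple_function_def)
      finally show "(\<Sum>y\<in>s i ` space ?B. y * indicator (s i -` {y} \<inter> space ?B) l) = s i l" .
    qed
    show "\<bar>s i l\<bar> \<le> 2 * B" if "l \<in> ?K" for i l
      using s(3)[OF K[OF that], of i] F(2)[OF that] by simp
  qed (rule F(1), rule s(2), rule K)
  then show "(LINT \<omega>|M1. of_real (F (Z1 \<omega>)) * w1 \<omega>) = (LINT \<omega>|M2. of_real (F (Z2 \<omega>)) * w2 \<omega>)"
    by (simp add: agree_def)
qed

section \<open>The law of the local times\<close>

lemma rate_killed:
  assumes "finite R" "x \<in> R"
  shows "rate R (\<lambda>x y. M x y - of_bool (x = y) * k x) \<theta> x = rate R M \<theta> x - k x"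
proof -
  have "(\<Sum>y\<in>R. (M x y - of_bool (x = y) * k x) * cis (- \<theta> y)) =
      (\<Sum>y\<in>R. M x y * cis (- \<theta> y)) - (\<Sum>y\<in>R. if x = y then k x * cis (- \<theta> y) else 0)"
    unfolding sum_subtractf[symmetric] by (intro sum.cong refl) (auto simp: algebra_simps)
  also have "(\<Sum>y\<in>R. if x = y then k x * cis (- \<theta> y) else 0) = k x * cis (- \<theta> x)"
    using assms by simp
  finally have "rate R (\<lambda>x y. M x y - of_bool (x = y) * k x) \<theta> x = rate R M \<theta> x - k x * (cis (\<theta> x) * cis (- \<theta> x))"
    using assms(2) by (simp add: rate_def right_diff_distrib mult_ac)
  then show ?thesis by (simp add: cis_mult)
qed

text \<open>
Killing shifts \<open>rate\<close> and the diagonal of the matrix by the same amount, so the phase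
matrix does not change.
\<close>

lemma phase_density_killed:
  assumes "finite R"
  shows "phase_density R (\<lambda>x y. M x y - of_bool (x = y) * of_real (v x)) a b l =
    of_real (exp (- (\<Sum>x\<in>R. v x * l x))) * phase_density R M a b l"
proof -
  let ?M = "\<lambda>x y. M x y - of_bool (x = y) * of_real (v x)"
  have cof: "cofactor_on R a b (phase_matrix R ?M \<theta>) = cofactor_on R a b (phase_matrix R M \<theta>)" for \<theta>
    by (rule cofactor_on_cong) (auto simp: phase_matrix_def rate_killed[OF assms])
  have exp: "phase_exp R ?M l \<theta> = of_real (exp (- (\<Sum>x\<in>R. v x * l x))) * phase_exp R M l \<theta>" for \<theta>
  proof -
    have "(\<Sum>x\<in>R. of_real (l x) * rate R ?M \<theta> x) = (\<Sum>x\<in>R. of_real (l x) * rate R M \<theta> x) - of_real (\<Sum>x\<in>R. v x * l x)"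
      unfolding of_real_sum sum_subtractf[symmetric]
      by (intro sum.cong refl) (simp only: rate_killed[OF assms], simp add: algebra_simps)
    then show ?thesis
      unfolding phase_exp_def by (simp only:) (simp add: exp_diff exp_minus exp_of_real[symmetric] divide_inverse)
  qed
  show ?thesis
    unfolding phase_density_def cof exp
    by (simp add: mult.left_commute flip: integral_mult_right_zero)
qed

context continuous_time_markov_chain
begin

lemma local_time_bounds:
  assumes "\<omega> \<in> space (P a)" "0 < T"
  shows "0 \<le> local_time X T \<omega> x" "local_time X T \<omega> x \<le> T"
proof -
  let ?s = "\<lambda>n. T / real n * (\<Sum>i=1..n. indicator {x} (X (real i * (T / real n)) \<omega>))"
  note lim = local_time_limit[OF assms, of x]
  have "0 \<le> ?s n" for n using assms(2) by (intro mult_nonneg_nonneg sum_nonneg) auto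
  then show "0 \<le> local_time X T \<omega> x" using LIMSEQ_le_const[OF lim] by blast
  have "?s n \<le> T" for n
  proof (cases "n = 0")
    case False
    have "(\<Sum>i=1..n. indicator {x} (X (real i * (T / real n)) \<omega>)) \<le> (\<Sum>i=1..n. 1 :: real)"
      by (intro sum_mono) (auto simp: indicator_def)
    then have "?s n \<le> T / real n * real n" using assms(2) by (intro mult_left_mono) auto
    then show ?thesis using False by simp
  qed (use assms in simp)
  then show "local_time X T \<omega> x \<le> T" using LIMSEQ_le_const2[OF lim] by blast
qed

lemma local_time_eq_0_if_not_visited:
  assumes "x \<notin> (\<lambda>s. X s \<omega>) ` {0..T}"
  shows "local_time X T \<omega> x = 0"
proof -
  have "indicator {0..T} s *\<^sub>R (indicator {x} (X s \<omega>) :: real) = 0" for s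
    using assms by (auto simp: indicator_def)
  then show ?thesis
    unfolding local_time_def set_lebesgue_integral_def by (simp only: Bochner_Integration.integral_zero)
qed

lemma sum_local_time:
  assumes "\<omega> \<in> space (P a)" "0 < T" "finite R" "(\<lambda>s. X s \<omega>) ` {0..T} \<subseteq> R"
  shows "(\<Sum>x\<in>R. local_time X T \<omega> x) = T"
proof (rule LIMSEQ_unique)
  let ?s = "\<lambda>n x. T / real n * (\<Sum>i=1..n. indicator {x} (X (real i * (T / real n)) \<omega>))"
  show "(\<lambda>n. \<Sum>x\<in>R. ?s n x) \<longlonglongrightarrow> (\<Sum>x\<in>R. local_time X T \<omega> x)"
    by (intro tendsto_sum local_time_limit[OF assms(1,2)])
  have "\<forall>\<^sub>F n in sequentially. (\<Sum>x\<in>R. ?s n x) = T"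
    using eventually_gt_at_top[of 0]
  proof eventually_elim
    case (elim n)
    have "(\<Sum>x\<in>R. ?s n x) = T / real n * (\<Sum>i=1..n. \<Sum>x\<in>R. indicator {x} (X (real i * (T / real n)) \<omega>))"
      by (subst sum.swap) (rule sum_distrib_left[symmetric])
    also have "(\<Sum>i=1..n. \<Sum>x\<in>R. indicator {x} (X (real i * (T / real n)) \<omega>)) = (\<Sum>i=1..n. 1 :: real)"
    proof (intro sum.cong refl)
      fix i assume "i \<in> {1..n}"
      then have "real i * (T / real n) \<in> {0..T}" using assms(2) elim by (auto simp: field_simps)
      then have "X (real i * (T / real n)) \<omega> \<in> R" using assms(4) by blast
      moreover have "(\<Sum>x\<in>R. indicator {x} (X (real i * (T / real n)) \<omega>)) =
          (\<Sum>x\<in>R. if X (real i * (T / real n)) \<omega> = x then 1 else 0 :: real)"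
        by (intro sum.cong refl) (auto simp: indicator_def)
      ultimately show "(\<Sum>x\<in>R. indicator {x} (X (real i * (T / real n)) \<omega>)) = (1 :: real)"
        using assms(3) by simp
    qed
    finally show ?case using elim by simp
  qed
  then show "(\<lambda>n. \<Sum>x\<in>R. ?s n x) \<longlonglongrightarrow> T" by (rule tendsto_eventually)
qed

lemma sets_visited_eq:
  assumes "0 < T" "finite R"
  shows "{\<omega> \<in> space (P a). X T \<omega> = b \<and> (\<lambda>s. X s \<omega>) ` {0..T} = R} \<in> sets (P a)"
proof -
  let ?S = "\<lambda>R. {\<omega> \<in> space (P a). \<forall>s\<in>{0..T}. X s \<omega> \<in> R}"
  have "{\<omega> \<in> space (P a). X T \<omega> = b \<and> (\<lambda>s. X s \<omega>) ` {0..T} = R} =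
      {\<omega> \<in> space (P a). X T \<omega> = b} \<inter> (?S R - (\<Union>x\<in>R. ?S (R - {x})))"
    by (intro set_eqI iffI) (force, fastforce)
  also have "\<dots> \<in> sets (P a)"
    using assms by (intro sets.Int sets.Diff sets.finite_UN sets_stays sets_X_eq) auto
  finally show ?thesis .
qed

text \<open>
Both sides, summed over all subsets of \<open>R\<close>, agree by \<open>laplace_transform_stays\<close>; by induction
they agree on the proper subsets. A site outside the visited set has local time zero, so the exponent
may be restricted to the range.
\<close>

lemma laplace_transform_range:
  assumes "finite R" "0 < T" and v: "\<And>x. 0 \<le> v x"
  shows "complex_of_real (LINT \<omega>|P a. exp (- (\<Sum>x\<in>R. v x * local_time X T \<omega> x)) *
      of_bool (X T \<omega> = b \<and> (\<lambda>s. X s \<omega>) ` {0..T} = R)) =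
    simplex_mass R (\<lambda>x y. of_real (A x y - of_bool (x = y) * v x)) a b T"
  using assms(1)
proof (induction R rule: finite_psubset_induct)
  case (psubset R)
  interpret prob_space "P a" by (rule prob_space_P)
  let ?M = "\<lambda>x y. complex_of_real (A x y - of_bool (x = y) * v x)"
  let ?f = "\<lambda>R \<omega>. exp (- (\<Sum>x\<in>R. v x * local_time X T \<omega> x)) * of_bool (X T \<omega> = b \<and> (\<lambda>s. X s \<omega>) ` {0..T} = R)"
  show ?case
  proof (cases "a \<in> R \<and> b \<in> R")
    case False
    have "AE \<omega> in P a. ?f R \<omega> = 0"
      using start[of a]
    proof eventually_elim
      case (elim \<omega>)
      have "X 0 \<omega> \<in> (\<lambda>s. X s \<omega>) ` {0..T}" "X T \<omega> \<in> (\<lambda>s. X s \<omega>) ` {0..T}" using assms(2) by auto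
      with elim False have "\<not> (X T \<omega> = b \<and> (\<lambda>s. X s \<omega>) ` {0..T} = R)" by metis
      then show ?case by simp
    qed
    then have "(LINT \<omega>|P a. ?f R \<omega>) = 0" by (rule integral_eq_zero_AE)
    with False show ?thesis by (auto simp: simplex_mass_def)
  next
    case True
    have int: "integrable (P a) (?f R')" if "R' \<subseteq> R" for R'
    proof (rule integrable_const_bound[where B = 1])
      have R': "finite R'" using that psubset.hyps finite_subset by blast
      have "(\<lambda>\<omega>. exp (- (\<Sum>x\<in>R'. v x * local_time X T \<omega> x)) *
          indicator {\<omega> \<in> space (P a). X T \<omega> = b \<and> (\<lambda>s. X s \<omega>) ` {0..T} = R'} \<omega>) \<in> borel_measurable (P a)"
        using local_time_measurable[OF assms(2)] sets_visited_eq[OF assms(2) R'] by measurable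
      then show "?f R' \<in> borel_measurable (P a)"
        by (rule measurable_cong[THEN iffD1, rotated]) (simp add: indicator_def)
      show "AE \<omega> in P a. norm (?f R' \<omega>) \<le> 1"
      proof (rule AE_I2)
        fix \<omega> assume "\<omega> \<in> space (P a)"
        then have "0 \<le> (\<Sum>x\<in>R'. v x * local_time X T \<omega> x)"
          using v local_time_bounds(1) assms(2) by (intro sum_nonneg mult_nonneg_nonneg) auto
        then show "norm (?f R' \<omega>) \<le> 1" by simp
      qed
    qed
    have split: "exp (- (\<Sum>x\<in>R. v x * local_time X T \<omega> x)) * of_bool (X T \<omega> = b \<and> (\<forall>s\<in>{0..T}. X s \<omega> \<in> R)) =
        (\<Sum>R'\<in>Pow R. ?f R' \<omega>)" for \<omega>
    proof (cases "(\<lambda>s. X s \<omega>) ` {0..T} \<subseteq> R")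
      case True
      let ?I = "(\<lambda>s. X s \<omega>) ` {0..T}"
      have "(\<Sum>x\<in>R. v x * local_time X T \<omega> x) = (\<Sum>x\<in>?I. v x * local_time X T \<omega> x)"
        using psubset.hyps True local_time_eq_0_if_not_visited[of _ \<omega> T]
        by (intro sum.mono_neutral_right) auto
      moreover have "(\<Sum>R'\<in>Pow R. ?f R' \<omega>) =
          (\<Sum>R'\<in>Pow R. if ?I = R' then exp (- (\<Sum>x\<in>?I. v x * local_time X T \<omega> x)) * of_bool (X T \<omega> = b) else 0)"
        by (intro sum.cong refl) auto
      ultimately show ?thesis using True psubset.hyps by (auto simp: image_subset_iff)
    next
      case False
      then have "\<not> (\<forall>s\<in>{0..T}. X s \<omega> \<in> R)" by auto
      moreover have "(\<Sum>R'\<in>Pow R. ?f R' \<omega>) = 0" using False by (intro sum.neutral) auto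
      ultimately show ?thesis by simp
    qed
    have "total_mass R ?M a b T = complex_of_real (LINT \<omega>|P a. (\<Sum>R'\<in>Pow R. ?f R' \<omega>))"
      using laplace_transform_stays[of R a b T v] psubset.hyps True assms(2) v by (simp only: split)
    also have "\<dots> = (\<Sum>R'\<in>Pow R. complex_of_real (LINT \<omega>|P a. ?f R' \<omega>))"
      using int by (subst Bochner_Integration.integral_sum) auto
    also have "\<dots> = complex_of_real (LINT \<omega>|P a. ?f R \<omega>) + (\<Sum>R'\<in>Pow R - {R}. complex_of_real (LINT \<omega>|P a. ?f R' \<omega>))"
      using psubset.hyps by (intro sum.remove) auto
    also have "(\<Sum>R'\<in>Pow R - {R}. complex_of_real (LINT \<omega>|P a. ?f R' \<omega>)) = (\<Sum>R'\<in>Pow R - {R}. simplex_mass R' ?M a b T)"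
      by (intro sum.cong refl psubset.IH) auto
    finally have "total_mass R ?M a b T = complex_of_real (LINT \<omega>|P a. ?f R \<omega>) + (\<Sum>R'\<in>Pow R - {R}. simplex_mass R' ?M a b T)" .
    moreover have "total_mass R ?M a b T = simplex_mass R ?M a b T + (\<Sum>R'\<in>Pow R - {R}. simplex_mass R' ?M a b T)"
      unfolding total_mass_def using psubset.hyps by (intro sum.remove) auto
    ultimately show ?thesis by simp
  qed
qed

text \<open>
The event is phrased with the set of visited sites, which can exceed the support of the local times by
the end point \<open>b\<close>. The right-hand side lives on strictly positive \<open>l\<close>, so this exceptional case
is automatically a null event.
\<close>

lemma local_time_law:
  fixes F :: "('a \<Rightarrow> real) \<Rightarrow> real"
  assumes "finite R" "a \<in> R" "b \<in> R" "0 < T"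
    and F: "F \<in> borel_measurable (\<Pi>\<^sub>M x\<in>R. borel)" "\<And>l. \<bar>F l\<bar> \<le> B"
  defines "\<rho> \<equiv> phase_density R (\<lambda>x y. of_real (A x y)) a b"
  shows "integrable (simplex_measure R T) (\<lambda>l. of_real (F l) * \<rho> l)"
    and "complex_of_real (LINT \<omega>|P a. F (restrict (local_time X T \<omega>) R) * of_bool (X T \<omega> = b \<and> (\<lambda>s. X s \<omega>) ` {0..T} = R)) =
      (LINT l|simplex_measure R T. of_real (F l) * \<rho> l)"
proof -
  interpret prob_space "P a" by (rule prob_space_P)
  let ?w = "\<lambda>\<omega>. of_bool (X T \<omega> = b \<and> (\<lambda>s. X s \<omega>) ` {0..T} = R) :: complex"
  let ?Z = "\<lambda>\<omega>. restrict (local_time X T \<omega>) R"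
  have Z: "?Z \<in> measurable (P a) (\<Pi>\<^sub>M x\<in>R. borel)"
    by (rule measurable_restrict) (rule local_time_measurable[OF assms(4)])
  have ZK: "?Z \<omega> \<in> R \<rightarrow>\<^sub>E {0..T}" if "\<omega> \<in> space (P a)" for \<omega>
    using local_time_bounds[OF that assms(4)] by (intro PiE_I) auto
  have id: "(\<lambda>l. l) \<in> measurable (simplex_measure R T) (\<Pi>\<^sub>M x\<in>R. borel)"
    unfolding measurable_cong_sets[OF sets_simplex_measure refl] by (rule measurable_restrict_space1) simp
  have idK: "l \<in> R \<rightarrow>\<^sub>E {0..T}" if "l \<in> space (simplex_measure R T)" for l
    using that pos_simplex_bounds[OF assms(1), of l T]
    by (auto simp: space_simplex_measure pos_simplex_def PiE_def Pi_def intro: less_imp_le)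
  have w: "integrable (P a) ?w"
  proof (rule integrable_const_bound[where B = 1])
    have "(\<lambda>\<omega>. indicator {\<omega> \<in> space (P a). X T \<omega> = b \<and> (\<lambda>s. X s \<omega>) ` {0..T} = R} \<omega> :: complex) \<in> borel_measurable (P a)"
      using sets_visited_eq[OF assms(4,1)] by (rule borel_measurable_indicator)
    then show "?w \<in> borel_measurable (P a)"
      by (rule measurable_cong[THEN iffD1, rotated]) (simp add: indicator_def)
  qed simp
  have \<rho>: "integrable (simplex_measure R T) \<rho>"
    unfolding \<rho>_def by (rule simplex_mass_eq_integral_density(2)) (use assms in auto)
  have laplace: "(LINT \<omega>|P a. of_real (\<Prod>x\<in>R. exp (- real (v x) * ?Z \<omega> x)) * ?w \<omega>) =
      (LINT l|simplex_measure R T. of_real (\<Prod>x\<in>R. exp (- real (v x) * l x)) * \<rho> l)" for v :: "'a \<Rightarrow> nat"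
  proof -
    let ?M = "\<lambda>x y. complex_of_real (A x y - of_bool (x = y) * real (v x))"
    have prod: "(\<Prod>x\<in>R. exp (- real (v x) * l x)) = exp (- (\<Sum>x\<in>R. real (v x) * l x))" for l :: "'a \<Rightarrow> real"
      using assms(1) by (simp add: exp_sum sum_negf[symmetric])
    have "(LINT \<omega>|P a. of_real (\<Prod>x\<in>R. exp (- real (v x) * ?Z \<omega> x)) * ?w \<omega>) =
      (LINT \<omega>|P a. complex_of_real (exp (- (\<Sum>x\<in>R. real (v x) * local_time X T \<omega> x)) *
        of_bool (X T \<omega> = b \<and> (\<lambda>s. X s \<omega>) ` {0..T} = R)))"
      unfolding prod by (intro Bochner_Integration.integral_cong refl) (simp cong: sum.cong)
    also have "\<dots> = simplex_mass R ?M a b T"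
      unfolding integral_complex_of_real by (rule laplace_transform_range) (use assms in auto)
    also have "\<dots> = (LINT l|simplex_measure R T. phase_density R ?M a b l)"
      by (rule simplex_mass_eq_integral_density(1)) (use assms in auto)
    also have "\<dots> = (LINT l|simplex_measure R T. of_real (\<Prod>x\<in>R. exp (- real (v x) * l x)) * \<rho> l)"
    proof -
      have M: "?M = (\<lambda>x y. complex_of_real (A x y) - of_bool (x = y) * of_real (real (v x)))"
        by (simp add: fun_eq_iff)
      show ?thesis unfolding M phase_density_killed[OF assms(1)] prod \<rho>_def ..
    qed
    finally show ?thesis .
  qed
  note unique = laplace_transform_unique[OF assms(1,4) Z ZK id idK w \<rho> laplace F]
  show "integrable (simplex_measure R T) (\<lambda>l. of_real (F l) * \<rho> l)" by (rule unique(1))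
  have "complex_of_real (LINT \<omega>|P a. F (?Z \<omega>) * of_bool (X T \<omega> = b \<and> (\<lambda>s. X s \<omega>) ` {0..T} = R)) =
      (LINT \<omega>|P a. of_real (F (?Z \<omega>)) * ?w \<omega>)"
    unfolding integral_complex_of_real[symmetric] by (intro Bochner_Integration.integral_cong refl) simp
  also have "\<dots> = (LINT l|simplex_measure R T. of_real (F l) * \<rho> l)" by (rule unique(2))
  finally show "complex_of_real (LINT \<omega>|P a. F (?Z \<omega>) * of_bool (X T \<omega> = b \<and> (\<lambda>s. X s \<omega>) ` {0..T} = R)) =
      (LINT l|simplex_measure R T. of_real (F l) * \<rho> l)" .
qed

lemma chain_range_eq_iff:
  assumes "\<omega> \<in> space (P a)" "0 < T" "finite R" "X T \<omega> \<in> R"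
  shows "chain_range X T \<omega> = R \<longleftrightarrow>
    (\<lambda>s. X s \<omega>) ` {0..T} = R \<and> restrict (local_time X T \<omega>) R \<in> pos_simplex R T"
proof -
  have img: "(\<lambda>s. X s \<omega>) ` {0..T} = insert (X T \<omega>) (chain_range X T \<omega>)"
    by (rule image_eq_insert_chain_range[of X \<omega> T]) (rule right_continuous[OF assms(1)], assumption, rule assms(2))
  show ?thesis
  proof
    assume cr: "chain_range X T \<omega> = R"
    then have im: "(\<lambda>s. X s \<omega>) ` {0..T} = R" using img assms(4) by auto
    have "0 < local_time X T \<omega> x" if "x \<in> R" for x
      using that cr local_time_bounds(1)[OF assms(1,2), of x] by (force simp: chain_range_def)
    moreover have "(\<Sum>x\<in>R. local_time X T \<omega> x) = T"
      using sum_local_time[OF assms(1-3)] im by simp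
    ultimately show "(\<lambda>s. X s \<omega>) ` {0..T} = R \<and> restrict (local_time X T \<omega>) R \<in> pos_simplex R T"
      using im by (simp add: pos_simplex_iff)
  next
    assume "(\<lambda>s. X s \<omega>) ` {0..T} = R \<and> restrict (local_time X T \<omega>) R \<in> pos_simplex R T"
    then have "\<forall>x\<in>R. 0 < local_time X T \<omega> x" "chain_range X T \<omega> \<subseteq> R"
      using img by (auto simp: pos_simplex_iff)
    then show "chain_range X T \<omega> = R" by (force simp: chain_range_def)
  qed
qed

end

theorem theorem2p1:
  fixes A :: "'a::countable \<Rightarrow> 'a \<Rightarrow> real"
    and P :: "'a \<Rightarrow> 'w measure"
    and X :: "real \<Rightarrow> 'w \<Rightarrow> 'a"
    and R :: "'a set" and a b :: 'a and T :: real
    and F :: "('a \<Rightarrow> real) \<Rightarrow> real"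
  assumes "\<exists>x y :: 'a. x \<noteq> y"
    and "continuous_time_markov_chain A P X"
    and "finite R" and "a \<in> R" and "b \<in> R"
    and "0 < T"
    and "F \<in> borel_measurable (restrict_space (\<Pi>\<^sub>M x\<in>R. borel) (pos_simplex R T))"
    and "bounded (F ` pos_simplex R T)"
  shows "integrable (simplex_measure R T)
           (\<lambda>l. complex_of_real (F l) * local_time_density A R a b l) \<and>
         complex_of_real
           (LINT \<omega>|P a. F (restrict (local_time X T \<omega>) R) *
              indicator {\<omega>. X T \<omega> = b} \<omega> * indicator {\<omega>. chain_range X T \<omega> = R} \<omega>) =
         (LINT l|simplex_measure R T. complex_of_real (F l) * local_time_density A R a b l)"
proof -
  interpret continuous_time_markov_chain A P X by fact
  let ?\<rho> = "phase_density R (\<lambda>x y. of_real (A x y)) a b"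
  \<comment> \<open>The extension by zero discards the paths that first reach \<open>b\<close> at time \<open>T\<close>.\<close>
  define G where "G l = (if l \<in> pos_simplex R T then F l else 0)" for l
  have G: "G \<in> borel_measurable (\<Pi>\<^sub>M x\<in>R. borel)"
  proof -
    have "pos_simplex R T \<inter> space (\<Pi>\<^sub>M x\<in>R. (borel :: real measure)) \<in> sets (\<Pi>\<^sub>M x\<in>R. borel)"
      by (rule sets.Int[OF pos_simplex_measurable[OF assms(3)] sets.top])
    moreover have "(0 :: real) \<in> space borel" by simp
    ultimately have "(\<lambda>l. if l \<in> pos_simplex R T then F l else 0) \<in> borel_measurable (\<Pi>\<^sub>M x\<in>R. borel)"
      using assms(7) by (rule measurable_restrict_space_iff[THEN iffD1])
    then show ?thesis unfolding G_def[abs_def] .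
  qed
  obtain B where B: "\<And>l. l \<in> pos_simplex R T \<Longrightarrow> \<bar>F l\<bar> \<le> B"
    using assms(8) unfolding bounded_iff by (metis imageI real_norm_def)
  have "\<bar>G l\<bar> \<le> \<bar>B\<bar>" for l using B[of l] by (auto simp: G_def)
  note law = local_time_law[OF assms(3-6) G this]
  have cong: "of_real (G l) * ?\<rho> l = complex_of_real (F l) * local_time_density A R a b l"
    if "l \<in> space (simplex_measure R T)" for l
    using that pos_simplex_bounds(1)[OF assms(3), of l T] assms(3)
    by (simp add: space_simplex_measure G_def local_time_density_eq_phase_density)
  have "integrable (simplex_measure R T) (\<lambda>l. complex_of_real (F l) * local_time_density A R a b l)"
    using law(1) by (simp add: cong cong: Bochner_Integration.integrable_cong)
  moreover have "(LINT l|simplex_measure R T. of_real (G l) * ?\<rho> l) =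
      (LINT l|simplex_measure R T. complex_of_real (F l) * local_time_density A R a b l)"
    by (rule Bochner_Integration.integral_cong[OF refl cong])
  moreover have "(LINT \<omega>|P a. F (restrict (local_time X T \<omega>) R) *
        indicator {\<omega>. X T \<omega> = b} \<omega> * indicator {\<omega>. chain_range X T \<omega> = R} \<omega>) =
      (LINT \<omega>|P a. G (restrict (local_time X T \<omega>) R) * of_bool (X T \<omega> = b \<and> (\<lambda>s. X s \<omega>) ` {0..T} = R))"
  proof (rule Bochner_Integration.integral_cong[OF refl])
    fix \<omega> assume "\<omega> \<in> space (P a)"
    from chain_range_eq_iff[OF this assms(6,3)] assms(5)
    show "F (restrict (local_time X T \<omega>) R) * indicator {\<omega>. X T \<omega> = b} \<omega> * indicator {\<omega>. chain_range X T \<omega> = R} \<omega> =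
        G (restrict (local_time X T \<omega>) R) * of_bool (X T \<omega> = b \<and> (\<lambda>s. X s \<omega>) ` {0..T} = R)"
      by (auto simp: indicator_def G_def)
  qed
  ultimately show ?thesis using law(2) by simp
qed

end
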